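(* Let $J$ be a bounded half-line Jacobi matrix, let $N_j\to\infty$ be a sequence along which the limits described in the context exist, with associated $\gamma$, $dk$, $A=\lim_{j\to\infty}(a(1)\cdots a(N_j))^{1/N_j}$. Let $K$ be the topological support (smallest closed support) of $dk$ and $Z=\{t\in\mathbb{R}:\gamma(t)=0\}$. Then $Z\supset\Sigma_{ac}(J)$ (up to sets of Lebesgue measure zero) and $\overline{Z}^{\mathrm{ess}}\supset \sigma_{ac}(J)$, and $$\overline{Z}^{\mathrm{ess}} \subset K \subset \sigma_{\mathrm{cap}}(J) , \qquad \operatorname{cap}(Z) \le A \le \operatorname{cap}(K) .$$
   Context: $|\cdot|$ is Lebesgue measure; $\operatorname{cap}$ denotes logarithmic capacity. For a Borel set $S\subset\mathbb{R}$: $\overline{S}^{\mathrm{ess}}=\{x\in\mathbb{R}:|S\cap(x-h,x+h)|>0\text{ for all }h>0\}$ and $S_{\mathrm{cap}}=\{x\in\mathbb{R}:\operatorname{cap}(S\cap(x-h,x+h))>0\text{ for all }h>0\}$; $\sigma_{\mathrm{cap}}(J)$ is the latter set for $S=\sigma(J)$, the spectrum of $J$. With $d\rho(t)=d\|E(t)\delta_1\|^2$ the spectral measure of $J$ ($E$ the spectral resolution of $J$), $\Sigma_{ac}(J)$ is an essential support of the absolutely continuous part of $\rho$, defined up to Lebesgue null sets, e.g. $\{t:d\rho/dt>0\}$, and $\sigma_{ac}(J)=\overline{\Sigma_{ac}}^{\mathrm{ess}}$. Setting: a Herglotz function is a holomorphic map of $\mathbb{C}^+=\{z\in\mathbb{C}:\operatorname{Im}z>0\}$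 to itself. $J$ is a half-line Jacobi matrix on $\ell_2(\mathbb{Z}_+)$, $\mathbb{Z}_+=\{1,2,\dots\}$: $(Ju)(n)=a(n)u(n+1)+a(n-1)u(n-1)+b(n)u(n)$ (term with $u(n-1)$ omitted for $n=1$), with real coefficients satisfying $(M+1)^{-1}\le a(n)\le M+1$, $|b(n)|\le M$ for some $M>0$. Put $a(0)=1$. For $z\in\mathbb{C}^+$ let $f_\pm(n,z)$ be the solutions of $a(n)f(n+1)+a(n-1)f(n-1)+b(n)f(n)=zf(n)$ ($n\ge1$) with $f_-(0,z)=0$, $f_-(1,z)=1$, $f_+(0,z)=1$, $f_+(1,z)=-\langle\delta_1,(J-z)^{-1}\delta_1\rangle$. Then $f_\pm(n,z)\ne0$ for $n\ge1$ and $z\mapsto\mp f_\pm(n+1,z)/f_\pm(n,z)$ are Herglotz functions. With the logarithm satisfying $\operatorname{Im}\ln\zeta\in(0,\pi)$ for $\zeta\in\mathbb{C}^+$, put $$w_\pm^{(N)}(z)=\frac1N\sum_{n=1}^N\ln\left[\mp\frac{f_\pm(n+1,z)}{f_\pm(n,z)}\right],\qquad g_N(z)=\frac1N\sum_{n=1}^N\langle\delta_n,(J-z)^{-1}\delta_n\rangle=\int_{\mathbb{R}}\frac{d\nu_N(t)}{t-z},$$ $d\nu_N(t)=\frac1N\sum_{n=1}^N d\|E(t)\delta_n\|^2$, and $dk_N=\frac1N\sum_{n=1}^N\delta_{\lambda_n^{(N)}}$, where $\lambda_1^{(N)},\dots,\lambda_N^{(N)}$ are the eigenvalues of the truncation of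 $J$ to $\ell_2(\{1,\dots,N\})$ (boundary conditions $u(0)=u(N+1)=0$). $N_j\to\infty$ is a fixed (otherwise arbitrary) sequence such that, as $j\to\infty$, $w_\pm^{(N_j)}\to w_\pm$ and $g_{N_j}\to g$ uniformly on compact subsets of $\mathbb{C}^+$ with Herglotz limits, $\nu_{N_j}$ and $dk_{N_j}$ converge in weak $*$ sense to probability measures, and $(a(1)\cdots a(N_j))^{1/N_j}\to A>0$. Write $w_+=-\gamma+i\pi k$ with $\gamma,k$ real valued on $\mathbb{C}^+$, and put $\gamma(t)=\lim_{y\to0+}\gamma(t+iy)$, $k(t)=\lim_{y\to0+}k(t+iy)$ for $t\in\mathbb{R}$ (these limits exist for every $t$, and $k(t)$ is increasing). The measure $dk$ is also the weak $*$ limit of $dk_{N_j}$ and $\nu_{N_j}$. *)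

theory Defs
  imports
    "HOL-Probability.Probability"
    "Jordan_Normal_Form.Char_Poly"
begin

section \<open>Logarithmic capacity and closures of subsets of the line\<close>

text \<open>The kernel \<open>ln (1 / |x - y|)\<close>; the diagonal is separate because \<open>ln 0 = 0\<close> in HOL.\<close>

definition log_kernel :: "real \<Rightarrow> real \<Rightarrow> ereal" where
  "log_kernel x y = (if x = y then \<infinity> else ereal (- ln \<bar>x - y\<bar>))"

text \<open>Positive part minus negative part (\<open>e2ennreal\<close> sends negative values to 0). For a finite
  measure of compact support the negative part is finite, so no \<open>\<infinity> - \<infinity>\<close> arises.\<close>

definition log_energy :: "real measure \<Rightarrow> ereal" where
  "log_energy \<mu> =
     enn2ereal (\<integral>\<^sup>+x. (\<integral>\<^sup>+y. e2ennreal (log_kernel x y) \<partial>\<mu>) \<partial>\<mu>)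
   - enn2ereal (\<integral>\<^sup>+x. (\<integral>\<^sup>+y. e2ennreal (- log_kernel x y) \<partial>\<mu>) \<partial>\<mu>)"

definition compact_prob_on :: "real set \<Rightarrow> real measure set" where
  "compact_prob_on S =
     {\<mu>. prob_space \<mu> \<and> sets \<mu> = sets borel \<and>
         (\<exists>C. compact C \<and> C \<subseteq> S \<and> emeasure \<mu> (- C) = 0)}"

text \<open>\<open>cap S = sup exp (- I \<mu>)\<close> over the probability measures with compact support in \<open>S\<close>, where
  \<open>exp (- \<infinity>) = 0\<close>; in particular \<open>cap {} = 0\<close>.\<close>

definition log_capacity :: "real set \<Rightarrow> ennreal" where
  "log_capacity S =
     (SUP \<mu>\<in>compact_prob_on S.
        if log_energy \<mu> = \<infinity> then 0 else ennreal (exp (- real_of_ereal (log_energy \<mu>))))"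

definition ess_closure :: "real set \<Rightarrow> real set" where
  "ess_closure S = {x. \<forall>h>0. emeasure lborel (S \<inter> {x - h<..<x + h}) > 0}"

definition cap_closure :: "real set \<Rightarrow> real set" where
  "cap_closure S = {x. \<forall>h>0. log_capacity (S \<inter> {x - h<..<x + h}) > 0}"


section \<open>Measures on the line\<close>

definition topological_support :: "real measure \<Rightarrow> real set" where
  "topological_support \<mu> = \<Inter> {C. closed C \<and> emeasure \<mu> (- C) = 0}"

text \<open>Weak-* convergence in the dual of \<open>C\<^sub>0(\<real>)\<close>.\<close>

definition weak_star_tendsto :: "(nat \<Rightarrow> real measure) \<Rightarrow> real measure \<Rightarrow> bool" where
  "weak_star_tendsto M \<mu> \<longleftrightarrow>
     (\<forall>f :: real \<Rightarrow> real. continuous_on UNIV f \<and> (f \<longlongrightarrow> 0) at_infinity \<longrightarrow>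
        (\<lambda>j. \<integral>t. f t \<partial>M j) \<longlonglongrightarrow> (\<integral>t. f t \<partial>\<mu>))"

definition lebesgue_decomposition ::
    "real measure \<Rightarrow> real measure \<Rightarrow> real measure \<Rightarrow> bool" where
  "lebesgue_decomposition \<mu> \<mu>ac \<mu>s \<longleftrightarrow>
     sets \<mu>ac = sets borel \<and> sets \<mu>s = sets borel \<and>
     (\<forall>A\<in>sets borel. emeasure \<mu> A = emeasure \<mu>ac A + emeasure \<mu>s A) \<and>
     absolutely_continuous lborel \<mu>ac \<and>
     (\<exists>B\<in>sets borel. emeasure lborel B = 0 \<and> emeasure \<mu>s (- B) = 0)"

text \<open>A Borel set carrying the absolutely continuous part, minimal up to Lebesgue null sets; such
  sets are unique up to null sets, and \<open>{t. d\<mu>/dt > 0}\<close> is one of them.\<close>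

definition ess_support_ac :: "real measure \<Rightarrow> real set \<Rightarrow> bool" where
  "ess_support_ac \<mu> S \<longleftrightarrow>
     S \<in> sets borel \<and>
     (\<exists>\<mu>ac \<mu>s. lebesgue_decomposition \<mu> \<mu>ac \<mu>s \<and> emeasure \<mu>ac (- S) = 0 \<and>
        (\<forall>T\<in>sets borel. emeasure \<mu>ac (- T) = 0 \<longrightarrow> emeasure lborel (S - T) = 0))"


section \<open>Operators on the sequence space over the positive integers\<close>

text \<open>Sequences indexed by \<open>{1, 2, \<dots>}\<close> are functions on \<open>nat\<close> that vanish at 0.\<close>

type_synonym cseq = "nat \<Rightarrow> complex"

definition ell2 :: "cseq set" where
  "ell2 = {u. u 0 = 0 \<and> summable (\<lambda>n. (cmod (u n))\<^sup>2)}"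

definition ell2_inner :: "cseq \<Rightarrow> cseq \<Rightarrow> complex" where
  "ell2_inner u v = (\<Sum>n. cnj (u n) * v n)"

definition ell2_norm :: "cseq \<Rightarrow> real" where
  "ell2_norm u = sqrt (\<Sum>n. (cmod (u n))\<^sup>2)"

definition delta :: "nat \<Rightarrow> cseq" where
  "delta n = (\<lambda>k. if k = n then 1 else 0)"

definition shifted :: "(cseq \<Rightarrow> cseq) \<Rightarrow> complex \<Rightarrow> cseq \<Rightarrow> cseq" where
  "shifted T z u = (\<lambda>n. T u n - z * u n)"

definition resolvent_set :: "(cseq \<Rightarrow> cseq) \<Rightarrow> complex set" where
  "resolvent_set T =
     {z. bij_betw (shifted T z) ell2 ell2 \<and>
         (\<exists>C. \<forall>u\<in>ell2. ell2_norm u \<le> C * ell2_norm (shifted T z u))}"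

definition resolvent :: "(cseq \<Rightarrow> cseq) \<Rightarrow> complex \<Rightarrow> cseq \<Rightarrow> cseq" where
  "resolvent T z = inv_into ell2 (shifted T z)"

text \<open>The real part of the spectrum, which for a self-adjoint operator is all of it.\<close>

definition real_spectrum :: "(cseq \<Rightarrow> cseq) \<Rightarrow> real set" where
  "real_spectrum T = {t. complex_of_real t \<notin> resolvent_set T}"

definition orthogonal_projection :: "(cseq \<Rightarrow> cseq) \<Rightarrow> bool" where
  "orthogonal_projection P \<longleftrightarrow>
     (\<forall>u\<in>ell2. P u \<in> ell2 \<and> P (P u) = P u) \<and>
     (\<forall>u\<in>ell2. \<forall>v\<in>ell2. \<forall>c d. P (\<lambda>n. c * u n + d * v n) = (\<lambda>n. c * P u n + d * P v n)) \<and>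
     (\<forall>u\<in>ell2. \<forall>v\<in>ell2. ell2_inner u (P v) = ell2_inner (P u) v)"

text \<open>The measure \<open>d\<parallel>E(t) u\<parallel>\<^sup>2\<close>.\<close>

definition spectral_measure :: "(real set \<Rightarrow> cseq \<Rightarrow> cseq) \<Rightarrow> cseq \<Rightarrow> real measure" where
  "spectral_measure E u = measure_of UNIV (sets borel) (\<lambda>A. ennreal ((ell2_norm (E A u))\<^sup>2))"

text \<open>\<open>E\<close> is a projection-valued Borel measure (strongly countably additive, \<open>E \<real> = 1\<close>) with
  \<open>T = \<integral> t dE(t)\<close>, stated through quadratic forms, which determine \<open>T\<close> by polarization.\<close>

definition spectral_resolution ::
    "(cseq \<Rightarrow> cseq) \<Rightarrow> (real set \<Rightarrow> cseq \<Rightarrow> cseq) \<Rightarrow> bool" where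
  "spectral_resolution T E \<longleftrightarrow>
     (\<forall>A\<in>sets borel. orthogonal_projection (E A)) \<and>
     (\<forall>u\<in>ell2. E UNIV u = u) \<and>
     (\<forall>A :: nat \<Rightarrow> real set. range A \<subseteq> sets borel \<longrightarrow> disjoint_family A \<longrightarrow>
        (\<forall>u\<in>ell2.
          (\<lambda>m. ell2_norm (\<lambda>k. (\<Sum>i<m. E (A i) u k) - E (\<Union>i. A i) u k)) \<longlonglongrightarrow> 0)) \<and>
     (\<forall>u\<in>ell2. integrable (spectral_measure E u) (\<lambda>t. t\<^sup>2) \<and>
        ell2_inner u (T u) = complex_of_real (\<integral>t. t \<partial>spectral_measure E u))"


section \<open>Jacobi matrices\<close>

definition jacobi_op :: "(nat \<Rightarrow> real) \<Rightarrow> (nat \<Rightarrow> real) \<Rightarrow> cseq \<Rightarrow> cseq" where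
  "jacobi_op a b u =
     (\<lambda>n. if n = 0 then 0
          else of_real (a n) * u (n + 1)
             + (if n = 1 then 0 else of_real (a (n - 1)) * u (n - 1))
             + of_real (b n) * u n)"

text \<open>The values \<open>a 0\<close> and \<open>b 0\<close> do not enter \<open>jacobi_op\<close>; \<open>a 0 = 1\<close> is the convention for the
  difference equation at \<open>n = 1\<close>.\<close>

definition bounded_jacobi :: "(nat \<Rightarrow> real) \<Rightarrow> (nat \<Rightarrow> real) \<Rightarrow> bool" where
  "bounded_jacobi a b \<longleftrightarrow>
     a 0 = 1 \<and>
     (\<exists>M>0. \<forall>n\<ge>1. inverse (M + 1) \<le> a n \<and> a n \<le> M + 1 \<and> \<bar>b n\<bar> \<le> M)"

text \<open>The solution of \<open>a(n) f(n+1) + a(n-1) f(n-1) + b(n) f(n) = z f(n)\<close>, \<open>n \<ge> 1\<close>, with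
  \<open>f(0) = c\<close> and \<open>f(1) = d\<close>.\<close>

fun jacobi_sol ::
    "(nat \<Rightarrow> real) \<Rightarrow> (nat \<Rightarrow> real) \<Rightarrow> complex \<Rightarrow> complex \<Rightarrow> complex \<Rightarrow> nat \<Rightarrow> complex" where
  "jacobi_sol a b z c d 0 = c"
| "jacobi_sol a b z c d (Suc 0) = d"
| "jacobi_sol a b z c d (Suc (Suc n)) =
     ((z - of_real (b (Suc n))) * jacobi_sol a b z c d (Suc n)
      - of_real (a n) * jacobi_sol a b z c d n) / of_real (a (Suc n))"

definition green :: "(nat \<Rightarrow> real) \<Rightarrow> (nat \<Rightarrow> real) \<Rightarrow> nat \<Rightarrow> complex \<Rightarrow> complex" where
  "green a b n z = ell2_inner (delta n) (resolvent (jacobi_op a b) z (delta n))"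

definition f_minus :: "(nat \<Rightarrow> real) \<Rightarrow> (nat \<Rightarrow> real) \<Rightarrow> nat \<Rightarrow> complex \<Rightarrow> complex" where
  "f_minus a b n z = jacobi_sol a b z 0 1 n"

definition f_plus :: "(nat \<Rightarrow> real) \<Rightarrow> (nat \<Rightarrow> real) \<Rightarrow> nat \<Rightarrow> complex \<Rightarrow> complex" where
  "f_plus a b n z = jacobi_sol a b z 1 (- green a b 1 z) n"

text \<open>The quotients below lie in the open upper half plane for \<open>Im z > 0\<close>, and there the principal
  branch \<open>Ln\<close> has imaginary part in \<open>(0, \<pi>)\<close>.\<close>

definition w_plus_avg :: "(nat \<Rightarrow> real) \<Rightarrow> (nat \<Rightarrow> real) \<Rightarrow> nat \<Rightarrow> complex \<Rightarrow> complex" where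
  "w_plus_avg a b N z =
     1 / of_nat N * (\<Sum>n=1..N. Ln (- (f_plus a b (n + 1) z / f_plus a b n z)))"

definition w_minus_avg :: "(nat \<Rightarrow> real) \<Rightarrow> (nat \<Rightarrow> real) \<Rightarrow> nat \<Rightarrow> complex \<Rightarrow> complex" where
  "w_minus_avg a b N z =
     1 / of_nat N * (\<Sum>n=1..N. Ln (f_minus a b (n + 1) z / f_minus a b n z))"

definition g_avg :: "(nat \<Rightarrow> real) \<Rightarrow> (nat \<Rightarrow> real) \<Rightarrow> nat \<Rightarrow> complex \<Rightarrow> complex" where
  "g_avg a b N z = 1 / of_nat N * (\<Sum>n=1..N. green a b n z)"

definition nu_avg :: "(real set \<Rightarrow> cseq \<Rightarrow> cseq) \<Rightarrow> nat \<Rightarrow> real measure" where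
  "nu_avg E N =
     measure_of UNIV (sets borel)
       (\<lambda>A. ennreal (1 / real N) * (\<Sum>n=1..N. emeasure (spectral_measure E (delta n)) A))"

text \<open>Rows and columns of \<open>Matrix.mat\<close> are numbered from 0, so entry \<open>(i, j)\<close> belongs to the
  sites \<open>i + 1\<close> and \<open>j + 1\<close>.\<close>

definition truncation :: "(nat \<Rightarrow> real) \<Rightarrow> (nat \<Rightarrow> real) \<Rightarrow> nat \<Rightarrow> real mat" where
  "truncation a b N =
     Matrix.mat N N
       (\<lambda>(i, j). if i = j then b (i + 1)
                 else if j = i + 1 then a (i + 1)
                 else if i = j + 1 then a (j + 1)
                 else 0)"

text \<open>The uniform distribution on the eigenvalues, counted with multiplicity (for \<open>N \<ge> 1\<close>).\<close>

definition eigenvalue_dist :: "(nat \<Rightarrow> real) \<Rightarrow> (nat \<Rightarrow> real) \<Rightarrow> nat \<Rightarrow> real measure" where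
  "eigenvalue_dist a b N =
     distr (measure_pmf (pmf_of_multiset (proots (char_poly (truncation a b N))))) borel (\<lambda>t. t)"


section \<open>Herglotz limits and their boundary values\<close>

definition upper_half_plane :: "complex set" where
  "upper_half_plane = {z. Im z > 0}"

definition herglotz :: "(complex \<Rightarrow> complex) \<Rightarrow> bool" where
  "herglotz f \<longleftrightarrow> f holomorphic_on upper_half_plane \<and> f ` upper_half_plane \<subseteq> upper_half_plane"

definition locally_uniform_limit :: "(nat \<Rightarrow> complex \<Rightarrow> complex) \<Rightarrow> (complex \<Rightarrow> complex) \<Rightarrow> bool" where
  "locally_uniform_limit F f \<longleftrightarrow>
     (\<forall>C. compact C \<and> C \<subseteq> upper_half_plane \<longrightarrow> uniform_limit C F f sequentially)"

text \<open>Boundary values of \<open>\<gamma>\<close> and \<open>k\<close>, where \<open>w = - \<gamma> + i \<pi> k\<close>.\<close>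

definition gamma_bdry :: "(complex \<Rightarrow> complex) \<Rightarrow> real \<Rightarrow> real" where
  "gamma_bdry w t = Lim (at_right 0) (\<lambda>y. - Re (w (Complex t y)))"

definition k_bdry :: "(complex \<Rightarrow> complex) \<Rightarrow> real \<Rightarrow> real" where
  "k_bdry w t = Lim (at_right 0) (\<lambda>y. Im (w (Complex t y)) / pi)"

definition dk_measure :: "(complex \<Rightarrow> complex) \<Rightarrow> real measure" where
  "dk_measure w = interval_measure (k_bdry w)"

end

theory Submission imports Defs
begin

text \<open>
  Constancy of the Wronskian reads \<open>- 1 / G\<^sub>n = a(n) (r\<^sub>+ + r\<^sub>-)\<close>, where \<open>G\<^sub>n\<close> is the diagonal Green function and
  \<open>r\<^sub>\<plusminus>\<close> are the two Herglotz quotients; hence \<open>w\<^sub>+ + w\<^sub>- = \<i> \<pi>\<close>. Since \<open>f\<^sub>-(N + 1, \<cdot>)\<close> is the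
  characteristic polynomial of the truncation divided by \<open>a(1) \<dots> a(N)\<close>, this gives
  \<open>w\<^sub>+(z) = \<i> \<pi> + ln A - \<integral> ln (z - s) d\<kappa>(s)\<close> for the limit \<open>\<kappa>\<close> of the eigenvalue distributions.
  The solution \<open>f\<^sub>+\<close> is bounded, so \<open>Re w\<^sub>+ \<le> 0\<close>; therefore \<open>\<kappa>\<close> has no atoms and equals \<open>dk\<close>, and
  \<open>\<gamma>(t) = \<integral> ln \<bar>t - s\<bar> d\<kappa>(s) - ln A \<ge> 0\<close> for every real \<open>t\<close>.

  Thus the energy of \<open>\<kappa>\<close> is at most \<open>- ln A\<close>, which yields \<open>A \<le> cap K\<close> and positive capacity near each
  point of \<open>K\<close>; positive definiteness of the logarithmic kernel yields \<open>cap Z \<le> A\<close>. In a gap of \<open>K\<close>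
  the function \<open>\<gamma>\<close> is strictly concave, so it has at most two zeros there. In a gap of the
  spectrum of \<open>J\<close> every truncation has at most one eigenvalue, so \<open>K\<close> does not meet the gap.

  For the absolutely continuous spectrum, \<open>f\<^sub>-(n, \<cdot>)\<close> is the density of \<open>\<langle>\<delta>\<^sub>n, E(\<cdot>) \<delta>\<^sub>1\<rangle>\<close> with respect to
  \<open>\<rho>\<close>, hence bounded in \<open>L\<^sup>1(\<rho>)\<close>, and \<open>f\<^sub>-(n, t)\<close> grows at most polynomially in \<open>n\<close> for \<open>\<rho>\<close>-almost
  every \<open>t\<close>. Fatou's lemma applied to the potentials of the eigenvalue distributions then gives
  \<open>\<gamma> \<le> 0\<close> at Lebesgue-almost every such \<open>t\<close>.
\<close>

text \<open>Weak convergence of the eigenvalue distributions controls potentials in one direction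
  only: for the nonnegative kernel \<open>ln (D / |t - s|)\<close> the potential of the limit is at
  most the lower limit of the potentials. The absolutely continuous part needs the other direction:
  at a point of polynomial growth the eigenvalue potentials are asymptotically at least
  \<open>ln D - ln A\<close>, and this bound has to be carried over to the potential of \<kappa>.
  Weak convergence does not give this pointwise. It does after integration over a bounded Borel set,
  because the part of the kernel with \<open>|t - s| \<le> \<epsilon>\<close> has Lebesgue integral
  at most \<open>2 * \<epsilon>\<close> for every \<open>s\<close>; this is where the exceptional
  null set comes from.

  A measure competing for the capacity of \<open>Z\<close> may have infinite energy. Energies are
  therefore computed in \<open>ennreal\<close> with the kernel \<open>ln (D / |x - y|)\<close>,
  where \<open>D\<close> is at least the distances that occur; for a probability measure this only
  shifts the energy by \<open>ln D\<close>. Inequalities are kept as sums, and only finite constants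
  are cancelled.\<close>

section \<open>The Wronskian of two solutions\<close>

definition jacobi_eq :: "(nat \<Rightarrow> real) \<Rightarrow> (nat \<Rightarrow> real) \<Rightarrow> complex \<Rightarrow> cseq \<Rightarrow> bool" where
  "jacobi_eq a b z f \<longleftrightarrow>
     (\<forall>n. of_real (a (Suc n)) * f (Suc (Suc n)) + of_real (a n) * f n + of_real (b (Suc n)) * f (Suc n)
          = z * f (Suc n))"

lemma Im_div_pos:
  assumes "Im (u * cnj v) > 0"
  shows "v \<noteq> 0" "u \<noteq> 0" "Im (u / v) = Im (u * cnj v) / (cmod v)\<^sup>2" "Im (u / v) > 0"
proof -
  show nz: "v \<noteq> 0" "u \<noteq> 0" using assms by auto
  have "u / v = u * cnj v / of_real ((cmod v)\<^sup>2)"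
    using nz by (simp add: complex_norm_square del: of_real_power)
  then show *: "Im (u / v) = Im (u * cnj v) / (cmod v)\<^sup>2"
    by (metis Im_divide_of_real)
  show "Im (u / v) > 0" unfolding * using nz assms by simp
qed

locale jacobi_coeffs =
  fixes a b :: "nat \<Rightarrow> real" and M :: real
  assumes a_0 [simp]: "a 0 = 1" and M_pos: "M > 0"
    and a_ge: "n \<ge> 1 \<Longrightarrow> inverse (M + 1) \<le> a n"
    and a_le_M: "n \<ge> 1 \<Longrightarrow> a n \<le> M + 1"
    and b_le: "n \<ge> 1 \<Longrightarrow> \<bar>b n\<bar> \<le> M"
begin

lemma a_pos [simp]: "a n > 0"
proof (cases "n \<ge> 1")
  case True
  have "0 < inverse (M + 1)" using M_pos by simp
  then show ?thesis using a_ge[OF True] by linarith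
next
  case False
  then have "n = 0" by simp
  then show ?thesis by simp
qed

lemma a_nz [simp]: "a n \<noteq> 0"
  using a_pos[of n] by linarith

lemma a_nonneg [simp]: "0 \<le> a n"
  using a_pos[of n] by (rule less_imp_le)

lemma a_le: "a n \<le> M + 1"
  using a_le_M[of n] M_pos by (cases n) auto

lemma prod_a_pos [simp]: "(\<Prod>n=1..N. a n) > 0"
  by (intro prod_pos) auto

lemma jacobi_eq_sol: "jacobi_eq a b z (jacobi_sol a b z c d)"
  unfolding jacobi_eq_def by (simp add: field_simps)

lemma jacobi_eq_unique:
  assumes "jacobi_eq a b z f" "jacobi_eq a b z g" "f 0 = g 0" "f 1 = g 1"
  shows "f n = g n"
proof (induction n rule: induct_nat_012)
  case (ge2 n)
  have "of_real (a (Suc n)) * f (Suc (Suc n)) + of_real (a n) * f n + of_real (b (Suc n)) * f (Suc n)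
    = of_real (a (Suc n)) * g (Suc (Suc n)) + of_real (a n) * g n + of_real (b (Suc n)) * g (Suc n)"
    using assms(1,2)[unfolded jacobi_eq_def, rule_format, of n] ge2 by simp
  then show ?case using ge2 by simp
qed (use assms in auto)

lemma jacobi_eq_lin:
  assumes "jacobi_eq a b z f" "jacobi_eq a b z g"
  shows "jacobi_eq a b z (\<lambda>n. c * f n + d * g n)"
  unfolding jacobi_eq_def
proof
  fix n
  have "of_real (a (Suc n)) * (c * f (Suc (Suc n)) + d * g (Suc (Suc n))) + of_real (a n) * (c * f n + d * g n)
     + of_real (b (Suc n)) * (c * f (Suc n) + d * g (Suc n))
     = c * (of_real (a (Suc n)) * f (Suc (Suc n)) + of_real (a n) * f n + of_real (b (Suc n)) * f (Suc n))
     + d * (of_real (a (Suc n)) * g (Suc (Suc n)) + of_real (a n) * g n + of_real (b (Suc n)) * g (Suc n))"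
    by (simp add: algebra_simps)
  also have "\<dots> = c * (z * f (Suc n)) + d * (z * g (Suc n))"
    using assms unfolding jacobi_eq_def by simp
  finally show "of_real (a (Suc n)) * (c * f (Suc (Suc n)) + d * g (Suc (Suc n))) + of_real (a n) * (c * f n + d * g n)
     + of_real (b (Suc n)) * (c * f (Suc n) + d * g (Suc n)) = z * (c * f (Suc n) + d * g (Suc n))"
    by (simp add: algebra_simps)
qed

lemma wronskian_step:
  assumes f: "jacobi_eq a b z f" and g: "jacobi_eq a b w g"
  shows "of_real (a (Suc n)) * (f (Suc (Suc n)) * g (Suc n) - f (Suc n) * g (Suc (Suc n)))
       = of_real (a n) * (f (Suc n) * g n - f n * g (Suc n)) + (z - w) * f (Suc n) * g (Suc n)"
proof -
  have "of_real (a (Suc n)) * f (Suc (Suc n)) = z * f (Suc n) - of_real (a n) * f n - of_real (b (Suc n)) * f (Suc n)"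
    "of_real (a (Suc n)) * g (Suc (Suc n)) = w * g (Suc n) - of_real (a n) * g n - of_real (b (Suc n)) * g (Suc n)"
    using f g unfolding jacobi_eq_def by (simp_all add: eq_diff_eq add_ac)
  then have "of_real (a (Suc n)) * f (Suc (Suc n)) * g (Suc n) - f (Suc n) * (of_real (a (Suc n)) * g (Suc (Suc n)))
     = (z * f (Suc n) - of_real (a n) * f n - of_real (b (Suc n)) * f (Suc n)) * g (Suc n)
     - f (Suc n) * (w * g (Suc n) - of_real (a n) * g n - of_real (b (Suc n)) * g (Suc n))"
    by simp
  then show ?thesis by (simp add: algebra_simps)
qed

text \<open>The step identity telescopes. It serves in three ways: with \<open>w = z\<close> the
  Wronskian is constant, with \<open>w = cnj z\<close> it produces sums of squares, and with two
  eigenvalues of a truncation the boundary terms vanish and it gives orthogonality.\<close>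

lemma wronskian_sum:
  assumes f: "jacobi_eq a b z f" and g: "jacobi_eq a b w g"
  shows "of_real (a n) * (f (Suc n) * g n - f n * g (Suc n))
       = (f 1 * g 0 - f 0 * g 1) + (z - w) * (\<Sum>k=1..n. f k * g k)"
proof (induction n)
  case (Suc n)
  have "(\<Sum>k=1..Suc n. f k * g k) = (\<Sum>k=1..n. f k * g k) + f (Suc n) * g (Suc n)" by simp
  then show ?case unfolding wronskian_step[OF f g, of n] Suc by (simp add: algebra_simps)
qed auto

lemma jacobi_eq_cnj: "jacobi_eq a b z f \<Longrightarrow> jacobi_eq a b (cnj z) (\<lambda>n. cnj (f n))"
  unfolding jacobi_eq_def
proof
  fix n
  assume "\<forall>n. of_real (a (Suc n)) * f (Suc (Suc n)) + of_real (a n) * f n + of_real (b (Suc n)) * f (Suc n)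
          = z * f (Suc n)"
  from arg_cong[OF this[rule_format, of n], of cnj]
  show "of_real (a (Suc n)) * cnj (f (Suc (Suc n))) + of_real (a n) * cnj (f n) + of_real (b (Suc n)) * cnj (f (Suc n))
          = cnj z * cnj (f (Suc n))" by simp
qed

text \<open>The conjugate of \<open>f\<close> solves the equation at \<open>cnj z\<close>, and the
  Wronskian of the two is purely imaginary. The signs in \<open>fm_wronskian_pos\<close> and
  \<open>fp_wronskian_neg\<close> are read off from this identity.\<close>

lemma im_wronskian:
  assumes f: "jacobi_eq a b z f"
  shows "a n * Im (f (Suc n) * cnj (f n)) = Im (f 1 * cnj (f 0)) + Im z * (\<Sum>k=1..n. (cmod (f k))\<^sup>2)"
proof -
  have "of_real (a n) * (f (Suc n) * cnj (f n) - f n * cnj (f (Suc n)))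
       = (f 1 * cnj (f 0) - f 0 * cnj (f 1)) + (z - cnj z) * (\<Sum>k=1..n. f k * cnj (f k))"
    by (rule wronskian_sum[OF f jacobi_eq_cnj[OF f]])
  moreover have "(\<Sum>k=1..n. f k * cnj (f k)) = of_real (\<Sum>k=1..n. (cmod (f k))\<^sup>2)"
    by (simp add: complex_norm_square [symmetric] del: of_real_power)
  moreover have "u * cnj v - v * cnj u = 2 * \<i> * of_real (Im (u * cnj v))" for u v
    by (simp add: complex_eq_iff)
  moreover have "z - cnj z = 2 * \<i> * of_real (Im z)"
    by (simp add: complex_eq_iff)
  ultimately have "of_real (a n) * (2 * \<i> * of_real (Im (f (Suc n) * cnj (f n)))) =
     2 * \<i> * of_real (Im (f 1 * cnj (f 0))) + 2 * \<i> * of_real (Im z) * of_real (\<Sum>k=1..n. (cmod (f k))\<^sup>2)"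
    by metis
  from arg_cong[OF this, of Im] have "2 * (a n * Im (f (Suc n) * cnj (f n)))
    = 2 * (Im (f 1 * cnj (f 0)) + Im z * (\<Sum>k=1..n. (cmod (f k))\<^sup>2))"
    by (simp add: algebra_simps)
  then show ?thesis by (metis mult_left_cancel zero_neq_numeral)
qed

section \<open>Orthogonal polynomials and the eigenvalues of the truncations\<close>

abbreviation "fm \<equiv> f_minus a b"

lemma fm_eq: "jacobi_eq a b z (\<lambda>n. fm n z)"
  unfolding f_minus_def by (rule jacobi_eq_sol)

lemma fm_0 [simp]: "fm 0 z = 0" and fm_1 [simp]: "fm (Suc 0) z = 1"
  by (simp_all add: f_minus_def)

lemma fm_cnj: "fm n (cnj z) = cnj (fm n z)"
  by (rule jacobi_eq_unique[OF fm_eq jacobi_eq_cnj[OF fm_eq]]) auto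

lemma fm_wronskian_pos:
  assumes "Im z > 0" "n \<ge> 1"
  shows "a n * Im (fm (Suc n) z * cnj (fm n z)) > 0"
proof -
  have "1 \<le> (\<Sum>k=1..n. (cmod (fm k z))\<^sup>2)"
    using member_le_sum[of 1 "{1..n}" "\<lambda>k. (cmod (fm k z))\<^sup>2"] assms by simp
  then have "0 < Im z * (\<Sum>k=1..n. (cmod (fm k z))\<^sup>2)" using assms by auto
  then show ?thesis unfolding im_wronskian[OF fm_eq] by simp
qed

lemma fm_nz:
  assumes "Im z > 0" shows "fm (Suc n) z \<noteq> 0"
  using fm_wronskian_pos[OF assms, of "Suc n"] by auto

lemma fm_root_real:
  assumes "fm (Suc n) z = 0" shows "Im z = 0"
proof (rule ccontr)
  assume "Im z \<noteq> 0"
  then consider "Im z > 0" | "Im (cnj z) > 0" by force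
  then show False
    using fm_nz[of z n] fm_nz[of "cnj z" n] assms by cases (auto simp: fm_cnj)
qed

text \<open>By \<open>fm_cnj\<close> the values on the real axis are real, so \<open>Re\<close> only
  changes the type.\<close>

definition fr :: "nat \<Rightarrow> real \<Rightarrow> real" where "fr n t = Re (fm n (of_real t))"

lemma fm_of_real: "fm n (of_real t) = of_real (fr n t)"
  using fm_cnj[of n "of_real t"] unfolding fr_def by (simp add: complex_eq_iff)

lemma fr_0 [simp]: "fr 0 t = 0" and fr_1 [simp]: "fr (Suc 0) t = 1"
  by (simp_all add: fr_def)

lemma fr_rec: "a (Suc n) * fr (Suc (Suc n)) t + a n * fr n t + b (Suc n) * fr (Suc n) t = t * fr (Suc n) t"
proof -
  have "(of_real (a (Suc n) * fr (Suc (Suc n)) t + a n * fr n t + b (Suc n) * fr (Suc n) t)::complex) = of_real (t * fr (Suc n) t)"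
    using fm_eq[of "of_real t"] unfolding jacobi_eq_def by (simp add: fm_of_real)
  then show ?thesis by (metis of_real_eq_iff)
qed

text \<open>A polynomial object with the values of \<open>fm\<close>, so that linear factors and
  derivatives become available.\<close>

fun jpoly :: "nat \<Rightarrow> complex poly" where
  "jpoly 0 = 0"
| "jpoly (Suc 0) = 1"
| "jpoly (Suc (Suc n)) = Polynomial.smult (of_real (1 / a (Suc n)))
     ([:- of_real (b (Suc n)), 1:] * jpoly (Suc n) - Polynomial.smult (of_real (a n)) (jpoly n))"

declare jpoly.simps(3) [simp del]

lemma poly_jpoly: "poly (jpoly n) z = fm n z"
  by (induction n rule: jpoly.induct) (simp_all add: f_minus_def jpoly.simps(3) diff_divide_distrib left_diff_distrib)

lemma jpoly_coeff:
  "degree (jpoly (Suc n)) \<le> n \<and> coeff (jpoly (Suc n)) n = of_real (1 / (\<Prod>k=1..n. a k))"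
proof (induction n rule: induct_nat_012)
  case 1
  show ?case by (auto intro!: degree_smult_le[THEN order_trans] simp: degree_pCons_eq_if jpoly.simps(3))
next
  case (ge2 n)
  let ?q = "[:- of_real (b (Suc (Suc n))), 1:] * jpoly (Suc (Suc n)) - Polynomial.smult (of_real (a (Suc n))) (jpoly (Suc n))"
  have d: "degree ([:- of_real (b (Suc (Suc n))), 1:] * jpoly (Suc (Suc n)) - Polynomial.smult (of_real (a (Suc n))) (jpoly (Suc n))) \<le> Suc (Suc n)"
  proof (rule degree_diff_le)
    show "degree ([:- of_real (b (Suc (Suc n))), 1:] * jpoly (Suc (Suc n))) \<le> Suc (Suc n)"
      by (rule order_trans[OF degree_mult_le]) (use ge2 in \<open>simp\<close>)
    show "degree (Polynomial.smult (of_real (a (Suc n))) (jpoly (Suc n))) \<le> Suc (Suc n)"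
      by (rule order_trans[OF degree_smult_le]) (use ge2 in simp)
  qed
  have c0: "coeff (jpoly (Suc (Suc n))) (Suc (Suc n)) = 0" "coeff (jpoly (Suc n)) (Suc (Suc n)) = 0"
    using ge2 by (auto intro!: coeff_eq_0)
  have "coeff ?q (Suc (Suc n)) = of_real (1 / (\<Prod>k=1..Suc n. a k))"
    using c0 ge2 by simp
  then show ?case
    unfolding jpoly.simps(3)[of "Suc n"]
    by (intro conjI order_trans[OF degree_smult_le d]) (simp del: mult_pCons_left)
qed simp

lemma degree_jpoly: "degree (jpoly (Suc n)) = n"
  and lead_coeff_jpoly: "lead_coeff (jpoly (Suc n)) = of_real (1 / (\<Prod>k=1..n. a k))"
proof -
  have "(\<Prod>k=1..n. a k) \<noteq> 0" using prod_a_pos[of n] by linarith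
  then have "coeff (jpoly (Suc n)) n \<noteq> 0" using jpoly_coeff[of n] by simp
  then show *: "degree (jpoly (Suc n)) = n"
    using jpoly_coeff[of n] le_degree by (metis antisym)
  show "lead_coeff (jpoly (Suc n)) = of_real (1 / (\<Prod>k=1..n. a k))"
    unfolding * using jpoly_coeff by blast
qed

text \<open>The confluent form of \<open>wronskian_sum\<close> for \<open>fm\<close>, obtained by
  differentiating the recurrence in \<open>z\<close>. At real points and for
  \<open>n \<ge> 1\<close> the right side is at least 1, so zeros are simple and neighbouring
  polynomials have no common real zero.\<close>

lemma christoffel_darboux_diag:
  "of_real (a n) * (poly (pderiv (jpoly (Suc n))) z * fm n z - poly (pderiv (jpoly n)) z * fm (Suc n) z)
   = (\<Sum>k=1..n. (fm k z)\<^sup>2)"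
proof (induction n)
  case (Suc n)
  have fe: "of_real (a (Suc n)) * fm (Suc (Suc n)) z = (z - of_real (b (Suc n))) * fm (Suc n) z - of_real (a n) * fm n z"
    using fm_eq[of z] unfolding jacobi_eq_def by (simp add: algebra_simps)
  have de: "of_real (a (Suc n)) * poly (pderiv (jpoly (Suc (Suc n)))) z =
     fm (Suc n) z + (z - of_real (b (Suc n))) * poly (pderiv (jpoly (Suc n))) z - of_real (a n) * poly (pderiv (jpoly n)) z"
    by (simp add: jpoly.simps(3) pderiv_smult pderiv_diff pderiv_mult pderiv_pCons poly_jpoly del: mult_pCons_left)
  have "of_real (a (Suc n)) * (poly (pderiv (jpoly (Suc (Suc n)))) z * fm (Suc n) z - poly (pderiv (jpoly (Suc n))) z * fm (Suc (Suc n)) z)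
     = (of_real (a (Suc n)) * poly (pderiv (jpoly (Suc (Suc n)))) z) * fm (Suc n) z - poly (pderiv (jpoly (Suc n))) z * (of_real (a (Suc n)) * fm (Suc (Suc n)) z)"
    by (simp add: algebra_simps del: jpoly.simps)
  also have "\<dots> = (fm (Suc n) z)\<^sup>2 + of_real (a n) * (poly (pderiv (jpoly (Suc n))) z * fm n z - poly (pderiv (jpoly n)) z * fm (Suc n) z)"
    unfolding fe de by (simp add: algebra_simps power2_eq_square del: jpoly.simps)
  finally show ?case using Suc by (simp del: jpoly.simps)
qed auto

lemma fm_root_simple:
  assumes "fm (Suc n) (of_real t) = 0"
  shows "poly (pderiv (jpoly (Suc n))) (of_real t) \<noteq> 0"
proof
  assume "poly (pderiv (jpoly (Suc n))) (of_real t) = 0"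
  then have "(\<Sum>k=1..n. (fm k (of_real t))\<^sup>2) = 0"
    using christoffel_darboux_diag[of n "of_real t"] assms by simp
  then have "(of_real (\<Sum>k=1..n. (fr k t)\<^sup>2) :: complex) = 0" by (simp add: fm_of_real)
  then have z: "(\<Sum>k=1..n. (fr k t)\<^sup>2) = 0" by (metis of_real_eq_0_iff)
  have "n \<ge> 1" using assms by (cases n) auto
  then have "1 \<le> (\<Sum>k=1..n. (fr k t)\<^sup>2)"
    using member_le_sum[of 1 "{1..n}" "\<lambda>k. (fr k t)\<^sup>2"] by simp
  with z show False by simp
qed

definition eigs :: "nat \<Rightarrow> real set" where "eigs N = {t. fr (Suc N) t = 0}"

lemma eigs_factorization:
  "finite (eigs N) \<and> card (eigs N) = N \<and>
   (\<forall>z. fm (Suc N) z = (\<Prod>s\<in>eigs N. z - of_real s) / of_real (\<Prod>k=1..N. a k))"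
proof -
  obtain as where as: "Polynomial.smult (lead_coeff (jpoly (Suc N))) (\<Prod>x\<leftarrow>as. [:- x, 1:]) = jpoly (Suc N)"
    "length as = N"
    using fundamental_theorem_algebra_factorized[of "jpoly (Suc N)"] degree_jpoly by auto
  have nz: "jpoly (Suc N) \<noteq> 0" using lead_coeff_jpoly[of N] prod_a_pos[of N]
    by (auto simp del: jpoly.simps)
  have ev: "fm (Suc N) z = (\<Prod>x\<leftarrow>as. z - x) / of_real (\<Prod>k=1..N. a k)" for z
  proof -
    have "fm (Suc N) z = poly (Polynomial.smult (lead_coeff (jpoly (Suc N))) (\<Prod>x\<leftarrow>as. [:- x, 1:])) z"
      using as poly_jpoly by metis
    also have "\<dots> = (\<Prod>x\<leftarrow>as. z - x) / of_real (\<Prod>k=1..N. a k)"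
      by (simp add: lead_coeff_jpoly poly_prod_list o_def del: jpoly.simps of_real_prod)
    finally show ?thesis .
  qed
  have pz: "(\<Prod>x\<leftarrow>as. z - x) = 0 \<longleftrightarrow> z \<in> set as" for z
    by (induction as) auto
  have setas: "set as = {z. fm (Suc N) z = 0}"
    using pz prod_a_pos[of N] unfolding ev by (auto simp del: of_real_prod)
  have real: "x \<in> set as \<Longrightarrow> of_real (Re x) = x" for x
    using fm_root_real unfolding setas by (auto simp: complex_eq_iff)
  \<comment> \<open>A repeated root would also be a zero of the derivative, contrary to
    \<open>fm_root_simple\<close>.\<close>
  have "distinct as"
  proof (rule ccontr)
    assume "\<not> distinct as"
    then obtain xs ys zs y where "as = xs @ [y] @ ys @ [y] @ zs"
      using not_distinct_decomp by blast
    then have "jpoly (Suc N) = [:-y, 1:] * ([:-y,1:] * Polynomial.smult (lead_coeff (jpoly (Suc N))) (\<Prod>x\<leftarrow>xs @ ys @ zs. [:- x, 1:]))"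
      using as(1) by (simp add: algebra_simps del: jpoly.simps)
    then obtain q where q: "jpoly (Suc N) = [:-y, 1:] * ([:-y,1:] * q)" by blast
    have "poly (pderiv (jpoly (Suc N))) y = 0"
      unfolding q by (simp add: pderiv_mult pderiv_pCons del: mult_pCons_left)
    moreover have "y \<in> set as" using \<open>as = _\<close> by simp
    ultimately show False using fm_root_simple[of N "Re y"] real[of y] setas by auto
  qed
  have eq: "eigs N = Re ` set as"
  proof (intro equalityI subsetI)
    fix t assume "t \<in> eigs N"
    then have "of_real t \<in> set as" unfolding setas eigs_def by (simp add: fm_of_real)
    then show "t \<in> Re ` set as" by (metis Re_complex_of_real image_eqI)
  next
    fix t assume "t \<in> Re ` set as"
    then obtain x where x: "x \<in> set as" "t = Re x" by auto
    then show "t \<in> eigs N" using real[of x] setas unfolding eigs_def fr_def by auto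
  qed
  have inj: "inj_on Re (set as)" by (rule inj_onI) (metis real)
  have "card (eigs N) = N" unfolding eq using card_image[OF inj] distinct_card[OF \<open>distinct as\<close>] as(2) by simp
  moreover have "(\<Prod>x\<leftarrow>as. z - x) = (\<Prod>s\<in>eigs N. z - of_real s)" for z
  proof -
    have "(\<Prod>x\<leftarrow>as. z - x) = (\<Prod>x\<in>set as. z - x)"
      using prod.distinct_set_conv_list[OF \<open>distinct as\<close>] by metis
    also have "\<dots> = (\<Prod>x\<in>set as. z - of_real (Re x))" using real by (intro prod.cong) auto
    also have "\<dots> = (\<Prod>s\<in>eigs N. z - of_real s)" unfolding eq by (simp add: prod.reindex[OF inj])
    finally show ?thesis .
  qed
  ultimately show ?thesis using ev unfolding eq by auto
qed

lemma finite_eigs [simp]: "finite (eigs N)" and card_eigs [simp]: "card (eigs N) = N"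
  and fm_prod: "fm (Suc N) z = (\<Prod>s\<in>eigs N. z - of_real s) / of_real (\<Prod>k=1..N. a k)"
  using eigs_factorization by blast+

lemma fr_prod: "fr (Suc N) t = (\<Prod>s\<in>eigs N. t - s) / (\<Prod>k=1..N. a k)"
proof -
  have "(of_real (fr (Suc N) t)::complex) = of_real ((\<Prod>s\<in>eigs N. t - s) / (\<Prod>k=1..N. a k))"
    using fm_prod[of N "of_real t"] unfolding fm_of_real by simp
  then show ?thesis by (metis of_real_eq_iff)
qed

text \<open>The value is \<open>M + 2 * (M + 1)\<close>: for \<open>\<bar>t\<bar>\<close> at least
  this large, \<open>\<bar>t - b (Suc n)\<bar>\<close> dominates \<open>a (Suc n) + a n\<close>, and
  \<open>\<bar>fr n t\<bar>\<close> cannot decrease in \<open>n\<close>.\<close>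

definition specR :: real where "specR = 3 * M + 2"

lemma fr_mono:
  assumes "\<bar>t\<bar> \<ge> specR"
  shows "\<bar>fr n t\<bar> \<le> \<bar>fr (Suc n) t\<bar>"
proof (induction n)
  case (Suc n)
  have "a (Suc n) * fr (Suc (Suc n)) t = (t - b (Suc n)) * fr (Suc n) t - a n * fr n t"
    using fr_rec[of n t] by (simp add: algebra_simps)
  then have "a (Suc n) * \<bar>fr (Suc (Suc n)) t\<bar> = \<bar>(t - b (Suc n)) * fr (Suc n) t - a n * fr n t\<bar>"
    by (metis a_pos abs_mult abs_of_pos)
  also have "\<dots> \<ge> \<bar>t - b (Suc n)\<bar> * \<bar>fr (Suc n) t\<bar> - a n * \<bar>fr n t\<bar>"
    using abs_triangle_ineq2[of "(t - b (Suc n)) * fr (Suc n) t" "a n * fr n t"]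
    by (simp only: abs_mult abs_of_pos[OF a_pos])
  moreover have "\<bar>t - b (Suc n)\<bar> \<ge> a (Suc n) + a n"
    using assms b_le[of "Suc n"] a_le[of n] a_le[of "Suc n"] unfolding specR_def by linarith
  then have "\<bar>t - b (Suc n)\<bar> * \<bar>fr (Suc n) t\<bar> \<ge> (a (Suc n) + a n) * \<bar>fr (Suc n) t\<bar>"
    by (rule mult_right_mono) simp
  moreover have "a n * \<bar>fr n t\<bar> \<le> a n * \<bar>fr (Suc n) t\<bar>" using Suc by simp
  ultimately have "a (Suc n) * \<bar>fr (Suc n) t\<bar> \<le> a (Suc n) * \<bar>fr (Suc (Suc n)) t\<bar>"
    unfolding distrib_right by linarith
  then show ?case by simp
qed simp

lemma eigs_bound: assumes "s \<in> eigs N" shows "\<bar>s\<bar> < specR"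
proof (rule ccontr)
  assume "\<not> \<bar>s\<bar> < specR"
  then have s: "\<bar>s\<bar> \<ge> specR" by simp
  have "1 \<le> \<bar>fr (Suc n) s\<bar>" for n
  proof (induction n)
    case (Suc n)
    then show ?case using fr_mono[OF s, of "Suc n"] by linarith
  qed simp
  from this[of N] show False using assms unfolding eigs_def by simp
qed

lemma eigs_eigenvalue:
  assumes "s \<in> eigs N" shows "poly (char_poly (truncation a b N)) s = 0"
proof -
  let ?A = "truncation a b N" and ?v = "Matrix.vec N (\<lambda>i. fr (Suc i) s)"
  have A: "?A \<in> carrier_mat N N" unfolding truncation_def by simp
  have N: "N \<ge> 1" using assms unfolding eigs_def by (cases N) auto
  have "eigenvector ?A ?v s"
    unfolding eigenvector_def
  proof (intro conjI)
    show "?v \<in> carrier_vec (dim_row ?A)" unfolding truncation_def by simp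
    have "?v $ 0 \<noteq> (0\<^sub>v N) $ 0" using N by simp
    then show "?v \<noteq> 0\<^sub>v (dim_row ?A)" using A by (metis carrier_matD(1))
    show "?A *\<^sub>v ?v = s \<cdot>\<^sub>v ?v"
    proof (rule eq_vecI)
      fix i assume "i < dim_vec (s \<cdot>\<^sub>v ?v)"
      then have i: "i < N" by simp
      have "(?A *\<^sub>v ?v) $ i = (\<Sum>j<N. ?A $$ (i, j) * fr (Suc j) s)"
        using i A by (simp add: mult_mat_vec_def scalar_prod_def atLeast0LessThan)
      also have "\<dots> = (\<Sum>j<N. (if j = i then b (Suc i) * fr (Suc i) s else 0)
           + (if j = Suc i then a (Suc i) * fr (Suc (Suc i)) s else 0)
           + (if i = Suc j then a i * fr i s else 0))"
        by (rule sum.cong) (use i in \<open>auto simp: truncation_def\<close>)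
      also have "\<dots> = b (Suc i) * fr (Suc i) s + (if Suc i < N then a (Suc i) * fr (Suc (Suc i)) s else 0)
           + (\<Sum>j<N. if i = Suc j then a i * fr i s else 0)"
        using i by (simp add: sum.distrib)
      \<comment> \<open>In the last row the matrix has no entry for \<open>fr (Suc N) s\<close>, but
        this value is 0 because \<open>s\<close> is in \<open>eigs N\<close>.\<close>
      also have "(if Suc i < N then a (Suc i) * fr (Suc (Suc i)) s else 0) = a (Suc i) * fr (Suc (Suc i)) s"
        using i assms unfolding eigs_def by (cases "Suc i = N") auto
      also have "(\<Sum>j<N. if i = Suc j then a i * fr i s else 0) = a i * fr i s"
        using i by (cases i) auto
      finally show "(?A *\<^sub>v ?v) $ i = (s \<cdot>\<^sub>v ?v) $ i"
        using i fr_rec[of i s] by (simp add: algebra_simps)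
    qed (use A in auto)
  qed
  then show ?thesis using eigenvalue_root_char_poly[OF A] unfolding eigenvalue_def by blast
qed

text \<open>The \<open>N\<close> distinct eigenvalues in \<open>eigs N\<close> already exhaust the
  degree of the characteristic polynomial, so every multiplicity is one.\<close>

lemma proots_truncation: "proots (char_poly (truncation a b N)) = mset_set (eigs N)"
proof -
  let ?P = "char_poly (truncation a b N)"
  have A: "truncation a b N \<in> carrier_mat N N" unfolding truncation_def by simp
  have deg: "degree ?P = N" and nz: "?P \<noteq> 0" using degree_monic_char_poly[OF A] by auto
  have "mset_set (eigs N) \<subseteq># proots ?P"
    unfolding subseteq_mset_def
  proof
    fix t
    show "count (mset_set (eigs N)) t \<le> count (proots ?P) t"
    proof (cases "t \<in> eigs N")
      case True
      then have "Polynomial.order t ?P \<noteq> 0" using eigs_eigenvalue nz order_root by blast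
      then show ?thesis using True nz by (simp add: count_proots)
    qed simp
  qed
  moreover have "size (proots ?P) \<le> size (mset_set (eigs N))"
    using size_proots_le[of ?P] deg by simp
  ultimately show ?thesis
    using mset_subset_size[of "mset_set (eigs N)" "proots ?P"] subset_mset.le_imp_less_or_eq by fastforce
qed

lemma eigs_nonempty: "N \<ge> 1 \<Longrightarrow> eigs N \<noteq> {}"
  using card_eigs[of N] by (auto simp del: card_eigs)

lemma eigenvalue_dist_eq:
  assumes "N \<ge> 1"
  shows "eigenvalue_dist a b N = distr (measure_pmf (pmf_of_set (eigs N))) borel (\<lambda>t. t)"
proof -
  have ne: "eigs N \<noteq> {}" using eigs_nonempty[OF assms(1)] .
  then have "pmf_of_multiset (mset_set (eigs N)) = pmf_of_set (eigs N)"
    using map_pmf_of_set[of "eigs N" "\<lambda>x. x"] by simp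
  then show ?thesis unfolding eigenvalue_dist_def proots_truncation by simp
qed

lemma integral_eigenvalue_dist:
  fixes f :: "real \<Rightarrow> real"
  assumes "N \<ge> 1" "f \<in> borel_measurable borel"
  shows "(\<integral>t. f t \<partial>eigenvalue_dist a b N) = (\<Sum>s\<in>eigs N. f s) / real N"
proof -
  have ne: "eigs N \<noteq> {}" using eigs_nonempty[OF assms(1)] .
  show ?thesis unfolding eigenvalue_dist_eq[OF assms(1)]
    using assms ne by (simp add: integral_distr integral_pmf_of_set)
qed

lemma nn_integral_eigenvalue_dist:
  assumes "N \<ge> 1" "f \<in> borel_measurable borel"
  shows "(\<integral>\<^sup>+t. f t \<partial>eigenvalue_dist a b N) = (\<Sum>s\<in>eigs N. f s) / of_nat N"
proof -
  have ne: "eigs N \<noteq> {}" using eigs_nonempty[OF assms(1)] .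
  show ?thesis unfolding eigenvalue_dist_eq[OF assms(1)]
    using assms ne by (simp add: nn_integral_distr nn_integral_pmf_of_set)
qed

end

section \<open>Arguments of points in the upper half plane\<close>

lemma Im_minus_inverse: "Im (- 1 / w) = Im w / (cmod w)\<^sup>2"
  by (simp add: Im_divide cmod_power2)

text \<open>Together with the limit \<pi> at the other end of the line, this limit fixes the branch
  constant in \<open>sum_Ln_rm\<close>.\<close>

lemma Im_Ln_shift_at_top: "((\<lambda>x. Im (Ln (Complex (x - s) 1))) \<longlongrightarrow> 0) at_top"
proof -
  have "filterlim (\<lambda>x. - s + x) at_top at_top"
    by (rule filterlim_tendsto_add_at_top[OF tendsto_const filterlim_ident])
  then have "((\<lambda>x. inverse (- s + x)) \<longlongrightarrow> 0) at_top"
    by (rule tendsto_inverse_0_at_top)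
  from tendsto_arctan[OF this] have "((\<lambda>x. arctan (inverse (- s + x))) \<longlongrightarrow> 0) at_top" by simp
  moreover have "\<forall>\<^sub>F x in at_top. arctan (inverse (- s + x)) = Im (Ln (Complex (x - s) 1))"
    using eventually_gt_at_top[of s]
    by eventually_elim (simp add: Im_Ln_eq complex_eq_iff divide_inverse)
  ultimately show ?thesis by (rule Lim_transform_eventually)
qed

lemma Im_Ln_shift_at_bot: "((\<lambda>x. Im (Ln (Complex (x - s) 1))) \<longlongrightarrow> pi) at_bot"
proof -
  have "filterlim (\<lambda>x. s + - x) at_top at_bot"
    by (rule filterlim_tendsto_add_at_top[OF tendsto_const filterlim_uminus_at_top_at_bot])
  then have "((\<lambda>x. inverse (s + - x)) \<longlongrightarrow> 0) at_bot"
    by (rule tendsto_inverse_0_at_top)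
  then have "((\<lambda>x. pi + arctan (- inverse (s + - x))) \<longlongrightarrow> pi + arctan (- 0)) at_bot"
    by (intro tendsto_intros)
  then have "((\<lambda>x. pi + arctan (- inverse (s + - x))) \<longlongrightarrow> pi) at_bot" by simp
  moreover have "\<forall>\<^sub>F x in at_bot. pi + arctan (- inverse (s + - x)) = Im (Ln (Complex (x - s) 1))"
    using eventually_gt_at_bot[of s]
  proof eventually_elim
    case (elim x)
    have "- inverse (s + - x) = 1 / (x - s)" using elim by (simp add: field_simps)
    then show ?case using elim by (simp add: Im_Ln_eq complex_eq_iff)
  qed
  ultimately show ?thesis by (rule Lim_transform_eventually)
qed

lemma Im_Ln_bounds: "Im z > 0 \<Longrightarrow> 0 < Im (Ln z)" "Im z > 0 \<Longrightarrow> Im (Ln z) < pi"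
  using Im_Ln_pos_lt_imp by auto

lemma Im_le_cmod: "Im z \<le> cmod z"
  using abs_Im_le_cmod[of z] by linarith

lemma ell2_inner_delta: "ell2_inner (delta n) v = v n"
proof -
  have "(\<lambda>k. cnj (delta n k) * v k) = (\<lambda>k. if k = n then v k else 0)"
    by (auto simp: delta_def)
  then show ?thesis unfolding ell2_inner_def using sums_single[of n v] by (simp add: sums_iff)
qed

context jacobi_coeffs begin

section \<open>The Weyl solution\<close>

text \<open>In the equation at site 1 the boundary term \<open>a 0 * f 0 = 1\<close> moves to the
  right side and, after the change of sign, becomes the source \<open>delta 1\<close>. This links
  the resolvent to the difference equation.\<close>

lemma jacobi_eq_iff_shifted:
  assumes "f 0 = 1"
  shows "jacobi_eq a b z f \<longleftrightarrow> shifted (jacobi_op a b) z (\<lambda>n. if n = 0 then 0 else - f n) = delta 1"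
proof -
  have all: "(\<forall>n. P n) \<longleftrightarrow> P 0 \<and> (\<forall>n. P (Suc n))" for P :: "nat \<Rightarrow> bool"
    by (metis not0_implies_Suc)
  have "of_real (a (Suc n)) * f (Suc (Suc n)) + of_real (a n) * f n + of_real (b (Suc n)) * f (Suc n) = z * f (Suc n)
     \<longleftrightarrow> shifted (jacobi_op a b) z (\<lambda>n. if n = 0 then 0 else - f n) (Suc n) = delta 1 (Suc n)" for n
    using assms by (cases n) (auto simp: shifted_def jacobi_op_def delta_def algebra_simps eq_neg_iff_add_eq_0)
  then show ?thesis
    unfolding jacobi_eq_def fun_eq_iff
    by (subst (2) all) (simp add: shifted_def jacobi_op_def delta_def)
qed

text \<open>\<open>f_plus\<close> is defined through \<open>inv_into\<close>, which means something
  only once \<open>delta 1\<close> is known to have a preimage in \<open>ell2\<close>. The preimage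
  is Weyl's limit of solutions vanishing at \<open>N + 1\<close>, whose sums of squares the
  Wronskian bounds uniformly.\<close>

lemma weyl_solution:
  assumes z: "Im z > 0"
  shows "\<exists>u\<in>ell2. shifted (jacobi_op a b) z u = delta 1"
proof -
  define q where "q n = jacobi_sol a b z 1 0 n" for n
  \<comment> \<open>This choice makes the solution with initial values \<open>1\<close> and
    \<open>- m N\<close> vanish at \<open>Suc N\<close>, which removes the boundary term from
    \<open>im_wronskian\<close>.\<close>
  define m where "m N = q (Suc N) / fm (Suc N) z" for N
  have q_eq: "jacobi_eq a b z q" unfolding q_def by (rule jacobi_eq_sol)
  have q01: "q 0 = 1" "q (Suc 0) = 0" by (simp_all add: q_def)
  define f where "f l n = 1 * q n + (- l) * fm n z" for l n
  have f_eq: "jacobi_eq a b z (f l)" for l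
    unfolding f_def by (rule jacobi_eq_lin[OF q_eq fm_eq])
  have f01: "f l 0 = 1" "f l (Suc 0) = - l" for l by (simp_all add: f_def q01)
  have sum_le: "Im z * (\<Sum>k=1..N. (cmod (f (m N) k))\<^sup>2) = Im (m N)" for N
  proof -
    have "f (m N) (Suc N) = 0" using fm_nz[OF z, of N] by (simp add: f_def m_def)
    then show ?thesis using im_wronskian[OF f_eq, of N "m N"] by (simp add: f01)
  qed
  have m_bd: "cmod (m N) \<le> 1 / Im z" for N
  proof (cases N)
    case 0
    then show ?thesis using z by (simp add: m_def q01)
  next
    case (Suc N')
    have "(cmod (m N))\<^sup>2 \<le> (\<Sum>k=1..N. (cmod (f (m N) k))\<^sup>2)"
      using member_le_sum[of 1 "{1..N}" "\<lambda>k. (cmod (f (m N) k))\<^sup>2"] Suc by (simp add: f01)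
    then have "Im z * (cmod (m N))\<^sup>2 \<le> Im (m N)"
      unfolding sum_le[symmetric] using z by simp
    also have "\<dots> \<le> cmod (m N)" by (rule Im_le_cmod)
    finally have "cmod (m N) * (Im z * cmod (m N)) \<le> cmod (m N) * 1"
      by (simp add: power2_eq_square algebra_simps)
    then have "cmod (m N) = 0 \<or> Im z * cmod (m N) \<le> 1"
      by (metis mult_le_cancel_left_pos norm_ge_zero order_le_less)
    then show ?thesis using z by (auto simp: field_simps)
  qed
  have "bounded (range m)" using m_bd by (auto simp: bounded_iff)
  then obtain l r where lr: "strict_mono r" "(m \<circ> r) \<longlonglongrightarrow> l"
    using bounded_imp_convergent_subsequence by blast
  \<comment> \<open>With the cutoff \<open>L\<close> fixed, every truncation of length at least
    \<open>L\<close> obeys the same bound, which therefore survives the limit.\<close>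
  have S: "(\<Sum>k=1..L. (cmod (f l k))\<^sup>2) \<le> 1 / (Im z)\<^sup>2" for L
  proof -
    have "(\<lambda>j. \<Sum>k=1..L. (cmod (f ((m \<circ> r) j) k))\<^sup>2) \<longlonglongrightarrow> (\<Sum>k=1..L. (cmod (f l k))\<^sup>2)"
      unfolding f_def by (intro tendsto_intros lr)
    moreover have "\<exists>N. \<forall>j\<ge>N. (\<Sum>k=1..L. (cmod (f ((m \<circ> r) j) k))\<^sup>2) \<le> 1 / (Im z)\<^sup>2"
    proof (intro exI allI impI)
      fix j assume "j \<ge> L"
      then have "L \<le> r j" using seq_suble[OF lr(1), of j] by linarith
      then have "(\<Sum>k=1..L. (cmod (f (m (r j)) k))\<^sup>2) \<le> (\<Sum>k=1..r j. (cmod (f (m (r j)) k))\<^sup>2)"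
        by (intro sum_mono2) auto
      also have "\<dots> = Im (m (r j)) / Im z" using sum_le[of "r j"] z by (simp add: field_simps)
      also have "\<dots> \<le> (1 / Im z) / Im z"
        using z by (intro divide_right_mono order_trans[OF Im_le_cmod m_bd[of "r j"]]) auto
      finally show "(\<Sum>k=1..L. (cmod (f ((m \<circ> r) j) k))\<^sup>2) \<le> 1 / (Im z)\<^sup>2"
        by (simp add: power2_eq_square)
    qed
    ultimately show ?thesis by (rule LIMSEQ_le_const2)
  qed
  define u where "u n = (if n = 0 then 0 else - f l n)" for n
  have "u \<in> ell2"
    unfolding ell2_def
  proof (intro CollectI conjI)
    show "u 0 = 0" by (simp add: u_def)
    show "summable (\<lambda>n. (cmod (u n))\<^sup>2)"
    proof (rule summableI_nonneg_bounded)
      fix n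
      have "(\<Sum>i<n. (cmod (u i))\<^sup>2) \<le> (\<Sum>i\<in>insert 0 {1..n}. (cmod (u i))\<^sup>2)"
        by (intro sum_mono2) auto
      also have "\<dots> = (\<Sum>k=1..n. (cmod (f l k))\<^sup>2)" by (simp add: u_def)
      finally show "(\<Sum>i<n. (cmod (u i))\<^sup>2) \<le> 1 / (Im z)\<^sup>2" using S[of n] by linarith
    qed simp
  qed
  moreover have "shifted (jacobi_op a b) z u = delta 1"
    using f_eq[of l] jacobi_eq_iff_shifted[of "f l" z] f01(1)[of l] unfolding u_def[abs_def] by simp
  ultimately show ?thesis by blast
qed

abbreviation "fp \<equiv> f_plus a b"

lemma fp_eq: "jacobi_eq a b z (\<lambda>n. fp n z)"
  unfolding f_plus_def by (rule jacobi_eq_sol)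

lemma fp_0 [simp]: "fp 0 z = 1"
  by (simp add: f_plus_def)

lemma fp_summable:
  assumes z: "Im z > 0"
  shows "summable (\<lambda>n. (cmod (fp n z))\<^sup>2)"
proof -
  define u where "u = resolvent (jacobi_op a b) z (delta 1)"
  have im: "delta 1 \<in> shifted (jacobi_op a b) z ` ell2"
    using weyl_solution[OF z] by force
  have u: "u \<in> ell2" "shifted (jacobi_op a b) z u = delta 1"
    unfolding u_def resolvent_def using inv_into_into[OF im] f_inv_into_f[OF im] by auto
  have u0: "u 0 = 0" and us: "summable (\<lambda>n. (cmod (u n))\<^sup>2)" using u(1) by (auto simp: ell2_def)
  define v where "v n = (if n = 0 then 1 else - u n)" for n
  have "(\<lambda>n. if n = 0 then 0 else - v n) = u" using u0 by (auto simp: v_def)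
  then have "jacobi_eq a b z v" using u(2) jacobi_eq_iff_shifted[of v z] by (simp add: v_def)
  moreover have "v 1 = fp 1 z"
    by (simp add: v_def f_plus_def green_def ell2_inner_delta u_def)
  ultimately have "fp n z = v n" for n
    using jacobi_eq_unique[OF fp_eq, of z v n] by (simp add: v_def)
  then have "(\<lambda>n. (cmod (fp (Suc n) z))\<^sup>2) = (\<lambda>n. (cmod (u (Suc n)))\<^sup>2)"
    by (simp add: v_def)
  then show ?thesis using us by (metis summable_Suc_iff[of "\<lambda>n. (cmod (fp n z))\<^sup>2"] summable_Suc_iff[of "\<lambda>n. (cmod (u n))\<^sup>2"])
qed

lemma fp_tendsto:
  assumes z: "Im z > 0" shows "(\<lambda>n. fp n z) \<longlonglongrightarrow> 0"
proof -
  have "(\<lambda>n. sqrt ((cmod (fp n z))\<^sup>2)) \<longlonglongrightarrow> sqrt 0"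
    by (intro tendsto_real_sqrt summable_LIMSEQ_zero[OF fp_summable[OF z]])
  then show ?thesis by (simp add: tendsto_norm_zero_iff)
qed

lemma two_zeros:
  assumes "jacobi_eq a b z f" "f (Suc n) = 0" "f (Suc (Suc n)) = 0"
  shows "f 0 = 0"
  using assms(2,3)
proof (induction n)
  case 0
  then show ?case using assms(1)[unfolded jacobi_eq_def, rule_format, of 0] by simp
next
  case (Suc n)
  have "of_real (a (Suc n)) * f (Suc n) = 0"
    using assms(1)[unfolded jacobi_eq_def, rule_format, of "Suc n"] Suc.prems by simp
  then show ?case using Suc by simp
qed

text \<open>The quantity increases in \<open>n\<close> and tends to 0, since \<open>fp\<close> does,
  so it is at most 0. If it vanished at some \<open>n\<close>, it would stay 0, \<open>fp\<close>
  would have two consecutive zeros, and then \<open>fp 0 z = 0\<close>.\<close>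

lemma fp_wronskian_neg:
  assumes z: "Im z > 0"
  shows "a n * Im (fp (Suc n) z * cnj (fp n z)) < 0"
proof -
  define W where "W n = a n * Im (fp (Suc n) z * cnj (fp n z))" for n
  have W: "W n = W 0 + Im z * (\<Sum>k=1..n. (cmod (fp k z))\<^sup>2)" for n
    unfolding W_def im_wronskian[OF fp_eq] by simp
  have step: "W (Suc n) = W n + Im z * (cmod (fp (Suc n) z))\<^sup>2" for n
    using W[of n] W[of "Suc n"] by (simp add: algebra_simps)
  have "incseq W" by (rule incseq_SucI) (use step z in simp)
  moreover have "W \<longlonglongrightarrow> 0"
  proof (rule Lim_null_comparison)
    show "\<forall>\<^sub>F n in sequentially. norm (W n) \<le> (M + 1) * (cmod (fp (Suc n) z) * cmod (fp n z))"
    proof (intro always_eventually allI)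
      fix n
      have "\<bar>W n\<bar> = a n * \<bar>Im (fp (Suc n) z * cnj (fp n z))\<bar>" unfolding W_def abs_mult abs_of_pos[OF a_pos] ..
      also have "\<dots> \<le> (M + 1) * cmod (fp (Suc n) z * cnj (fp n z))"
        by (intro mult_mono a_le abs_Im_le_cmod) (use M_pos in auto)
      finally show "norm (W n) \<le> (M + 1) * (cmod (fp (Suc n) z) * cmod (fp n z))"
        by (simp add: norm_mult)
    qed
    have "(\<lambda>n. (M + 1) * (cmod (fp (Suc n) z) * cmod (fp n z))) \<longlonglongrightarrow> (M + 1) * (cmod 0 * cmod 0)"
      using fp_tendsto[OF z] LIMSEQ_Suc[OF fp_tendsto[OF z]] by (intro tendsto_intros)
    then show "(\<lambda>n. (M + 1) * (cmod (fp (Suc n) z) * cmod (fp n z))) \<longlonglongrightarrow> 0" by simp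
  qed
  ultimately have le0: "W n \<le> 0" for n by (rule incseq_le)
  have "W n < 0"
  proof (rule ccontr)
    assume "\<not> W n < 0"
    then have "W n \<ge> 0" by simp
    have p: "Im z * (cmod (fp (Suc k) z))\<^sup>2 \<ge> 0" for k using z by simp
    have "Im z * (cmod (fp (Suc n) z))\<^sup>2 = 0" "Im z * (cmod (fp (Suc (Suc n)) z))\<^sup>2 = 0"
      using step[of n] step[of "Suc n"] le0[of "Suc n"] le0[of "Suc (Suc n)"] \<open>W n \<ge> 0\<close> p[of n] p[of "Suc n"]
      by linarith+
    then have "fp (Suc n) z = 0" "fp (Suc (Suc n)) z = 0" using z by auto
    from two_zeros[OF fp_eq this] show False by simp
  qed
  then show ?thesis unfolding W_def .
qed

section \<open>The Herglotz quotients, their bounds and their logarithms\<close>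

definition rp :: "nat \<Rightarrow> complex \<Rightarrow> complex" where "rp n z = - (fp (Suc n) z / fp n z)"
definition rm :: "nat \<Rightarrow> complex \<Rightarrow> complex" where "rm n z = fm (Suc n) z / fm n z"

text \<open>\<open>grn n\<close> is the diagonal Green function at \<open>n\<close>, but only this product formula is needed.\<close>

definition grn :: "nat \<Rightarrow> complex \<Rightarrow> complex" where "grn n z = - (fp n z * fm n z)"

lemma fp_nz: assumes "Im z > 0" shows "fp n z \<noteq> 0"
  using fp_wronskian_neg[OF assms, of n] by auto

lemma Im_rp_pos: assumes "Im z > 0" shows "Im (rp n z) > 0"
proof -
  have "a n * Im (- fp (Suc n) z * cnj (fp n z)) > 0"
    using fp_wronskian_neg[OF assms, of n] by (simp add: algebra_simps)
  then have "Im (- fp (Suc n) z * cnj (fp n z)) > 0" using a_pos[of n] by (metis zero_less_mult_pos)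
  from Im_div_pos(4)[OF this] show ?thesis unfolding rp_def by simp
qed

text \<open>Only the last term of the sum of squares is kept. The resulting lower bound is uniform
  in \<open>n\<close>, which positivity alone would not give; \<open>rm_bound\<close> and
  \<open>Ln_grn_bound\<close> rest on it.\<close>

lemma Im_rm_ge:
  assumes z: "Im z > 0" and n: "n \<ge> 1" shows "a n * Im (rm n z) \<ge> Im z"
proof -
  have "Im (fm (Suc n) z * cnj (fm n z)) > 0"
    using fm_wronskian_pos[OF assms] a_pos[of n] by (metis zero_less_mult_pos)
  note * = Im_div_pos[OF this]
  have "(cmod (fm n z))\<^sup>2 \<le> (\<Sum>k=1..n. (cmod (fm k z))\<^sup>2)"
    using n by (intro member_le_sum) auto
  then have "Im z * (cmod (fm n z))\<^sup>2 \<le> a n * Im (fm (Suc n) z * cnj (fm n z))"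
    unfolding im_wronskian[OF fm_eq] using z by simp
  then show ?thesis unfolding rm_def *(3) using *(1) by (simp add: field_simps)
qed

lemma Im_rm_pos:
  assumes z: "Im z > 0" and n: "n \<ge> 1" shows "Im (rm n z) > 0"
  using Im_rm_ge[OF assms] z a_pos[of n] by (metis less_le_trans zero_less_mult_pos)

lemma fm_nz': "Im z > 0 \<Longrightarrow> n \<ge> 1 \<Longrightarrow> fm n z \<noteq> 0"
  using fm_nz[of z "n - 1"] by simp

lemma grn_ratio:
  assumes z: "Im z > 0" and n: "n \<ge> 1"
  shows "- 1 / grn n z = of_real (a n) * (rp n z + rm n z)"
proof -
  have "of_real (a n) * (fp (Suc n) z * fm n z - fp n z * fm (Suc n) z) = - 1"
    using wronskian_sum[OF fp_eq fm_eq, of n z z] by simp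
  then have "- 1 / grn n z = - (of_real (a n) * (fp (Suc n) z * fm n z - fp n z * fm (Suc n) z)) / (fp n z * fm n z)"
    unfolding grn_def by simp
  also have "\<dots> = of_real (a n) * (rp n z + rm n z)"
    unfolding rp_def rm_def using fp_nz[OF z, of n] fm_nz'[OF z n] by (simp add: field_simps)
  finally show ?thesis .
qed

lemma Im_grn_pos:
  assumes z: "Im z > 0" and n: "n \<ge> 1" shows "Im (grn n z) > 0"
proof -
  have "Im (- 1 / grn n z) > 0"
    unfolding grn_ratio[OF assms] using Im_rp_pos[OF z, of n] Im_rm_pos[OF assms] by simp
  then show ?thesis unfolding Im_minus_inverse by (simp add: zero_less_divide_iff)
qed

text \<open>\<open>rm 1\<close> is explicit. For larger \<open>n\<close> one step of the Riccati
  recursion expresses \<open>rm n\<close> through the reciprocal of its predecessor, which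
  \<open>Im_rm_ge\<close> keeps away from 0.\<close>

lemma rm_bound:
  assumes z: "Im z > 0" and n: "n \<ge> 1"
  shows "a n * cmod (rm n z) \<le> cmod z + M + (M + 1)\<^sup>2 / Im z"
proof (cases "n = 1")
  case True
  have "of_real (a 1) * rm 1 z = z - of_real (b 1)"
    using fm_eq[of z, unfolded jacobi_eq_def, rule_format, of 0] by (simp add: rm_def algebra_simps)
  then have "cmod (of_real (a 1) * rm 1 z) \<le> cmod z + \<bar>b 1\<bar>"
    using norm_triangle_ineq4[of z "of_real (b 1)"] by simp
  then have "a 1 * cmod (rm 1 z) \<le> cmod z + M"
    using b_le[of 1] by (simp add: norm_mult)
  moreover have "0 \<le> (M + 1)\<^sup>2 / Im z" using z by simp
  ultimately show ?thesis unfolding True by linarith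
next
  case False
  then obtain k where k: "n = Suc k" "k \<ge> 1" using n by (cases n) auto
  have nz: "fm k z \<noteq> 0" "fm (Suc k) z \<noteq> 0" using fm_nz'[OF z] k by auto
  have "of_real (a n) * fm (Suc n) z = (z - of_real (b n)) * fm n z - of_real (a k) * fm k z"
    using fm_eq[of z, unfolded jacobi_eq_def, rule_format, of k] k by (simp add: algebra_simps)
  then have "of_real (a n) * rm n z = z - of_real (b n) - of_real (a k) / rm k z"
    unfolding rm_def using nz k by (simp add: field_simps)
  then have "cmod (of_real (a n) * rm n z) \<le> cmod z + \<bar>b n\<bar> + cmod (of_real (a k) / rm k z)"
    using norm_triangle_ineq4[of "z - of_real (b n)" "of_real (a k) / rm k z"] norm_triangle_ineq4[of z "of_real (b n)"]
    by simp
  moreover have "cmod (of_real (a k) / rm k z) \<le> (M + 1)\<^sup>2 / Im z"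
  proof -
    have "Im z \<le> a k * cmod (rm k z)"
      using Im_rm_ge[OF z k(2)] mult_left_mono[OF Im_le_cmod[of "rm k z"] a_nonneg[of k]] by linarith
    moreover have "0 < cmod (rm k z)" using nz by (simp add: rm_def)
    ultimately have "a k / cmod (rm k z) \<le> a k * (a k / Im z)"
      using z by (simp add: field_simps)
    also have "\<dots> \<le> (M + 1) * ((M + 1) / Im z)"
      using z a_le[of k] M_pos by (intro mult_mono divide_right_mono) auto
    finally show ?thesis by (simp add: norm_divide power2_eq_square less_imp_le)
  qed
  ultimately show ?thesis using b_le[of n] n by (simp add: norm_mult less_imp_le)
qed

text \<open>The Riccati recursion read towards larger indices: \<open>- a n / rp n\<close> is
  \<open>z - b (Suc n)\<close> plus a point of the upper half plane, so its imaginary part is at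
  least \<open>Im z\<close>.\<close>

lemma rp_bound:
  assumes z: "Im z > 0"
  shows "cmod (rp n z) \<le> (M + 1) / Im z"
proof -
  have nz: "fp n z \<noteq> 0" "fp (Suc n) z \<noteq> 0" using fp_nz[OF z] by auto
  have "of_real (a n) * fp n z = (z - of_real (b (Suc n))) * fp (Suc n) z - of_real (a (Suc n)) * fp (Suc (Suc n)) z"
    using fp_eq[of z, unfolded jacobi_eq_def, rule_format, of n] by (simp add: algebra_simps)
  then have "- (of_real (a n) / rp n z) = z - of_real (b (Suc n)) + of_real (a (Suc n)) * rp (Suc n) z"
    unfolding rp_def using nz by (simp add: field_simps)
  then have "Im (- (of_real (a n) / rp n z)) = Im z + a (Suc n) * Im (rp (Suc n) z)" by simp
  then have "Im z \<le> Im (- (of_real (a n) / rp n z))"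
    using mult_pos_pos[OF a_pos[of "Suc n"] Im_rp_pos[OF z, of "Suc n"]] by simp
  also have "\<dots> \<le> cmod (- (of_real (a n) / rp n z))" by (rule Im_le_cmod)
  finally have "Im z \<le> a n / cmod (rp n z)" by (simp add: norm_divide less_imp_le)
  moreover have "0 < cmod (rp n z)" using nz by (simp add: rp_def)
  ultimately have "cmod (rp n z) \<le> a n / Im z" using z by (simp add: field_simps)
  also have "\<dots> \<le> (M + 1) / Im z" using a_le z by (intro divide_right_mono) auto
  finally show ?thesis .
qed

text \<open>The bound is uniform in \<open>n\<close>, so the boundary term left by telescoping in
  \<open>w_sum\<close> disappears after division by \<open>N\<close>.\<close>

lemma Ln_grn_bound:
  assumes z: "Im z > 0"
  shows "\<exists>B. \<forall>n\<ge>1. cmod (Ln (grn n z)) \<le> B"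
proof -
  \<comment> \<open>The first summand bounds \<open>a n * cmod (rp n z)\<close>, the second is the
    bound of \<open>rm_bound\<close>.\<close>
  define C where "C = (M + 1)\<^sup>2 / Im z + (cmod z + M + (M + 1)\<^sup>2 / Im z)"
  have "cmod (Ln (grn n z)) \<le> \<bar>ln (Im z)\<bar> + \<bar>ln C\<bar> + pi" if n: "n \<ge> 1" for n
  proof -
    have im: "Im (grn n z) > 0" by (rule Im_grn_pos[OF z n])
    then have nz: "grn n z \<noteq> 0" by auto
    have inv: "inverse (cmod (grn n z)) = cmod (of_real (a n) * (rp n z + rm n z))"
      unfolding grn_ratio[OF z n, symmetric] by (simp add: norm_divide inverse_eq_divide)
    have "Im z \<le> Im (of_real (a n) * (rp n z + rm n z))"
      using Im_rm_ge[OF z n] mult_pos_pos[OF a_pos[of n] Im_rp_pos[OF z, of n]] by (simp add: distrib_left)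
    then have lo: "Im z \<le> inverse (cmod (grn n z))"
      unfolding inv using Im_le_cmod by (rule order_trans)
    have "cmod (of_real (a n) * (rp n z + rm n z)) \<le> a n * cmod (rp n z) + a n * cmod (rm n z)"
      using norm_triangle_ineq[of "rp n z" "rm n z"] by (simp add: norm_mult less_imp_le flip: distrib_left)
    also have "a n * cmod (rp n z) \<le> (M + 1) * ((M + 1) / Im z)"
      using z M_pos by (intro mult_mono a_le rp_bound) auto
    finally have hi: "inverse (cmod (grn n z)) \<le> C"
      unfolding inv C_def using rm_bound[OF z n] by (simp add: power2_eq_square)
    have pos: "0 < inverse (cmod (grn n z))" using nz by simp
    have "ln (Im z) \<le> ln (inverse (cmod (grn n z)))" "ln (inverse (cmod (grn n z))) \<le> ln C"
      using lo hi z pos by (auto intro!: ln_mono)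
    then have "\<bar>ln (cmod (grn n z))\<bar> \<le> \<bar>ln (Im z)\<bar> + \<bar>ln C\<bar>"
      using nz by (simp add: ln_inverse)
    moreover have "\<bar>Im (Ln (grn n z))\<bar> \<le> pi" using Im_Ln_bounds[OF im] by simp
    ultimately show ?thesis
      using cmod_le[of "Ln (grn n z)"] nz by simp
  qed
  then show ?thesis by blast
qed

text \<open>The product of the quotients is \<open>- grn (Suc n) z / grn n z\<close>, so both sides
  have the same exponential. All four arguments lie strictly between 0 and \<pi>, hence both
  imaginary parts lie strictly between 0 and 2 \<pi> and no multiple of 2 \<pi> can
  intervene.\<close>

lemma Ln_rp_rm:
  assumes z: "Im z > 0" and n: "n \<ge> 1"
  shows "Ln (rp n z) + Ln (rm n z) = \<i> * pi + (Ln (grn (Suc n) z) - Ln (grn n z))"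
proof (rule exp_complex_eqI)
  have nz: "fp n z \<noteq> 0" "fm n z \<noteq> 0" "fp (Suc n) z \<noteq> 0" "fm (Suc n) z \<noteq> 0"
    using fp_nz[OF z] fm_nz'[OF z] n by auto
  show "exp (Ln (rp n z) + Ln (rm n z)) = exp (\<i> * pi + (Ln (grn (Suc n) z) - Ln (grn n z)))"
    using nz by (simp add: exp_add exp_diff rp_def rm_def grn_def)
  have i: "Im (grn (Suc n) z) > 0" "Im (grn n z) > 0" "Im (rp n z) > 0" "Im (rm n z) > 0"
    using Im_grn_pos[OF z] Im_rp_pos[OF z] Im_rm_pos[OF z] n by auto
  show "\<bar>Im (Ln (rp n z) + Ln (rm n z)) - Im (\<i> * pi + (Ln (grn (Suc n) z) - Ln (grn n z)))\<bar> < 2 * pi"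
    using Im_Ln_bounds[OF i(1)] Im_Ln_bounds[OF i(2)] Im_Ln_bounds[OF i(3)] Im_Ln_bounds[OF i(4)] by simp
qed

lemma w_sum:
  assumes z: "Im z > 0" and N: "N \<ge> 1"
  shows "w_plus_avg a b N z + w_minus_avg a b N z = \<i> * pi + (Ln (grn (Suc N) z) - Ln (grn 1 z)) / of_nat N"
proof -
  have "(\<Sum>n=1..N. Ln (rp n z)) + (\<Sum>n=1..N. Ln (rm n z)) = (\<Sum>n=1..N. \<i> * pi + (Ln (grn (Suc n) z) - Ln (grn n z)))"
    unfolding sum.distrib[symmetric] using Ln_rp_rm[OF z] by (intro sum.cong) auto
  also have "\<dots> = of_nat N * (\<i> * pi) + (Ln (grn (Suc N) z) - Ln (grn 1 z))"
    using sum_Suc_diff'[of 1 "Suc N" "\<lambda>n. Ln (grn n z)"] by (simp add: sum.distrib atLeastLessThanSuc_atLeastAtMost)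
  finally have "w_plus_avg a b N z + w_minus_avg a b N z = (of_nat N * (\<i> * pi) + (Ln (grn (Suc N) z) - Ln (grn 1 z))) / of_nat N"
    unfolding w_plus_avg_def w_minus_avg_def rp_def rm_def by (simp flip: add_divide_distrib)
  then show ?thesis using N by (simp add: add_divide_distrib)
qed

lemma prod_rm:
  assumes z: "Im z > 0" shows "(\<Prod>n=1..N. rm n z) = fm (Suc N) z"
proof (induction N)
  case (Suc N)
  then show ?case using fm_nz[OF z, of N] by (simp add: rm_def)
qed simp

lemma continuous_fm: "continuous_on S (\<lambda>z. fm n z)"
  unfolding poly_jpoly[symmetric] by (intro continuous_intros)

text \<open>Both sides are logarithms of \<open>fm (Suc N) z\<close>, by \<open>prod_rm\<close> and
  by \<open>fm_prod\<close>. Their difference is continuous with discrete values on the connected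
  half plane, hence constant; the constant is found along a horizontal line.\<close>

lemma sum_Ln_rm:
  assumes z: "Im z > 0"
  shows "(\<Sum>n=1..N. Ln (rm n z)) = (\<Sum>s\<in>eigs N. Ln (z - of_real s)) - of_real (\<Sum>n=1..N. ln (a n))"
proof -
  let ?U = "{z. Im z > 0}"
  define D where "D z = (\<Sum>n=1..N. Ln (rm n z)) - ((\<Sum>s\<in>eigs N. Ln (z - of_real s)) - of_real (\<Sum>n=1..N. ln (a n)))" for z
  have nonpos: "w \<notin> \<real>\<^sub>\<le>\<^sub>0" if "Im w > 0" for w :: complex using that by (auto simp: complex_nonpos_Reals_iff)
  have expD: "exp (D z) = 1" if "Im z > 0" for z
  proof -
    have nz: "rm n z \<noteq> 0" if "n \<ge> 1" for n using Im_rm_pos[OF \<open>Im z > 0\<close> that] by auto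
    have "exp (\<Sum>n=1..N. Ln (rm n z)) = fm (Suc N) z"
      unfolding exp_sum[OF finite_atLeastAtMost] prod_rm[OF that, symmetric] using nz by (intro prod.cong) auto
    moreover have "exp (\<Sum>s\<in>eigs N. Ln (z - of_real s)) = (\<Prod>s\<in>eigs N. z - of_real s)"
      unfolding exp_sum[OF finite_eigs] by (intro prod.cong exp_Ln) (use that in \<open>auto simp: complex_eq_iff\<close>)
    moreover have "exp (of_real (\<Sum>n=1..N. ln (a n))) = (of_real (\<Prod>n=1..N. a n) :: complex)"
      unfolding exp_of_real exp_sum[OF finite_atLeastAtMost] by simp
    ultimately show ?thesis unfolding D_def exp_diff using fm_prod[of N z] fm_nz[OF that, of N] by simp
  qed
  have cont: "continuous_on ?U D"
    unfolding D_def rm_def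
    by (intro continuous_intros continuous_on_Ln' continuous_fm nonpos)
       (auto simp: fm_nz' Im_rm_pos[unfolded rm_def])
  from convex_connected[OF convex_halfspace_Im_gt] cont have "D constant_on ?U"
  proof (rule continuous_discrete_range_constant)
    fix x assume x: "x \<in> ?U"
    have "2 * pi \<le> norm (D y - D x)" if y: "y \<in> ?U" "D y \<noteq> D x" for y
    proof (rule ccontr)
      assume "\<not> 2 * pi \<le> norm (D y - D x)"
      then have "\<bar>Im (D y) - Im (D x)\<bar> < 2 * pi" using abs_Im_le_cmod[of "D y - D x"] by simp
      then show False using exp_complex_eqI[of "D y" "D x"] expD x y by auto
    qed
    then show "\<exists>e>0. \<forall>y. y \<in> ?U \<and> D y \<noteq> D x \<longrightarrow> e \<le> norm (D y - D x)"
      by (intro exI[of _ "2 * pi"]) auto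
  qed
  then obtain c where c: "D z = c" if "Im z > 0" for z unfolding constant_on_def by blast
  have "Re c = 0" using expD[OF z] c[OF z] exp_eq_1[of c] by simp
  have "Im c = 0"
  proof (rule antisym)
    \<comment> \<open>On the line \<open>Im z = 1\<close> the argument of each \<open>rm n z\<close>
      stays between 0 and \<pi>. Far to the right the arguments of all \<open>z - s\<close> tend to
      0, which gives \<open>Im c \<ge> 0\<close>; far to the left the \<open>N\<close> arguments
      tend to \<pi>, which gives \<open>Im c \<le> 0\<close>.\<close>
    define h where "h x = (\<Sum>s\<in>eigs N. Im (Ln (Complex (x - s) 1)))" for x
    have c_eq: "Im c = (\<Sum>n=1..N. Im (Ln (rm n (Complex x 1)))) - h x" for x
    proof -
      have "Complex x 1 - of_real s = Complex (x - s) 1" for s by (simp add: complex_eq_iff)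
      then show ?thesis using arg_cong[OF c[of "Complex x 1"], of Im] by (simp add: D_def h_def)
    qed
    have i: "Im (rm n (Complex x 1)) > 0" if "n \<ge> 1" for n x using Im_rm_pos[of "Complex x 1" n] that by simp
    have lo: "Im c \<ge> - h x" for x
    proof -
      have "0 \<le> (\<Sum>n=1..N. Im (Ln (rm n (Complex x 1))))"
        by (intro sum_nonneg less_imp_le[OF Im_Ln_bounds(1)] i) auto
      then show ?thesis unfolding c_eq[of x] by simp
    qed
    have hi: "Im c \<le> of_nat N * pi - h x" for x
    proof -
      have "(\<Sum>n=1..N. Im (Ln (rm n (Complex x 1)))) \<le> of_nat (card {1..N}) * pi"
        by (intro sum_bounded_above less_imp_le[OF Im_Ln_bounds(2)] i) auto
      then show ?thesis unfolding c_eq[of x] by simp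
    qed
    have "(h \<longlongrightarrow> (\<Sum>s\<in>eigs N. 0)) at_top" unfolding h_def by (intro tendsto_sum Im_Ln_shift_at_top)
    then have "((\<lambda>x. - h x) \<longlongrightarrow> - 0) at_top" by (intro tendsto_minus) simp
    then show "0 \<le> Im c" using tendsto_upperbound[of "\<lambda>x. - h x" "- 0" at_top "Im c"] lo by simp
    have "(h \<longlongrightarrow> (\<Sum>s\<in>eigs N. pi)) at_bot" unfolding h_def by (intro tendsto_sum Im_Ln_shift_at_bot)
    then have "((\<lambda>x. of_nat N * pi - h x) \<longlongrightarrow> of_nat N * pi - of_nat N * pi) at_bot"
      by (intro tendsto_intros) simp
    then show "Im c \<le> 0"
      using tendsto_lowerbound[of "\<lambda>x. of_nat N * pi - h x" "of_nat N * pi - of_nat N * pi" at_bot "Im c"] hi by simp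
  qed
  with \<open>Re c = 0\<close> have "D z = 0" using c[OF z] by (simp add: complex_eq_iff)
  then show ?thesis unfolding D_def by simp
qed

lemma w_plus_avg_eq:
  assumes z: "Im z > 0" and N: "N \<ge> 1"
  shows "w_plus_avg a b N z = \<i> * pi + of_real ((\<Sum>n=1..N. ln (a n)) / N)
     - (\<Sum>s\<in>eigs N. Ln (z - of_real s)) / of_nat N + (Ln (grn (Suc N) z) - Ln (grn 1 z)) / of_nat N"
proof -
  have "w_minus_avg a b N z = (\<Sum>n=1..N. Ln (rm n z)) / of_nat N"
    unfolding w_minus_avg_def rm_def by simp
  also have "\<dots> = (\<Sum>s\<in>eigs N. Ln (z - of_real s)) / of_nat N - of_real ((\<Sum>n=1..N. ln (a n)) / N)"
    unfolding sum_Ln_rm[OF z] by (simp add: diff_divide_distrib del: of_real_sum)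
  finally have "w_minus_avg a b N z = (\<Sum>s\<in>eigs N. Ln (z - of_real s)) / of_nat N - of_real ((\<Sum>n=1..N. ln (a n)) / N)" .
  moreover have "w_plus_avg a b N z = (w_plus_avg a b N z + w_minus_avg a b N z) - w_minus_avg a b N z" by simp
  ultimately show ?thesis unfolding w_sum[OF assms] by (simp del: of_real_sum)
qed

text \<open>Only the end terms survive, so a bound on \<open>fp\<close> in \<open>n\<close> is all
  that the sign of \<open>Re w\<close> requires.\<close>

lemma Re_w_plus_avg:
  assumes z: "Im z > 0"
  shows "Re (w_plus_avg a b N z) = (ln (cmod (fp (Suc N) z)) - ln (cmod (fp 1 z))) / N"
proof -
  have "Re (Ln (rp n z)) = ln (cmod (fp (Suc n) z)) - ln (cmod (fp n z))" for n
    using fp_nz[OF z] by (simp add: rp_def norm_divide ln_div)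
  then have "(\<Sum>n=1..N. Re (Ln (rp n z))) = ln (cmod (fp (Suc N) z)) - ln (cmod (fp 1 z))"
    using sum_Suc_diff'[of 1 "Suc N" "\<lambda>n. ln (cmod (fp n z))"] by (simp add: atLeastLessThanSuc_atLeastAtMost)
  then show ?thesis unfolding w_plus_avg_def rp_def by simp
qed

end

section \<open>The limit of the eigenvalue distributions\<close>

text \<open>The constant \<open>D\<close> makes the logarithmic kernel nonnegative on sets of diameter at most \<open>D\<close>.\<close>

definition pot_kernel :: "real \<Rightarrow> real \<Rightarrow> real \<Rightarrow> ennreal" where
  "pot_kernel D x y = (if x = y then \<infinity> else ennreal (ln (D / \<bar>x - y\<bar>)))"

lemma measurable_pot_kernel [measurable]: "(\<lambda>(x, y). pot_kernel D x y) \<in> borel_measurable (borel \<Otimes>\<^sub>M borel)"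
  unfolding pot_kernel_def by measurable

locale jacobi_limit = jacobi_coeffs +
  fixes N :: "nat \<Rightarrow> nat" and w :: "complex \<Rightarrow> complex" and \<kappa> :: "real measure" and A :: real
  assumes N_top: "filterlim N at_top sequentially"
    and w_lim: "locally_uniform_limit (\<lambda>j. w_plus_avg a b (N j)) w"
    and prob_\<kappa>: "prob_space \<kappa>" and sets_\<kappa>: "sets \<kappa> = sets borel"
    and weak: "weak_star_tendsto (\<lambda>j. eigenvalue_dist a b (N j)) \<kappa>"
    and root_lim: "(\<lambda>j. root (N j) (\<Prod>n=1..N j. a n)) \<longlonglongrightarrow> A" and A_pos: "A > 0"
begin

sublocale kap: prob_space \<kappa> by (rule prob_\<kappa>)

lemma space_\<kappa> [simp]: "space \<kappa> = UNIV"
  using sets_eq_imp_space_eq[OF sets_\<kappa>] by simp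

lemma meas_\<kappa> [measurable_cong]: "sets \<kappa> = sets borel" by (rule sets_\<kappa>)

lemma ev_N: "\<forall>\<^sub>F j in sequentially. N j \<ge> 1"
  using N_top by (simp add: filterlim_at_top)

lemma specR_pos: "specR > 0" using M_pos by (simp add: specR_def)

lemma kappa_limit:
  fixes f :: "real \<Rightarrow> real"
  assumes f: "continuous_on UNIV f" and f0: "(f \<longlongrightarrow> 0) at_infinity"
  shows "(\<lambda>j. (\<Sum>s\<in>eigs (N j). f s) / real (N j)) \<longlonglongrightarrow> (\<integral>t. f t \<partial>\<kappa>)"
proof -
  have m: "f \<in> borel_measurable borel" using f by (rule borel_measurable_continuous_onI)
  have "(\<lambda>j. \<integral>t. f t \<partial>eigenvalue_dist a b (N j)) \<longlonglongrightarrow> (\<integral>t. f t \<partial>\<kappa>)"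
    using weak f f0 unfolding weak_star_tendsto_def by blast
  moreover have "\<forall>\<^sub>F j in sequentially. (\<integral>t. f t \<partial>eigenvalue_dist a b (N j)) = (\<Sum>s\<in>eigs (N j). f s) / real (N j)"
    using ev_N by eventually_elim (rule integral_eigenvalue_dist[OF _ m])
  ultimately show ?thesis by (rule Lim_transform_eventually)
qed

text \<open>Weak convergence is tested on functions vanishing at infinity. This cutoff is 1 on an
  interval containing all eigenvalues, so multiplying by it admits arbitrary continuous test
  functions.\<close>

definition cut :: "real \<Rightarrow> real" where "cut t = max 0 (min 1 (specR + 1 - \<bar>t\<bar>))"

lemma cut_mult_limit:
  assumes f: "continuous_on UNIV f"
  shows "continuous_on UNIV (\<lambda>t. cut t * f t)"
    and "(\<lambda>j. (\<Sum>s\<in>eigs (N j). f s) / real (N j)) \<longlonglongrightarrow> (\<integral>t. cut t * f t \<partial>\<kappa>)"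
proof -
  show c: "continuous_on UNIV (\<lambda>t. cut t * f t)" unfolding cut_def by (intro continuous_intros f)
  have "\<forall>\<^sub>F t in at_infinity. cut t * f t = 0"
    unfolding eventually_at_infinity by (intro exI[of _ "specR + 1"]) (auto simp: cut_def)
  then have "((\<lambda>t. cut t * f t) \<longlongrightarrow> 0) at_infinity" by (rule tendsto_eventually)
  moreover have "(\<Sum>s\<in>eigs n. cut s * f s) = (\<Sum>s\<in>eigs n. f s)" for n
    using eigs_bound by (intro sum.cong) (auto simp: cut_def less_imp_le)
  ultimately show "(\<lambda>j. (\<Sum>s\<in>eigs (N j). f s) / real (N j)) \<longlonglongrightarrow> (\<integral>t. cut t * f t \<partial>\<kappa>)"
    using kappa_limit[OF c] by simp
qed

text \<open>Testing with \<open>cut\<close> itself shows that its integral is 1, the full mass, and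
  \<open>cut\<close> equals 1 exactly on the interval in question.\<close>

lemma AE_bounded: "AE s in \<kappa>. \<bar>s\<bar> \<le> specR"
proof -
  have c: "continuous_on UNIV cut" using cut_mult_limit(1)[of "\<lambda>t. 1"] by simp
  have i: "integrable \<kappa> cut"
    using borel_measurable_continuous_onI[OF c]
    by (intro kap.integrable_const_bound[of _ 1]) (auto simp: cut_def measurable_cong_sets[OF sets_\<kappa> refl])
  have "\<forall>\<^sub>F j in sequentially. (\<Sum>s\<in>eigs (N j). 1) / real (N j) = 1"
    using ev_N by eventually_elim simp
  then have "(\<lambda>j. (\<Sum>s\<in>eigs (N j). 1) / real (N j)) \<longlonglongrightarrow> 1" by (rule tendsto_eventually)
  moreover have "(\<lambda>j. (\<Sum>s\<in>eigs (N j). 1) / real (N j)) \<longlonglongrightarrow> (\<integral>t. cut t \<partial>\<kappa>)"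
    using cut_mult_limit(2)[of "\<lambda>t. 1"] by simp
  ultimately have "(\<integral>t. cut t \<partial>\<kappa>) = 1" using LIMSEQ_unique by blast
  then have "(\<integral>t. 1 - cut t \<partial>\<kappa>) = 0" using i kap.prob_space by simp
  moreover have "AE t in \<kappa>. 0 \<le> 1 - cut t" by (simp add: cut_def)
  ultimately have "AE t in \<kappa>. 1 - cut t = 0"
    using integral_nonneg_eq_0_iff_AE[of \<kappa> "\<lambda>t. 1 - cut t"] i by simp
  then show ?thesis by eventually_elim (auto simp: cut_def max_def min_def split: if_splits)
qed

lemma integrable_cont:
  fixes f :: "real \<Rightarrow> 'a::{banach, second_countable_topology}"
  assumes "continuous_on UNIV f"
  shows "integrable \<kappa> f"
proof -
  have "compact (f ` {-specR..specR})"
    by (intro compact_continuous_image continuous_on_subset[OF assms]) auto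
  then have "bounded (f ` {-specR..specR})" by (rule compact_imp_bounded)
  then obtain B where "\<forall>x\<in>f ` {-specR..specR}. norm x \<le> B" unfolding bounded_iff by blast
  then have B: "norm (f t) \<le> B" if "\<bar>t\<bar> \<le> specR" for t
    using that by (auto simp: abs_le_iff)
  have "f \<in> borel_measurable borel" using assms by (rule borel_measurable_continuous_onI)
  moreover have "AE t in \<kappa>. norm (f t) \<le> B"
    using AE_bounded by eventually_elim (use B in auto)
  ultimately show ?thesis
    by (intro kap.integrable_const_bound) (auto simp: measurable_cong_sets[OF sets_\<kappa> refl])
qed

lemma kappa_limit_cont:
  fixes f :: "real \<Rightarrow> real"
  assumes f: "continuous_on UNIV f"
  shows "(\<lambda>j. (\<Sum>s\<in>eigs (N j). f s) / real (N j)) \<longlonglongrightarrow> (\<integral>t. f t \<partial>\<kappa>)"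
proof -
  have "(\<integral>t. cut t * f t \<partial>\<kappa>) = (\<integral>t. f t \<partial>\<kappa>)"
  proof (rule integral_cong_AE)
    show "AE t in \<kappa>. cut t * f t = f t" using AE_bounded by eventually_elim (simp add: cut_def)
  qed (use borel_measurable_continuous_onI[OF cut_mult_limit(1)[OF f]] borel_measurable_continuous_onI[OF f]
       in \<open>auto simp: measurable_cong_sets[OF sets_\<kappa> refl]\<close>)
  then show ?thesis using cut_mult_limit(2)[OF f] by simp
qed

lemma kappa_limit_complex:
  fixes f :: "real \<Rightarrow> complex"
  assumes f: "continuous_on UNIV f"
  shows "(\<lambda>j. (\<Sum>s\<in>eigs (N j). f s) / of_nat (N j)) \<longlonglongrightarrow> (\<integral>t. f t \<partial>\<kappa>)"
proof -
  have "(\<lambda>j. (\<Sum>s\<in>eigs (N j). Re (f s)) / real (N j)) \<longlonglongrightarrow> (\<integral>t. Re (f t) \<partial>\<kappa>)"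
    "(\<lambda>j. (\<Sum>s\<in>eigs (N j). Im (f s)) / real (N j)) \<longlonglongrightarrow> (\<integral>t. Im (f t) \<partial>\<kappa>)"
    by (intro kappa_limit_cont continuous_intros f)+
  then show ?thesis
    by (simp add: tendsto_complex_iff integrable_cont[OF f])
qed

lemma ln_a_limit: "(\<lambda>j. (\<Sum>n=1..N j. ln (a n)) / N j) \<longlonglongrightarrow> ln A"
proof -
  have "(\<lambda>j. ln (root (N j) (\<Prod>n=1..N j. a n))) \<longlonglongrightarrow> ln A"
    using root_lim A_pos by (intro tendsto_ln) auto
  moreover have "\<forall>\<^sub>F j in sequentially. ln (root (N j) (\<Prod>n=1..N j. a n)) = (\<Sum>n=1..N j. ln (a n)) / N j"
    using ev_N by eventually_elim (simp add: ln_root ln_prod prod_pos)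
  ultimately show ?thesis by (rule Lim_transform_eventually)
qed

lemma w_pointwise: "Im z > 0 \<Longrightarrow> (\<lambda>j. w_plus_avg a b (N j) z) \<longlonglongrightarrow> w z"
proof -
  assume z: "Im z > 0"
  have "uniform_limit {z} (\<lambda>j. w_plus_avg a b (N j)) w sequentially"
    using w_lim[unfolded locally_uniform_limit_def upper_half_plane_def, rule_format, of "{z}"] z by simp
  then show "(\<lambda>j. w_plus_avg a b (N j) z) \<longlonglongrightarrow> w z" by (rule tendsto_uniform_limitI) auto
qed

lemma nonpos_Reals_Im: "Im z > 0 \<Longrightarrow> z \<notin> \<real>\<^sub>\<le>\<^sub>0"
  by (auto simp: complex_nonpos_Reals_iff)

lemma inverse_N: "(\<lambda>j. inverse (real (N j))) \<longlonglongrightarrow> 0"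
  by (intro tendsto_inverse_0_at_top filterlim_compose[OF filterlim_real_sequentially N_top])

lemma cont_Ln: "Im z > 0 \<Longrightarrow> continuous_on UNIV (\<lambda>s. Ln (z - of_real s))"
  by (intro continuous_intros continuous_on_Ln' nonpos_Reals_Im) auto

lemma w_formula:
  assumes z: "Im z > 0"
  shows "w z = \<i> * pi + of_real (ln A) - (\<integral>s. Ln (z - of_real s) \<partial>\<kappa>)"
proof (rule LIMSEQ_unique[OF w_pointwise[OF z]])
  obtain B where B: "\<And>n. n \<ge> 1 \<Longrightarrow> cmod (Ln (grn n z)) \<le> B" using Ln_grn_bound[OF z] by blast
  have e: "(\<lambda>j. (Ln (grn (Suc (N j)) z) - Ln (grn 1 z)) / of_nat (N j)) \<longlonglongrightarrow> 0"
  proof (rule Lim_null_comparison)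
    have "cmod ((Ln (grn (Suc (N j)) z) - Ln (grn 1 z)) / of_nat (N j)) \<le> (2 * B) * inverse (real (N j))" for j
    proof -
      have "cmod (Ln (grn (Suc (N j)) z) - Ln (grn 1 z)) \<le> 2 * B"
        using B[of "Suc (N j)"] B[of 1] norm_triangle_ineq4[of "Ln (grn (Suc (N j)) z)" "Ln (grn 1 z)"] by simp
      from mult_right_mono[OF this, of "inverse (real (N j))"] show ?thesis
        by (simp add: norm_divide divide_inverse norm_mult norm_inverse)
    qed
    then show "\<forall>\<^sub>F j in sequentially. cmod ((Ln (grn (Suc (N j)) z) - Ln (grn 1 z)) / of_nat (N j)) \<le> (2 * B) * inverse (real (N j))"
      by simp
    show "(\<lambda>j. (2 * B) * inverse (real (N j))) \<longlonglongrightarrow> 0"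
      using tendsto_mult[OF tendsto_const[of "2 * B"] inverse_N] by simp
  qed
  have "(\<lambda>j. \<i> * pi + of_real ((\<Sum>n=1..N j. ln (a n)) / N j) - (\<Sum>s\<in>eigs (N j). Ln (z - of_real s)) / of_nat (N j)
       + (Ln (grn (Suc (N j)) z) - Ln (grn 1 z)) / of_nat (N j))
     \<longlonglongrightarrow> \<i> * pi + of_real (ln A) - (\<integral>s. Ln (z - of_real s) \<partial>\<kappa>) + 0"
    by (intro tendsto_add tendsto_diff tendsto_const tendsto_of_real ln_a_limit kappa_limit_complex cont_Ln z e)
  moreover have "\<forall>\<^sub>F j in sequentially. \<i> * pi + of_real ((\<Sum>n=1..N j. ln (a n)) / N j) - (\<Sum>s\<in>eigs (N j). Ln (z - of_real s)) / of_nat (N j)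
       + (Ln (grn (Suc (N j)) z) - Ln (grn 1 z)) / of_nat (N j) = w_plus_avg a b (N j) z"
    using ev_N by eventually_elim (rule w_plus_avg_eq[OF z, symmetric])
  ultimately show "(\<lambda>j. w_plus_avg a b (N j) z) \<longlonglongrightarrow> \<i> * pi + of_real (ln A) - (\<integral>s. Ln (z - of_real s) \<partial>\<kappa>)"
    by (simp add: Lim_transform_eventually)
qed

lemma Re_w_nonpos:
  assumes z: "Im z > 0" shows "Re (w z) \<le> 0"
proof -
  obtain C where C: "C > 0" "\<And>n. cmod (fp n z) \<le> C"
    using fp_tendsto[OF z] convergent_imp_Bseq by (metis BseqE convergentI)
  have "(\<lambda>j. (ln C - ln (cmod (fp 1 z))) * inverse (real (N j))) \<longlonglongrightarrow> (ln C - ln (cmod (fp 1 z))) * 0"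
    by (intro tendsto_intros inverse_N)
  moreover have "(\<lambda>j. Re (w_plus_avg a b (N j) z)) \<longlonglongrightarrow> Re (w z)"
    by (intro tendsto_intros w_pointwise z)
  moreover have "Re (w_plus_avg a b (N j) z) \<le> (ln C - ln (cmod (fp 1 z))) * inverse (real (N j))" for j
  proof -
    have "ln (cmod (fp (Suc (N j)) z)) \<le> ln C"
      using fp_nz[OF z, of "Suc (N j)"] C by (intro ln_mono) auto
    then show ?thesis unfolding Re_w_plus_avg[OF z] by (simp add: divide_inverse mult_right_mono)
  qed
  ultimately show ?thesis using LIMSEQ_le[of _ "Re (w z)" _ "(ln C - ln (cmod (fp 1 z))) * 0"] by auto
qed

section \<open>Passage to the real axis\<close>

definition phi :: "real \<Rightarrow> real \<Rightarrow> real \<Rightarrow> real" where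
  "phi t y s = ln (cmod (Complex (t - s) y))"

lemma Complex_minus_real: "Complex t y - of_real s = Complex (t - s) y"
  by (simp add: complex_eq_iff)

lemma phi_cont: "y > 0 \<Longrightarrow> continuous_on UNIV (phi t y)"
  unfolding phi_def Complex_minus_real[symmetric]
  by (intro continuous_intros) (auto simp: complex_eq_iff)

lemma Re_w: "y > 0 \<Longrightarrow> - Re (w (Complex t y)) = (\<integral>s. phi t y s \<partial>\<kappa>) - ln A"
proof -
  assume y: "y > 0"
  have c: "integrable \<kappa> (\<lambda>s. Ln (Complex t y - of_real s))"
    by (intro integrable_cont cont_Ln) (use y in auto)
  have "Re (Ln (Complex t y - of_real s)) = phi t y s" for s
    unfolding Complex_minus_real phi_def using y by (subst Re_Ln) (auto simp: complex_eq_iff)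
  then have "Re (\<integral>s. Ln (Complex t y - of_real s) \<partial>\<kappa>) = (\<integral>s. phi t y s \<partial>\<kappa>)"
    by (simp flip: integral_Re add: c)
  then show ?thesis using y by (simp add: w_formula)
qed

lemma phi_ge: "y > 0 \<Longrightarrow> ln A \<le> (\<integral>s. phi t y s \<partial>\<kappa>)"
  using Re_w[of y t] Re_w_nonpos[of "Complex t y"] by simp

lemma cmod_shift_le:
  assumes "\<bar>t\<bar> + specR + 1 \<le> D" "\<bar>s\<bar> \<le> specR" "\<bar>y\<bar> \<le> 1"
  shows "cmod (Complex (t - s) y) \<le> D"
  using cmod_le[of "Complex (t - s) y"] assms by simp

text \<open>Fatou's lemma as the height \<open>y\<close> decreases to 0; the bound at positive
  height is \<open>phi_ge\<close>, that is, \<open>Re w \<le> 0\<close>. The summand 1 in the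
  condition on \<open>D\<close> leaves room for heights up to 1, which keeps the integrands
  nonnegative.\<close>

lemma potential_le:
  assumes D: "\<bar>t\<bar> + specR + 1 \<le> D"
  shows "(\<integral>\<^sup>+s. pot_kernel D t s \<partial>\<kappa>) \<le> ennreal (ln D - ln A)"
proof -
  have Dpos: "D \<ge> 1" using D specR_pos by linarith
  define y where "y n = inverse (real (Suc n))" for n
  have y: "y n > 0" "y n \<le> 1" for n unfolding y_def by (simp_all add: inverse_le_1_iff)
  have y0: "y \<longlonglongrightarrow> 0" unfolding y_def by (rule LIMSEQ_inverse_real_of_nat)
  have lim: "pot_kernel D t s \<le> liminf (\<lambda>n. ennreal (ln D - phi t (y n) s))" for s
  proof (cases "t = s")
    case True
    have "filterlim (\<lambda>n. ln D + - ln (y n)) at_top sequentially"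
    proof (intro filterlim_tendsto_add_at_top[OF tendsto_const] filterlim_compose[OF filterlim_uminus_at_top_at_bot]
        filterlim_compose[OF ln_at_0])
      show "filterlim y (at_right 0) sequentially"
        using y0 y(1) by (simp add: filterlim_at less_imp_neq[THEN not_sym])
    qed
    then have "(\<lambda>n. ennreal (ln D + - ln (y n))) \<longlonglongrightarrow> \<infinity>"
      by (simp add: ennreal_tendsto_top_eq_at_top)
    moreover have "ln D - phi t (y n) s = ln D + - ln (y n)" for n
      using y(1)[of n] True by (simp add: phi_def complex_norm abs_of_pos)
    ultimately have "liminf (\<lambda>n. ennreal (ln D - phi t (y n) s)) = \<infinity>"
      by (simp add: lim_imp_Liminf)
    then show ?thesis by simp
  next
    case False
    have "(\<lambda>n. phi t (y n) s) \<longlonglongrightarrow> ln (cmod (Complex (t - s) 0))"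
      unfolding phi_def using False by (intro tendsto_intros tendsto_Complex y0) (auto simp: complex_eq_iff)
    then have "(\<lambda>n. ennreal (ln D - phi t (y n) s)) \<longlonglongrightarrow> ennreal (ln D - ln \<bar>t - s\<bar>)"
      by (intro tendsto_ennrealI tendsto_intros) (simp add: complex_norm)
    then have "liminf (\<lambda>n. ennreal (ln D - phi t (y n) s)) = ennreal (ln D - ln \<bar>t - s\<bar>)"
      by (simp add: lim_imp_Liminf)
    then show ?thesis using False Dpos by (simp add: pot_kernel_def ln_div)
  qed
  have cont: "continuous_on UNIV (\<lambda>s. ln D - phi t (y n) s)" for n
    by (intro continuous_intros phi_cont y)
  have "(\<integral>\<^sup>+s. pot_kernel D t s \<partial>\<kappa>) \<le> (\<integral>\<^sup>+s. liminf (\<lambda>n. ennreal (ln D - phi t (y n) s)) \<partial>\<kappa>)"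
    by (intro nn_integral_mono lim)
  also have "\<dots> \<le> liminf (\<lambda>n. \<integral>\<^sup>+s. ennreal (ln D - phi t (y n) s) \<partial>\<kappa>)"
    using borel_measurable_continuous_onI[OF cont]
    by (intro nn_integral_liminf) (auto simp: measurable_cong_sets[OF sets_\<kappa> refl])
  also have "\<dots> \<le> liminf (\<lambda>n::nat. ennreal (ln D - ln A))"
  proof (intro Liminf_mono always_eventually allI)
    fix n
    have "(\<integral>\<^sup>+s. ennreal (ln D - phi t (y n) s) \<partial>\<kappa>) = ennreal (\<integral>s. ln D - phi t (y n) s \<partial>\<kappa>)"
    proof (rule nn_integral_eq_integral[OF integrable_cont[OF cont]])
      show "AE s in \<kappa>. 0 \<le> ln D - phi t (y n) s"
        using AE_bounded
      proof eventually_elim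
        case (elim s)
        have "cmod (Complex (t - s) (y n)) \<le> D" using y[of n] by (intro cmod_shift_le D elim) auto
        moreover have "cmod (Complex (t - s) (y n)) > 0" using y[of n] by (auto simp: complex_eq_iff)
        ultimately show ?case unfolding phi_def by (simp add: ln_mono)
      qed
    qed
    also have "(\<integral>s. ln D - phi t (y n) s \<partial>\<kappa>) = ln D - (\<integral>s. phi t (y n) s \<partial>\<kappa>)"
      using integrable_cont[OF phi_cont[OF y(1)]] by (subst Bochner_Integration.integral_diff) (auto simp: kap.prob_space[simplified])
    finally show "(\<integral>\<^sup>+s. ennreal (ln D - phi t (y n) s) \<partial>\<kappa>) \<le> ennreal (ln D - ln A)"
      using phi_ge[OF y(1)[of n], of t] by (simp add: ennreal_leI)
  qed
  finally show ?thesis by (simp add: Liminf_const)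
qed

text \<open>The kernel is infinite on the diagonal, so an atom at \<open>t\<close> would make the
  potential at \<open>t\<close> infinite.\<close>

lemma AE_neq: "AE s in \<kappa>. s \<noteq> t"
proof -
  have "(\<integral>\<^sup>+s. pot_kernel (\<bar>t\<bar> + specR + 1) t s \<partial>\<kappa>) \<noteq> \<infinity>"
    using potential_le[of t "\<bar>t\<bar> + specR + 1"] by (auto simp: top_unique)
  then have "AE s in \<kappa>. pot_kernel (\<bar>t\<bar> + specR + 1) t s \<noteq> \<infinity>"
    by (intro nn_integral_noteq_infinite) auto
  then show ?thesis by eventually_elim (auto simp: pot_kernel_def)
qed

lemma ln_ge0_of_bound:
  assumes "\<bar>t\<bar> + specR + 1 \<le> D" "\<bar>s\<bar> \<le> specR" "s \<noteq> t"
  shows "0 \<le> ln (D / \<bar>t - s\<bar>)" "ln (D / \<bar>t - s\<bar>) = ln D - ln \<bar>t - s\<bar>"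
proof -
  have "\<bar>t - s\<bar> \<le> D" "D > 0" using assms specR_pos by linarith+
  then show "0 \<le> ln (D / \<bar>t - s\<bar>)" "ln (D / \<bar>t - s\<bar>) = ln D - ln \<bar>t - s\<bar>"
    using assms(3) by (auto simp: ln_div)
qed

abbreviation potential :: "real \<Rightarrow> real" where
  "potential t \<equiv> \<integral>s. ln \<bar>t - s\<bar> \<partial>\<kappa>"

lemma integrable_ln: "integrable \<kappa> (\<lambda>s. ln \<bar>t - s\<bar>)"
  and potential_eq: "\<bar>t\<bar> + specR + 1 \<le> D \<Longrightarrow>
    (\<integral>\<^sup>+s. pot_kernel D t s \<partial>\<kappa>) = ennreal (ln D - potential t) \<and>
    0 \<le> ln D - potential t"
proof -
  have main: "integrable \<kappa> (\<lambda>s. ln D - ln \<bar>t - s\<bar>) \<and>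
     (\<integral>\<^sup>+s. pot_kernel D t s \<partial>\<kappa>) = ennreal (\<integral>s. ln D - ln \<bar>t - s\<bar> \<partial>\<kappa>) \<and> 0 \<le> (\<integral>s. ln D - ln \<bar>t - s\<bar> \<partial>\<kappa>)"
    if D: "\<bar>t\<bar> + specR + 1 \<le> D" for D
  proof -
    have AE: "AE s in \<kappa>. 0 \<le> ln D - ln \<bar>t - s\<bar> \<and> pot_kernel D t s = ennreal (ln D - ln \<bar>t - s\<bar>)"
      using AE_neq[of t] AE_bounded
      by eventually_elim (use ln_ge0_of_bound[OF D] in \<open>auto simp: pot_kernel_def\<close>)
    have "(\<integral>\<^sup>+s. ennreal (ln D - ln \<bar>t - s\<bar>) \<partial>\<kappa>) = (\<integral>\<^sup>+s. pot_kernel D t s \<partial>\<kappa>)"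
      by (rule nn_integral_cong_AE) (use AE in eventually_elim, simp)
    moreover have "\<dots> < \<infinity>" using potential_le[OF D] by (auto simp: top_unique less_top[symmetric])
    ultimately have i: "integrable \<kappa> (\<lambda>s. ln D - ln \<bar>t - s\<bar>)"
      by (intro integrableI_nonneg) (use AE in \<open>auto elim: eventually_mono\<close>)
    moreover have "0 \<le> (\<integral>s. ln D - ln \<bar>t - s\<bar> \<partial>\<kappa>)"
      by (rule integral_nonneg_AE) (use AE in \<open>auto elim: eventually_mono\<close>)
    moreover have "(\<integral>\<^sup>+s. ennreal (ln D - ln \<bar>t - s\<bar>) \<partial>\<kappa>) = ennreal (\<integral>s. ln D - ln \<bar>t - s\<bar> \<partial>\<kappa>)"
      by (rule nn_integral_eq_integral[OF i]) (use AE in \<open>auto elim: eventually_mono\<close>)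
    ultimately show ?thesis using \<open>(\<integral>\<^sup>+s. ennreal (ln D - ln \<bar>t - s\<bar>) \<partial>\<kappa>) = (\<integral>\<^sup>+s. pot_kernel D t s \<partial>\<kappa>)\<close> by simp
  qed
  have "integrable \<kappa> (\<lambda>s. ln (\<bar>t\<bar> + specR + 1) - (ln (\<bar>t\<bar> + specR + 1) - ln \<bar>t - s\<bar>))"
    by (intro Bochner_Integration.integrable_diff main[THEN conjunct1]) auto
  then show int: "integrable \<kappa> (\<lambda>s. ln \<bar>t - s\<bar>)" by simp
  have eq: "(\<integral>s. ln D - ln \<bar>t - s\<bar> \<partial>\<kappa>) = ln D - potential t" for D
    using int by (subst Bochner_Integration.integral_diff) (auto simp: kap.prob_space[simplified])
  show "\<bar>t\<bar> + specR + 1 \<le> D \<Longrightarrow>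
    (\<integral>\<^sup>+s. pot_kernel D t s \<partial>\<kappa>) = ennreal (ln D - potential t) \<and> 0 \<le> ln D - potential t"
    using main[of D] unfolding eq by simp
qed

text \<open>Reduces a one-sided limit to sequences, along which dominated convergence applies; the
  bound \<open>X n \<le> 1\<close> is what the majorant in \<open>gamma_eq\<close> asks for.\<close>

lemma at_right_sequentiallyI:
  fixes f :: "real \<Rightarrow> real"
  assumes "\<And>X. (\<And>n. X n > 0) \<Longrightarrow> (\<And>n. X n \<le> 1) \<Longrightarrow> X \<longlonglongrightarrow> 0 \<Longrightarrow> (\<lambda>n. f (X n)) \<longlonglongrightarrow> L"
  shows "(f \<longlongrightarrow> L) (at_right 0)"
proof (rule tendsto_at_right_sequentially[of 0 1])
  fix S :: "nat \<Rightarrow> real"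
  assume "\<And>n. 0 < S n" "\<And>n. S n < 1" "decseq S" "S \<longlonglongrightarrow> 0"
  then show "(\<lambda>n. f (S n)) \<longlonglongrightarrow> L" using assms[of S] by (auto simp: less_imp_le)
qed simp

lemma gamma_eq: "gamma_bdry w t = potential t - ln A"
  and gamma_nonneg: "0 \<le> gamma_bdry w t"
proof -
  define D where "D = \<bar>t\<bar> + specR + 1"
  have D1: "D \<ge> 1" using specR_pos by (simp add: D_def)
  have lim: "((\<lambda>y. \<integral>s. phi t y s \<partial>\<kappa>) \<longlongrightarrow> potential t) (at_right 0)"
  proof (rule at_right_sequentiallyI)
    fix X :: "nat \<Rightarrow> real" assume X: "\<And>n. X n > 0" "\<And>n. X n \<le> 1" "X \<longlonglongrightarrow> 0"
    show "(\<lambda>n. \<integral>s. phi t (X n) s \<partial>\<kappa>) \<longlonglongrightarrow> potential t"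
    \<comment> \<open>For heights up to 1 the integrand lies between
      \<open>ln \<bar>t - s\<bar>\<close> and \<open>ln D\<close>, and
      \<open>ln D \<ge> 0\<close>.\<close>
    proof (rule integral_dominated_convergence[where w="\<lambda>s. \<bar>ln \<bar>t - s\<bar>\<bar> + ln D"])
      show "integrable \<kappa> (\<lambda>s. \<bar>ln \<bar>t - s\<bar>\<bar> + ln D)" using integrable_ln by auto
      show "AE s in \<kappa>. (\<lambda>n. phi t (X n) s) \<longlonglongrightarrow> ln \<bar>t - s\<bar>"
        using AE_neq[of t]
      proof eventually_elim
        case (elim s)
        have "(\<lambda>n. phi t (X n) s) \<longlonglongrightarrow> ln (cmod (Complex (t - s) 0))"
          unfolding phi_def using elim by (intro tendsto_intros tendsto_Complex X(3)) (auto simp: complex_eq_iff)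
        then show ?case by (simp add: complex_norm)
      qed
      show "AE s in \<kappa>. norm (phi t (X n) s) \<le> \<bar>ln \<bar>t - s\<bar>\<bar> + ln D" for n
        using AE_neq[of t] AE_bounded
      proof eventually_elim
        case (elim s)
        have "cmod (Complex (t - s) (X n)) \<le> D"
          using X(1,2)[of n] by (intro cmod_shift_le elim) (auto simp: D_def)
        moreover have "cmod (Complex (t - s) (X n)) > 0" using X(1)[of n] by (auto simp: complex_eq_iff)
        ultimately have "phi t (X n) s \<le> ln D" unfolding phi_def by (simp add: ln_mono)
        moreover have "ln \<bar>t - s\<bar> \<le> phi t (X n) s"
          unfolding phi_def using elim abs_Re_le_cmod[of "Complex (t - s) (X n)"] by (intro ln_mono) auto
        moreover have "0 \<le> ln D" using D1 by simp
        ultimately show ?case by simp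
      qed
    qed (use borel_measurable_continuous_onI[OF phi_cont[OF X(1)]] in \<open>auto simp: measurable_cong_sets[OF sets_\<kappa> refl]\<close>)
  qed
  have lim2: "((\<lambda>y. - Re (w (Complex t y))) \<longlongrightarrow> potential t - ln A) (at_right 0)"
  proof (rule Lim_transform_eventually)
    show "((\<lambda>y. (\<integral>s. phi t y s \<partial>\<kappa>) - ln A) \<longlongrightarrow> potential t - ln A) (at_right 0)"
      by (intro tendsto_intros lim)
    show "\<forall>\<^sub>F y in at_right 0. (\<integral>s. phi t y s \<partial>\<kappa>) - ln A = - Re (w (Complex t y))"
      using eventually_at_right_less[of 0] by eventually_elim (simp add: Re_w)
  qed
  show eq: "gamma_bdry w t = potential t - ln A"
    unfolding gamma_bdry_def by (rule tendsto_Lim[OF _ lim2]) simp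
  have "\<forall>\<^sub>F y in at_right 0. 0 \<le> - Re (w (Complex t y))"
    using eventually_at_right_less[of 0] by eventually_elim (use Re_w_nonpos in auto)
  from tendsto_lowerbound[OF lim2 this] show "0 \<le> gamma_bdry w t" unfolding eq by simp
qed

text \<open>As \<open>y\<close> decreases to 0, the argument of \<open>t - s + \<i> y\<close> tends
  to 0 for \<open>s < t\<close> and to \<pi> for \<open>s > t\<close>, and \<open>s = t\<close> is a
  null event. Hence \<open>Im w / \<pi>\<close> tends to 1 minus the mass to the right of
  \<open>t\<close>.\<close>

lemma k_bdry_eq: "k_bdry w t = cdf \<kappa> t"
proof -
  have lim: "((\<lambda>y. \<integral>s. Im (Ln (Complex (t - s) y)) \<partial>\<kappa>) \<longlongrightarrow> (\<integral>s. pi * indicator {t<..} s \<partial>\<kappa>)) (at_right 0)"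
  proof (rule at_right_sequentiallyI)
    fix X :: "nat \<Rightarrow> real" assume X: "\<And>n. X n > 0" "\<And>n. X n \<le> 1" "X \<longlonglongrightarrow> 0"
    have c: "continuous_on UNIV (\<lambda>s. Im (Ln (Complex (t - s) (X n))))" for n
      unfolding Complex_minus_real[symmetric] by (intro continuous_intros cont_Ln) (use X in auto)
    show "(\<lambda>n. \<integral>s. Im (Ln (Complex (t - s) (X n))) \<partial>\<kappa>) \<longlonglongrightarrow> (\<integral>s. pi * indicator {t<..} s \<partial>\<kappa>)"
    proof (rule integral_dominated_convergence[where w="\<lambda>s. pi"])
      show "AE s in \<kappa>. norm (Im (Ln (Complex (t - s) (X n)))) \<le> pi" for n
        using Im_Ln_bounds[of "Complex (t - s) (X n)" for s] X(1)[of n] by (auto simp: less_imp_le)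
      show "AE s in \<kappa>. (\<lambda>n. Im (Ln (Complex (t - s) (X n)))) \<longlonglongrightarrow> pi * indicator {t<..} s"
        using AE_neq[of t]
      proof eventually_elim
        case (elim s)
        have "(\<lambda>n. X n / (t - s)) \<longlonglongrightarrow> 0 / (t - s)" using elim by (intro tendsto_intros X) auto
        then have l: "(\<lambda>n. arctan (X n / (t - s))) \<longlonglongrightarrow> arctan 0" by (intro tendsto_arctan) simp
        have eq: "Im (Ln (Complex (t - s) (X n))) = arctan (X n / (t - s)) + pi * indicator {t<..} s" for n
          using elim X(1)[of n] by (subst Im_Ln_eq) (auto simp: complex_eq_iff)
        show ?case unfolding eq using tendsto_add[OF l tendsto_const] by simp
      qed
    qed (use borel_measurable_continuous_onI[OF c] in \<open>auto simp: measurable_cong_sets[OF sets_\<kappa> refl]\<close>)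
  qed
  have "((\<lambda>y. Im (w (Complex t y)) / pi) \<longlongrightarrow> (pi - (\<integral>s. pi * indicator {t<..} s \<partial>\<kappa>)) / pi) (at_right 0)"
  proof (rule Lim_transform_eventually)
    show "((\<lambda>y. (pi - (\<integral>s. Im (Ln (Complex (t - s) y)) \<partial>\<kappa>)) / pi) \<longlongrightarrow> (pi - (\<integral>s. pi * indicator {t<..} s \<partial>\<kappa>)) / pi) (at_right 0)"
      by (intro tendsto_intros lim) simp
    have "(pi - (\<integral>s. Im (Ln (Complex (t - s) y)) \<partial>\<kappa>)) / pi = Im (w (Complex t y)) / pi" if "y > 0" for y
    proof -
      have c: "integrable \<kappa> (\<lambda>s. Ln (Complex t y - of_real s))"
        by (intro integrable_cont cont_Ln) (use that in auto)
      show ?thesis using that c by (simp add: w_formula flip: integral_Im Complex_minus_real)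
    qed
    then show "\<forall>\<^sub>F y in at_right 0. (pi - (\<integral>s. Im (Ln (Complex (t - s) y)) \<partial>\<kappa>)) / pi = Im (w (Complex t y)) / pi"
      using eventually_at_right_less[of 0] by (auto elim: eventually_mono)
  qed
  then have "k_bdry w t = (pi - (\<integral>s. pi * indicator {t<..} s \<partial>\<kappa>)) / pi"
    unfolding k_bdry_def by (intro tendsto_Lim) simp
  also have "\<dots> = 1 - measure \<kappa> {t<..}" by (simp add: field_simps)
  also have "{t<..} = space \<kappa> - {..t}" by auto
  also have "1 - measure \<kappa> (space \<kappa> - {..t}) = cdf \<kappa> t"
    using kap.prob_compl[of "{..t}"] by (simp add: cdf_def sets_\<kappa>)
  finally show ?thesis .
qed

lemma dk_eq: "dk_measure w = \<kappa>"
proof -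
  have rd: "real_distribution \<kappa>"
    by (intro real_distribution.intro real_distribution_axioms.intro prob_\<kappa>) (auto simp: sets_\<kappa>)
  then interpret rd: real_distribution \<kappa> .
  note c = rd.cdf_nondecreasing rd.cdf_is_right_cont rd.cdf_lim_at_bot rd.cdf_lim_at_top_prob
  have "interval_measure (cdf \<kappa>) = \<kappa>"
    by (rule cdf_unique[OF real_distribution_interval_measure[OF c] rd cdf_interval_measure[OF c(1-3)]])
  moreover have "k_bdry w = cdf \<kappa>" by (rule ext) (rule k_bdry_eq)
  ultimately show ?thesis unfolding dk_measure_def by simp
qed

end

section \<open>Logarithmic energy\<close>

lemma ennreal_two_mult_le_squares: "2 * (x * y) \<le> x * x + y * (y::ennreal)"
proof (cases x; cases y)
  fix r s :: real assume rs: "x = ennreal r" "0 \<le> r" "y = ennreal s" "0 \<le> s"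
  have "2 * (x * y) = ennreal (2 * (r * s))" using rs by (simp add: ennreal_mult)
  also have "\<dots> \<le> ennreal (r * r + s * s)"
    using sum_squares_bound[of r s] by (intro ennreal_leI) (simp add: power2_eq_square)
  also have "\<dots> = x * x + y * y" using rs by (simp add: ennreal_mult ennreal_plus)
  finally show ?thesis .
qed auto

abbreviation energy :: "('a \<Rightarrow> 'a \<Rightarrow> ennreal) \<Rightarrow> 'a measure \<Rightarrow> 'a measure \<Rightarrow> ennreal" where
  "energy k \<mu> \<nu> \<equiv> \<integral>\<^sup>+x. (\<integral>\<^sup>+y. k x y \<partial>\<nu>) \<partial>\<mu>"

text \<open>Positive definiteness is stated without subtraction, so that infinite values are allowed.\<close>

lemma positive_definite_kernel:
  fixes \<phi> :: "'a \<Rightarrow> 'c \<Rightarrow> ennreal"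
  assumes "sigma_finite_measure \<mu>" "sigma_finite_measure \<nu>" "sigma_finite_measure P"
    and S: "sets \<mu> = sets X" "sets \<nu> = sets X"
    and \<phi>: "case_prod \<phi> \<in> borel_measurable (X \<Otimes>\<^sub>M P)"
  defines "T \<equiv> \<lambda>x y. \<integral>\<^sup>+p. \<phi> x p * \<phi> y p \<partial>P"
  shows "2 * energy T \<mu> \<nu> \<le> energy T \<mu> \<mu> + energy T \<nu> \<nu>"
proof -
  \<comment> \<open>By Tonelli a mutual energy is the integral over \<open>P\<close> of the product
    of the two transforms of the measures, so the claim reduces to
    \<open>2 * u * v \<le> u * u + v * v\<close> at each point.\<close>
  have fact: "energy T M M' = (\<integral>\<^sup>+p. (\<integral>\<^sup>+x. \<phi> x p \<partial>M) * (\<integral>\<^sup>+y. \<phi> y p \<partial>M') \<partial>P)"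
    if M: "sigma_finite_measure M" "sigma_finite_measure M'" "sets M = sets X" "sets M' = sets X" for M M'
  proof -
    interpret A: pair_sigma_finite M P by (intro pair_sigma_finite.intro M assms)
    interpret B: pair_sigma_finite M' P by (intro pair_sigma_finite.intro M assms)
    note [measurable_cong] = M(3,4)
    note [measurable] = \<phi>
    have "(\<integral>\<^sup>+y. T x y \<partial>M') = (\<integral>\<^sup>+p. \<phi> x p * (\<integral>\<^sup>+y. \<phi> y p \<partial>M') \<partial>P)" if x: "x \<in> space M" for x
    proof -
      have "x \<in> space X" using x sets_eq_imp_space_eq[OF M(3)] by simp
      then have "(\<lambda>(y, p). \<phi> x p * \<phi> y p) \<in> borel_measurable (M' \<Otimes>\<^sub>M P)" by measurable
      then have "(\<integral>\<^sup>+y. T x y \<partial>M') = (\<integral>\<^sup>+p. (\<integral>\<^sup>+y. \<phi> x p * \<phi> y p \<partial>M') \<partial>P)"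
        unfolding T_def by (rule B.Fubini'[symmetric])
      also have "\<dots> = (\<integral>\<^sup>+p. \<phi> x p * (\<integral>\<^sup>+y. \<phi> y p \<partial>M') \<partial>P)"
        by (intro nn_integral_cong nn_integral_cmult) measurable
      finally show ?thesis .
    qed
    then have "energy T M M' = (\<integral>\<^sup>+x. (\<integral>\<^sup>+p. \<phi> x p * (\<integral>\<^sup>+y. \<phi> y p \<partial>M') \<partial>P) \<partial>M)"
      by (intro nn_integral_cong) auto
    also have "\<dots> = (\<integral>\<^sup>+p. (\<integral>\<^sup>+x. \<phi> x p * (\<integral>\<^sup>+y. \<phi> y p \<partial>M') \<partial>M) \<partial>P)"
      by (rule A.Fubini'[symmetric]) measurable
    also have "\<dots> = (\<integral>\<^sup>+p. (\<integral>\<^sup>+x. \<phi> x p \<partial>M) * (\<integral>\<^sup>+y. \<phi> y p \<partial>M') \<partial>P)"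
      by (intro nn_integral_cong nn_integral_multc) measurable
    finally show ?thesis .
  qed
  interpret A: sigma_finite_measure \<mu> by fact
  interpret B: sigma_finite_measure \<nu> by fact
  note [measurable_cong] = S
  note [measurable] = \<phi>
  show ?thesis
    unfolding fact[OF assms(1,2) S] fact[OF assms(1,1) S(1,1)] fact[OF assms(2,2) S(2,2)]
    by (subst nn_integral_cmult[symmetric], measurable, subst nn_integral_add[symmetric], measurable)
       (intro nn_integral_mono ennreal_two_mult_le_squares)
qed

text \<open>The triangle \<open>(h - \<bar>x - y\<bar>)\<^sup>+\<close> is the overlap of the intervals of length \<open>h\<close> starting at \<open>x\<close> and
  \<open>y\<close>; its integral against \<open>dh / h\<^sup>2\<close> is the logarithmic kernel up to a small correction.\<close>

definition tri_kernel :: "real \<Rightarrow> real \<Rightarrow> real \<Rightarrow> ennreal" where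
  "tri_kernel R x y = (\<integral>\<^sup>+p. (case p of (h, u) \<Rightarrow> indicator {0<..R} h * ennreal (1 / h) * indicator {x..x + h} u)
       * (case p of (h, u) \<Rightarrow> indicator {0<..R} h * ennreal (1 / h) * indicator {y..y + h} u) \<partial>(lborel \<Otimes>\<^sub>M lborel))"

lemma tri_kernel_pd:
  assumes "prob_space \<mu>" "prob_space \<nu>" "sets \<mu> = sets borel" "sets \<nu> = sets borel"
  shows "2 * energy (tri_kernel R) \<mu> \<nu>
     \<le> energy (tri_kernel R) \<mu> \<mu> + energy (tri_kernel R) \<nu> \<nu>"
  unfolding tri_kernel_def
proof (rule positive_definite_kernel[OF _ _ _ assms(3,4)])
  interpret prob_space \<mu> by fact
  show "sigma_finite_measure \<mu>" ..
  interpret nu: prob_space \<nu> by fact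
  show "sigma_finite_measure \<nu>" ..
  show "sigma_finite_measure (lborel \<Otimes>\<^sub>M lborel :: (real \<times> real) measure)"
    by (simp add: lborel_prod sigma_finite_lborel)
  have *: "indicator {x..x + h} u = (indicator {q. fst q \<le> snd (snd q) \<and> snd (snd q) \<le> fst q + fst (snd q)} (x, h, u) :: ennreal)"
    for x h u :: real by (auto split: split_indicator)
  show "(\<lambda>(x, p). case p of (h, u) \<Rightarrow> indicator {0<..R} h * ennreal (1 / h) * indicator {x..x + h} u)
    \<in> borel_measurable (borel \<Otimes>\<^sub>M (lborel \<Otimes>\<^sub>M lborel))"
    unfolding * by measurable
qed

lemma measurable_tri_kernel: "(\<lambda>(x, y). tri_kernel R x y) \<in> borel_measurable (borel \<Otimes>\<^sub>M borel)"
proof -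
  interpret sigma_finite_measure "lborel \<Otimes>\<^sub>M lborel :: (real \<times> real) measure"
    by (simp add: lborel_prod sigma_finite_lborel)
  have *: "indicator {x..x + h} u = (if x \<le> u \<and> u \<le> x + h then 1 else 0 :: ennreal)"
    for x h u :: real by (auto split: split_indicator)
  show ?thesis unfolding tri_kernel_def * by measurable
qed

text \<open>Intervals of length \<open>h\<close> whose starting points have distance
  \<open>d\<close> overlap in length \<open>h - d\<close>. Integrating \<open>(h - d) / h^2\<close>
  from \<open>d\<close> to \<open>R\<close> gives the logarithm and a correction
  \<open>d / R - 1\<close>, which becomes constant as \<open>R\<close> grows.\<close>

lemma tri_kernel_eq:
  assumes d: "x \<noteq> y" "\<bar>x - y\<bar> \<le> R"
  shows "tri_kernel R x y = ennreal (ln (R / \<bar>x - y\<bar>) + \<bar>x - y\<bar> / R - 1)"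
proof -
  define d where "d = \<bar>x - y\<bar>"
  have d0: "0 < d" "d \<le> R" using assms by (auto simp: d_def)
  have *: "indicator {x..x + h} u = (if x \<le> u \<and> u \<le> x + h then 1 else 0 :: ennreal)"
    for x h u :: real by (auto split: split_indicator)
  have inner: "(\<integral>\<^sup>+u. (indicator {0<..R} h * ennreal (1 / h) * indicator {x..x + h} u) * (indicator {0<..R} h * ennreal (1 / h) * indicator {y..y + h} u) \<partial>lborel)
      = ennreal ((h - d) / h\<^sup>2) * indicator {d..R} h" for h
  proof (cases "0 < h \<and> h \<le> R")
    case True
    have "(\<integral>\<^sup>+u. (indicator {0<..R} h * ennreal (1 / h) * indicator {x..x + h} u) * (indicator {0<..R} h * ennreal (1 / h) * indicator {y..y + h} u) \<partial>lborel)
       = (\<integral>\<^sup>+u. ennreal (1 / h\<^sup>2) * indicator {max x y..min x y + h} u \<partial>lborel)"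
      using True by (intro nn_integral_cong) (auto split: split_indicator simp: ennreal_mult[symmetric] power2_eq_square)
    also have "\<dots> = ennreal (1 / h\<^sup>2) * emeasure lborel {max x y..min x y + h}"
      by (simp add: nn_integral_cmult_indicator)
    also have "emeasure lborel {max x y..min x y + h} = ennreal (h - d) * indicator {d..R} h"
      using True by (auto simp: emeasure_lborel_Icc_eq d_def max_def min_def abs_if split: split_indicator)
    also have "ennreal (1 / h\<^sup>2) * (ennreal (h - d) * indicator {d..R} h) = ennreal ((h - d) / h\<^sup>2) * indicator {d..R} h"
      by (auto split: split_indicator simp: ennreal_mult'[symmetric] field_simps)
    finally show ?thesis .
  next
    case False
    then show ?thesis using d0 by (auto split: split_indicator)
  qed
  have "tri_kernel R x y = (\<integral>\<^sup>+h. ennreal ((h - d) / h\<^sup>2) * indicator {d..R} h \<partial>lborel)"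
    unfolding tri_kernel_def inner[symmetric]
    by (subst lborel.nn_integral_fst[symmetric]) (auto simp: *)
  also have "\<dots> = ennreal ((ln R + d / R) - (ln d + d / d))"
  proof (rule nn_integral_FTC_Icc)
    fix h assume h: "h \<in> {d..R}"
    show "((\<lambda>h. ln h + d / h) has_real_derivative (h - d) / h\<^sup>2) (at h)"
      using h d0 by (auto intro!: derivative_eq_intros simp: field_simps power2_eq_square)
    show "0 \<le> (h - d) / h\<^sup>2" using h by simp
  qed (use d0 in auto)
  also have "(ln R + d / R) - (ln d + d / d) = ln (R / d) + d / R - 1"
    using d0 by (simp add: ln_div)
  finally show ?thesis unfolding d_def .
qed

text \<open>A two-sided comparison with error only \<open>D / R\<close>. On the diagonal just the
  second inequality is claimed, its right side being infinite there; this is why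
  \<open>pot_kernel_pd\<close> asks that one measure have no atoms.\<close>

lemma pot_kernel_compare:
  assumes D: "\<bar>x - y\<bar> \<le> D" "D \<le> R" "0 < D"
  shows "x \<noteq> y \<Longrightarrow> pot_kernel D x y + ennreal (ln (R / D)) \<le> tri_kernel R x y + 1"
    "tri_kernel R x y + 1 \<le> pot_kernel D x y + (ennreal (ln (R / D)) + ennreal (D / R))"
proof -
  define d where "d = \<bar>x - y\<bar>"
  have *: "0 \<le> ln (D / d)" "0 \<le> ln (R / D)" "ln (R / d) = ln (D / d) + ln (R / D)"
    "0 \<le> d / R" "d / R \<le> D / R" "0 \<le> ln (R / d) + d / R - 1" "0 \<le> D / R" if "x \<noteq> y"
  proof -
    have d0: "0 < d" "d \<le> D" using D that by (auto simp: d_def)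
    show "0 \<le> ln (D / d)" "0 \<le> ln (R / D)" "ln (R / d) = ln (D / d) + ln (R / D)"
      "0 \<le> d / R" "d / R \<le> D / R" "0 \<le> D / R"
      using d0 D by (auto simp: ln_div divide_right_mono)
    have "ln (d / R) \<le> d / R - 1" using d0 D by (intro ln_le_minus_one) auto
    then show "0 \<le> ln (R / d) + d / R - 1" using d0 D by (simp add: ln_div)
  qed
  have T: "tri_kernel R x y + 1 = ennreal (ln (R / d) + d / R)" if "x \<noteq> y"
  proof -
    have "tri_kernel R x y = ennreal (ln (R / d) + d / R - 1)"
      unfolding d_def using that D by (intro tri_kernel_eq) auto
    then show ?thesis using *(6)[OF that] by (simp flip: ennreal_plus ennreal_1)
  qed
  show "pot_kernel D x y + ennreal (ln (R / D)) \<le> tri_kernel R x y + 1" if "x \<noteq> y"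
    unfolding T[OF that] pot_kernel_def d_def[symmetric] using that *[OF that]
    by (simp flip: ennreal_plus add: ennreal_leI)
  show "tri_kernel R x y + 1 \<le> pot_kernel D x y + (ennreal (ln (R / D)) + ennreal (D / R))"
  proof (cases "x = y")
    case False
    show ?thesis unfolding T[OF False] pot_kernel_def d_def[symmetric] using False *[OF False]
      by (simp flip: ennreal_plus add: ennreal_leI)
  qed (simp add: pot_kernel_def)
qed

text \<open>The constants \<open>ln (R / D)\<close> from the comparison enter both sides with the
  same total weight, because both measures have mass one, and cancel. What remains is an error
  proportional to \<open>D / R\<close>, made small by a large \<open>R\<close>.\<close>

lemma pot_kernel_pd:
  assumes P: "prob_space \<mu>" "prob_space \<nu>" and S: "sets \<mu> = sets borel" "sets \<nu> = sets borel"
    and B: "AE x in \<mu>. \<bar>x\<bar> \<le> B" "AE x in \<nu>. \<bar>x\<bar> \<le> B" and B0: "B > 0"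
    and diag: "\<And>x. AE y in \<nu>. y \<noteq> x"
  shows "2 * energy (pot_kernel (2 * B)) \<mu> \<nu>
     \<le> energy (pot_kernel (2 * B)) \<mu> \<mu> + energy (pot_kernel (2 * B)) \<nu> \<nu>"
proof (rule ennreal_le_epsilon)
  fix e :: real assume e: "e > 0"
  define D where "D = 2 * B"
  \<comment> \<open>Chosen so that the error \<open>D / R\<close>, which enters once for each of the
    two self-energies, totals at most \<open>e\<close>.\<close>
  define R where "R = max D (2 * D / e)"
  have D0: "D > 0" using B0 by (simp add: D_def)
  have R: "D \<le> R" "2 * D / e \<le> R" "R > 0" using D0 by (auto simp: R_def)
  have DR: "2 * (D / R) \<le> e" "0 \<le> D / R" using R e D0 by (simp_all add: field_simps)
  define c where "c = ennreal (ln (R / D))"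
  have [simp]: "c \<noteq> \<infinity>" "c \<noteq> \<top>" by (simp_all add: c_def)
  note [measurable] = measurable_tri_kernel
  have add_const: "(\<integral>\<^sup>+x. (\<integral>\<^sup>+y. f x y + k \<partial>M') \<partial>M) = energy f M M' + k"
    if M: "prob_space M" "prob_space M'" "sets M = sets borel" "sets M' = sets borel"
      and f: "(\<lambda>(x, y). f x y) \<in> borel_measurable (borel \<Otimes>\<^sub>M borel)" for f :: "real \<Rightarrow> real \<Rightarrow> ennreal" and k M M'
  proof -
    interpret A: prob_space M by fact
    interpret B: prob_space M' by fact
    note [measurable_cong] = M(3,4)
    note [measurable] = f
    have "(\<integral>\<^sup>+y. f x y + k \<partial>M') = (\<integral>\<^sup>+y. f x y \<partial>M') + k" for x
      by (subst nn_integral_add) (auto simp: B.emeasure_space_1)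
    then have "(\<integral>\<^sup>+x. (\<integral>\<^sup>+y. f x y + k \<partial>M') \<partial>M) = (\<integral>\<^sup>+x. (\<integral>\<^sup>+y. f x y \<partial>M') + k \<partial>M)" by simp
    also have "\<dots> = energy f M M' + k"
      by (subst nn_integral_add) (auto simp: A.emeasure_space_1)
    finally show ?thesis .
  qed
  have mono: "energy f M M' \<le> energy g M M'"
    if "AE x in M. \<bar>x\<bar> \<le> B" "AE y in M'. \<bar>y\<bar> \<le> B" "\<And>x. AE y in M'. \<bar>x - y\<bar> \<le> D \<longrightarrow> f x y \<le> g x y" for f g :: "real \<Rightarrow> real \<Rightarrow> ennreal" and M M'
  proof (rule nn_integral_mono_AE)
    show "AE x in M. (\<integral>\<^sup>+y. f x y \<partial>M') \<le> (\<integral>\<^sup>+y. g x y \<partial>M')"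
      using that(1)
    proof eventually_elim
      case (elim x)
      show ?case
      proof (rule nn_integral_mono_AE)
        show "AE y in M'. f x y \<le> g x y"
          using that(2) that(3)[of x]
        proof eventually_elim
          case (elim y)
          then show ?case using \<open>\<bar>x\<bar> \<le> B\<close> by (auto simp: D_def)
        qed
      qed
    qed
  qed
  have cross: "energy (pot_kernel D) \<mu> \<nu> + c \<le> energy (tri_kernel R) \<mu> \<nu> + 1"
  proof -
    have "(\<integral>\<^sup>+x. (\<integral>\<^sup>+y. pot_kernel D x y + c \<partial>\<nu>) \<partial>\<mu>) \<le> (\<integral>\<^sup>+x. (\<integral>\<^sup>+y. tri_kernel R x y + 1 \<partial>\<nu>) \<partial>\<mu>)"
    proof (rule mono[OF B])
      fix x
      show "AE y in \<nu>. \<bar>x - y\<bar> \<le> D \<longrightarrow> pot_kernel D x y + c \<le> tri_kernel R x y + 1"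
        using diag[of x] unfolding c_def
        by eventually_elim (use pot_kernel_compare(1) R D0 in blast)
    qed
    then show ?thesis by (simp add: add_const P S measurable_tri_kernel measurable_pot_kernel)
  qed
  have self: "energy (tri_kernel R) M M + 1 \<le> energy (pot_kernel D) M M + (c + ennreal (D / R))"
    if M: "prob_space M" "sets M = sets borel" "AE x in M. \<bar>x\<bar> \<le> B" for M
  proof -
    have "(\<integral>\<^sup>+x. (\<integral>\<^sup>+y. tri_kernel R x y + 1 \<partial>M) \<partial>M) \<le> (\<integral>\<^sup>+x. (\<integral>\<^sup>+y. pot_kernel D x y + (c + ennreal (D / R)) \<partial>M) \<partial>M)"
      by (rule mono[OF M(3,3)]) (use pot_kernel_compare(2) R D0 in \<open>auto simp: c_def\<close>)
    then show ?thesis by (simp add: add_const M measurable_tri_kernel measurable_pot_kernel)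
  qed
  let ?X = "energy (pot_kernel D) \<mu> \<nu>"
  let ?U = "energy (pot_kernel D) \<mu> \<mu>" and ?V = "energy (pot_kernel D) \<nu> \<nu>"
  have "2 * ?X + 2 * c \<le> 2 * (energy (tri_kernel R) \<mu> \<nu> + 1)"
    using mult_left_mono[OF cross, of 2] by (simp add: distrib_left)
  also have "\<dots> \<le> (energy (tri_kernel R) \<mu> \<mu> + 1) + (energy (tri_kernel R) \<nu> \<nu> + 1)"
  proof -
    have two: "(u + 1) + (v + 1) = (u + v) + 2" for u v :: ennreal
    proof -
      have "(u + 1) + (v + 1) = (u + v) + (1 + 1)" by (simp only: ac_simps)
      then show ?thesis by simp
    qed
    show ?thesis
      unfolding two using add_right_mono[OF tri_kernel_pd[OF P S, of R], of 2] by (simp add: distrib_left)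
  qed
  also have "\<dots> \<le> (?U + (c + ennreal (D / R))) + (?V + (c + ennreal (D / R)))"
    by (intro add_mono self P S B)
  also have "\<dots> = (?U + ?V + ennreal (2 * (D / R))) + 2 * c"
  proof -
    have "ennreal (2 * (D / R)) = ennreal (D / R) + ennreal (D / R)"
      using DR(2) unfolding mult_2 by (rule ennreal_plus[OF _ DR(2)])
    then show ?thesis by (simp only: mult_2 mult_2_right ac_simps)
  qed
  finally have "2 * ?X \<le> ?U + ?V + ennreal (2 * (D / R))"
    by (simp add: ennreal_mult_eq_top_iff add.commute[of _ "2 * c"] ennreal_add_left_cancel_le)
  also have "\<dots> \<le> ?U + ?V + ennreal e" using DR by (intro add_left_mono ennreal_leI)
  finally show "2 * energy (pot_kernel (2 * B)) \<mu> \<nu>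
     \<le> energy (pot_kernel (2 * B)) \<mu> \<mu> + energy (pot_kernel (2 * B)) \<nu> \<nu> + ennreal e"
    unfolding D_def .
qed

text \<open>Pointwise, \<open>pot_kernel\<close> plus the negative part of the logarithmic kernel
  equals its positive part plus \<open>ln D\<close>. The negative part is at most
  \<open>ln D\<close> on the support, so its energy is finite and may be subtracted even when the
  positive part is infinite.\<close>

lemma log_energy_eq:
  assumes P: "prob_space \<mu>" and S: "sets \<mu> = sets borel"
    and B: "AE x in \<mu>. \<bar>x\<bar> \<le> B" and B1: "B \<ge> 1"
  shows "log_energy \<mu> = enn2ereal (energy (pot_kernel (2 * B)) \<mu> \<mu>) - ereal (ln (2 * B))"
proof -
  interpret prob_space \<mu> by fact
  note [measurable_cong] = S
  define D where "D = 2 * B"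
  have D1: "D \<ge> 1" "ln D \<ge> 0" using B1 by (auto simp: D_def)
  define p q where "p x y = (if x = y then \<infinity> else ennreal (- ln \<bar>x - y\<bar>))"
    and "q x y = (if x = y then 0 else ennreal (ln \<bar>x - y\<bar>))" for x y :: real
  have pq: "e2ennreal (log_kernel x y) = p x y" "e2ennreal (- log_kernel x y) = q x y" for x y
    by (auto simp: log_kernel_def p_def q_def e2ennreal_neg ennreal.abs_eq[symmetric] simp flip: e2ennreal_ereal)
  have [measurable]: "(\<lambda>(x, y). p x y) \<in> borel_measurable (borel \<Otimes>\<^sub>M borel)"
    "(\<lambda>(x, y). q x y) \<in> borel_measurable (borel \<Otimes>\<^sub>M borel)"
    unfolding p_def q_def by measurable
  have pt: "pot_kernel D x y + q x y = p x y + ennreal (ln D) \<and> q x y \<le> ennreal (ln D)" if "\<bar>x\<bar> \<le> B" "\<bar>y\<bar> \<le> B" for x y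
  proof (cases "x = y")
    case False
    define d where "d = \<bar>x - y\<bar>"
    have d: "0 < d" "d \<le> D" using that False by (auto simp: d_def D_def)
    then have l: "ln d \<le> ln D" by simp
    have "ennreal (ln (D / d)) + ennreal (ln d) = ennreal (- ln d) + ennreal (ln D)"
    proof (cases "ln d \<ge> 0")
      case True
      then show ?thesis using d l D1 by (simp add: ln_div ennreal_neg flip: ennreal_plus)
    next
      case False
      then show ?thesis using d l D1 by (simp add: ln_div ennreal_neg flip: ennreal_plus)
    qed
    then show ?thesis using False l by (simp add: pot_kernel_def p_def q_def d_def ennreal_leI)
  qed (simp add: pot_kernel_def p_def q_def)
  have AE2: "AE x in \<mu>. AE y in \<mu>. pot_kernel D x y + q x y = p x y + ennreal (ln D) \<and> q x y \<le> ennreal (ln D)"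
    using B
  proof eventually_elim
    case (elim x)
    show ?case using B by eventually_elim (use elim pt in blast)
  qed
  let ?I = "energy (pot_kernel D) \<mu> \<mu>" and ?P = "energy p \<mu> \<mu>" and ?Q = "energy q \<mu> \<mu>"
  have "?I + ?Q = (\<integral>\<^sup>+x. (\<integral>\<^sup>+y. pot_kernel D x y + q x y \<partial>\<mu>) \<partial>\<mu>)"
    by (simp add: nn_integral_add)
  also have "\<dots> = (\<integral>\<^sup>+x. (\<integral>\<^sup>+y. p x y + ennreal (ln D) \<partial>\<mu>) \<partial>\<mu>)"
    by (rule nn_integral_cong_AE) (use AE2 in \<open>auto elim!: eventually_mono intro!: nn_integral_cong_AE\<close>)
  also have "\<dots> = ?P + ennreal (ln D)"
    by (simp add: nn_integral_add emeasure_space_1)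
  finally have eq: "?I + ?Q = ?P + ennreal (ln D)" .
  have "?Q \<le> (\<integral>\<^sup>+x. (\<integral>\<^sup>+y. ennreal (ln D) \<partial>\<mu>) \<partial>\<mu>)"
  proof (rule nn_integral_mono_AE)
    show "AE x in \<mu>. (\<integral>\<^sup>+y. q x y \<partial>\<mu>) \<le> (\<integral>\<^sup>+y. ennreal (ln D) \<partial>\<mu>)"
      using AE2
    proof eventually_elim
      case (elim x)
      show ?case by (rule nn_integral_mono_AE) (use elim in eventually_elim, simp)
    qed
  qed
  also have "\<dots> = ennreal (ln D)" by (simp add: emeasure_space_1)
  finally have Qfin: "?Q \<le> ennreal (ln D)" .
  then obtain qr where qr: "?Q = ennreal qr" "0 \<le> qr" by (cases ?Q) (auto simp: top_unique)
  have "enn2ereal ?P - enn2ereal ?Q = enn2ereal ?I - ereal (ln D)"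
  proof (cases ?I)
    case top
    then have "?P + ennreal (ln D) = \<top>" using eq by simp
    then have "?P = \<top>" by simp
    then show ?thesis using top qr by simp
  next
    case (real i)
    then obtain pr where pr: "?P = ennreal pr" "0 \<le> pr" using eq qr by (cases ?P) (auto simp: ennreal_plus[symmetric] simp del: ennreal_plus)
    have "ennreal (i + qr) = ennreal (pr + ln D)" using eq real qr pr D1 by simp
    then have "i + qr = pr + ln D" using real qr pr D1 by (subst (asm) ennreal_inj) auto
    then show ?thesis using real qr pr by (simp add: enn2ereal_ennreal)
  qed
  then show ?thesis unfolding log_energy_def pq D_def .
qed

lemma compact_prob_on_bounded:
  assumes "\<mu> \<in> compact_prob_on S"
  shows "prob_space \<mu>" "sets \<mu> = sets borel" "\<exists>C B. compact C \<and> C \<subseteq> S \<and> (AE x in \<mu>. x \<in> C) \<and> B \<ge> B0 \<and> (AE x in \<mu>. \<bar>x\<bar> \<le> B)"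
proof -
  show P: "prob_space \<mu>" "sets \<mu> = sets borel" using assms by (auto simp: compact_prob_on_def)
  obtain C where C: "compact C" "C \<subseteq> S" "emeasure \<mu> (- C) = 0" using assms by (auto simp: compact_prob_on_def)
  have "- C \<in> sets \<mu>" using C(1) by (simp add: P(2) borel_closed compact_imp_closed)
  then have "- C \<in> null_sets \<mu>" using C(3) by auto
  then have AE: "AE x in \<mu>. x \<in> C" using AE_not_in by fastforce
  obtain B where B: "\<And>x. x \<in> C \<Longrightarrow> \<bar>x\<bar> \<le> B" using compact_imp_bounded[OF C(1)] by (auto simp: bounded_iff)
  have "AE x in \<mu>. \<bar>x\<bar> \<le> max B B0" using AE by eventually_elim (use B in \<open>auto simp: le_max_iff_disj\<close>)
  then show "\<exists>C B. compact C \<and> C \<subseteq> S \<and> (AE x in \<mu>. x \<in> C) \<and> B \<ge> B0 \<and> (AE x in \<mu>. \<bar>x\<bar> \<le> B)"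
    using C AE by (intro exI[of _ C] exI[of _ "max B B0"]) auto
qed

lemma log_energy_not_minf:
  assumes "\<mu> \<in> compact_prob_on S" shows "log_energy \<mu> \<noteq> - \<infinity>"
proof -
  note P = compact_prob_on_bounded[OF assms]
  obtain B where B: "B \<ge> 1" "AE x in \<mu>. \<bar>x\<bar> \<le> B" using P(3)[of 1] by blast
  show ?thesis unfolding log_energy_eq[OF P(1,2) B(2,1)]
    by (cases "energy (pot_kernel (2 * B)) \<mu> \<mu>") (auto simp: enn2ereal_ennreal)
qed

lemma log_capacity_ge:
  assumes \<mu>: "\<mu> \<in> compact_prob_on S" and "log_energy \<mu> \<le> ereal r"
  shows "ennreal (exp (- r)) \<le> log_capacity S"
proof -
  obtain e where e: "log_energy \<mu> = ereal e" "e \<le> r"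
    using log_energy_not_minf[OF \<mu>] assms(2) by (cases "log_energy \<mu>") auto
  have "ennreal (exp (- r)) \<le> ennreal (exp (- e))" using e by (intro ennreal_leI) simp
  also have "\<dots> = (if log_energy \<mu> = \<infinity> then 0 else ennreal (exp (- real_of_ereal (log_energy \<mu>))))"
    using e by simp
  also have "\<dots> \<le> log_capacity S" unfolding log_capacity_def by (rule SUP_upper[OF \<mu>])
  finally show ?thesis .
qed

lemma log_capacity_le:
  assumes "\<And>\<mu>. \<mu> \<in> compact_prob_on S \<Longrightarrow> ereal r \<le> log_energy \<mu>"
  shows "log_capacity S \<le> ennreal (exp (- r))"
  unfolding log_capacity_def
proof (rule SUP_least)
  fix \<mu> assume "\<mu> \<in> compact_prob_on S"
  from assms[OF this] show "(if log_energy \<mu> = \<infinity> then 0 else ennreal (exp (- real_of_ereal (log_energy \<mu>)))) \<le> ennreal (exp (- r))"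
    by (cases "log_energy \<mu>") (auto intro!: ennreal_leI)
qed

section \<open>Support and capacity\<close>

lemma closed_topological_support: "closed (topological_support \<mu>)"
  unfolding topological_support_def by (intro closed_Inter) auto

text \<open>The complement is a union of possibly uncountably many open null sets; by the Lindelof
  property countably many of them cover it.\<close>

lemma emeasure_compl_topological_support:
  assumes S: "sets \<mu> = sets borel"
  shows "emeasure \<mu> (- topological_support \<mu>) = 0"
proof -
  define F where "F = {U. open U \<and> emeasure \<mu> U = 0}"
  have eq: "- topological_support \<mu> = \<Union>F"
  proof (intro equalityI subsetI)
    fix x assume "x \<in> - topological_support \<mu>"
    then obtain C where "closed C" "emeasure \<mu> (- C) = 0" "x \<notin> C" by (auto simp: topological_support_def)
    then show "x \<in> \<Union>F" unfolding F_def by (intro UnionI[of "- C"]) auto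
  next
    fix x assume "x \<in> \<Union>F"
    then obtain U where "open U" "emeasure \<mu> U = 0" "x \<in> U" by (auto simp: F_def)
    then have "x \<notin> - U" "closed (- U)" "emeasure \<mu> (- (- U)) = 0" by auto
    then show "x \<in> - topological_support \<mu>" unfolding topological_support_def by blast
  qed
  obtain F' where F': "F' \<subseteq> F" "countable F'" "\<Union>F' = \<Union>F"
    using Lindelof[of F] by (auto simp: F_def)
  have "(\<Union>U\<in>F'. U) \<in> null_sets \<mu>"
    using F' by (intro null_sets_UN' ) (auto simp: F_def null_sets_def S)
  then show ?thesis unfolding eq F'(3)[symmetric] by auto
qed

lemma topological_support_open:
  assumes "x \<in> topological_support \<mu>" "open U" "x \<in> U"
  shows "emeasure \<mu> U > 0"
proof (rule ccontr)
  assume "\<not> emeasure \<mu> U > 0"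
  then have "emeasure \<mu> (- (- U)) = 0" "closed (- U)" using assms(2) by (auto simp: not_less)
  then show False using assms unfolding topological_support_def by blast
qed

lemma not_in_topological_support:
  assumes "x \<notin> topological_support \<mu>" "sets \<mu> = sets borel"
  shows "\<exists>h>0. emeasure \<mu> {x - h<..<x + h} = 0"
proof -
  obtain C where C: "closed C" "emeasure \<mu> (- C) = 0" "x \<notin> C" using assms by (auto simp: topological_support_def)
  then obtain h where h: "h > 0" "ball x h \<subseteq> - C" using open_contains_ball[of "- C"] by auto
  have "emeasure \<mu> {x - h<..<x + h} \<le> emeasure \<mu> (- C)"
    using h C(1) assms(2) by (intro emeasure_mono) (auto simp: ball_eq_greaterThanLessThan)
  then show ?thesis using h C(2) by auto
qed

lemma ln_strict_concave:
  fixes x y z :: real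
  assumes "0 < x" "x < y" "y < z"
  shows "(z - y) * ln x + (y - x) * ln z < (z - x) * ln y"
proof -
  have "ln (x / y) < x / y - 1" "ln (z / y) < z / y - 1"
    using assms ln_le_minus_one[of "x / y"] ln_le_minus_one[of "z / y"] ln_eq_minus_one[of "x / y"] ln_eq_minus_one[of "z / y"]
    by (force simp: order_less_le)+
  then have *: "ln x < ln y + (x / y - 1)" "ln z < ln y + (z / y - 1)" using assms by (simp_all add: ln_div)
  have "(z - y) * ln x + (y - x) * ln z < (z - y) * (ln y + (x / y - 1)) + (y - x) * (ln y + (z / y - 1))"
    using assms * by (intro add_strict_mono mult_strict_left_mono) auto
  also have "\<dots> = (z - x) * ln y" using assms by (simp add: field_simps)
  finally show ?thesis .
qed

context jacobi_limit begin

lemma A_le_potential: "ln A \<le> potential t"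
  using gamma_nonneg[of t] gamma_eq[of t] by simp

lemma gamma_zero_iff: "gamma_bdry w t = 0 \<longleftrightarrow> potential t = ln A"
  unfolding gamma_eq by simp

lemma gamma_measurable [measurable]: "(\<lambda>t. gamma_bdry w t) \<in> borel_measurable borel"
  unfolding gamma_eq by measurable

abbreviation "supp \<equiv> topological_support \<kappa>"

lemma supp_subset: "supp \<subseteq> {- specR..specR}"
proof -
  have "AE s in \<kappa>. s \<in> {- specR..specR}" using AE_bounded by eventually_elim auto
  moreover have "(AE s in \<kappa>. s \<in> {- specR..specR}) \<longleftrightarrow> emeasure \<kappa> (- {- specR..specR}) = 0"
    by (rule AE_iff_measurable) (auto simp: sets_\<kappa>)
  ultimately have "emeasure \<kappa> (- {- specR..specR}) = 0" by blast
  then show ?thesis unfolding topological_support_def by (intro Inter_lower) auto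
qed

lemma compact_supp: "compact supp"
  using supp_subset by (meson closed_topological_support bounded_closed_interval bounded_subset compact_eq_bounded_closed)

lemma energy_le:
  assumes B: "B \<ge> specR + 1"
  shows "energy (pot_kernel (2 * B)) \<kappa> \<kappa> \<le> ennreal (ln (2 * B) - ln A)"
proof -
  have "energy (pot_kernel (2 * B)) \<kappa> \<kappa> \<le> (\<integral>\<^sup>+x. ennreal (ln (2 * B) - ln A) \<partial>\<kappa>)"
  proof (rule nn_integral_mono_AE)
    show "AE x in \<kappa>. (\<integral>\<^sup>+y. pot_kernel (2 * B) x y \<partial>\<kappa>) \<le> ennreal (ln (2 * B) - ln A)"
      using AE_bounded by eventually_elim (rule potential_le, use B in auto)
  qed
  then show ?thesis using kap.emeasure_space_1 by simp
qed

text \<open>\<open>ennreal\<close> sends negative reals to 0, so the energy bounds can be converted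
  back to reals only with this sign.\<close>

lemma const_nonneg: "B \<ge> specR + 1 \<Longrightarrow> 0 \<le> ln (2 * B) - ln A"
  using potential_eq[of 0 "2 * B"] A_le_potential[of 0] specR_pos by simp

lemma capacity_supp_ge: "ennreal A \<le> log_capacity supp"
proof -
  have k: "\<kappa> \<in> compact_prob_on supp"
    unfolding compact_prob_on_def using prob_\<kappa> sets_\<kappa> compact_supp emeasure_compl_topological_support[OF sets_\<kappa>] by auto
  define B where "B = specR + 1"
  have B: "B \<ge> specR + 1" "B \<ge> 1" using specR_pos by (auto simp: B_def)
  have "log_energy \<kappa> = enn2ereal (energy (pot_kernel (2 * B)) \<kappa> \<kappa>) - ereal (ln (2 * B))"
    by (rule log_energy_eq[OF prob_\<kappa> sets_\<kappa> _ B(2)]) (use AE_bounded in eventually_elim, use B in auto)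
  also have "\<dots> \<le> enn2ereal (ennreal (ln (2 * B) - ln A)) - ereal (ln (2 * B))"
    using energy_le[OF B(1)] by (intro ereal_minus_mono) (auto simp: less_eq_ennreal.rep_eq)
  also have "\<dots> = ereal (- ln A)" using const_nonneg[OF B(1)] by (simp add: enn2ereal_ennreal)
  finally have "log_energy \<kappa> \<le> ereal (- ln A)" .
  from log_capacity_ge[OF k this] show ?thesis using A_pos by simp
qed

text \<open>On the zero set the potential of \<kappa> is the constant \<open>ln A\<close>, so every
  competing \<mu> has mutual energy exactly \<open>L\<close> with \<kappa>. Positive definiteness
  gives \<open>2 * L \<le> I + L\<close> for the energy \<open>I\<close> of \<mu>; cancelling the
  finite \<open>L\<close> is legitimate even if \<open>I\<close> is infinite.\<close>

lemma capacity_zero_set_le: "log_capacity {t. gamma_bdry w t = 0} \<le> ennreal A"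
proof -
  have "log_capacity {t. gamma_bdry w t = 0} \<le> ennreal (exp (- (- ln A)))"
  proof (rule log_capacity_le)
    fix \<mu> assume \<mu>: "\<mu> \<in> compact_prob_on {t. gamma_bdry w t = 0}"
    note P = compact_prob_on_bounded[OF \<mu>]
    obtain C B where C: "C \<subseteq> {t. gamma_bdry w t = 0}" "AE x in \<mu>. x \<in> C"
      and B: "specR + 1 \<le> B" "AE x in \<mu>. \<bar>x\<bar> \<le> B" using P(3)[of "specR + 1"] by blast
    interpret m: prob_space \<mu> by (rule P)
    have B1: "B \<ge> 1" "B > 0" using B specR_pos by auto
    define L where "L = ln (2 * B) - ln A"
    have L0: "L \<ge> 0" unfolding L_def by (rule const_nonneg[OF B(1)])
    have BK: "AE x in \<kappa>. \<bar>x\<bar> \<le> B" using AE_bounded by eventually_elim (use B in auto)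
    have "AE x in \<mu>. (\<integral>\<^sup>+y. pot_kernel (2 * B) x y \<partial>\<kappa>) = ennreal L"
      using C(2) B(2)
    proof eventually_elim
      case (elim x)
      have "potential x = ln A" using elim C(1) gamma_zero_iff by blast
      then show ?case using potential_eq[of x "2 * B"] elim B by (simp add: L_def)
    qed
    then have cross: "energy (pot_kernel (2 * B)) \<mu> \<kappa> = ennreal L"
      using m.emeasure_space_1 by (subst nn_integral_cong_AE[where v="\<lambda>x. ennreal L"]) auto
    let ?I = "energy (pot_kernel (2 * B)) \<mu> \<mu>"
    have "2 * ennreal L \<le> ?I + energy (pot_kernel (2 * B)) \<kappa> \<kappa>"
      unfolding cross[symmetric] by (rule pot_kernel_pd[OF P(1) prob_\<kappa> P(2) sets_\<kappa> B(2) BK B1(2) AE_neq])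
    also have "\<dots> \<le> ?I + ennreal L"
      unfolding L_def by (intro add_left_mono energy_le B)
    finally have "ennreal L + ennreal L \<le> ennreal L + ?I" by (simp only: mult_2[of "ennreal L"] add.commute[of ?I])
    then have "ennreal L \<le> ?I" unfolding ennreal_add_left_cancel_le by simp
    then have "enn2ereal (ennreal L) - ereal (ln (2 * B)) \<le> enn2ereal ?I - ereal (ln (2 * B))"
      by (intro ereal_minus_mono) (auto simp: less_eq_ennreal.rep_eq)
    also have "\<dots> = log_energy \<mu>" by (rule log_energy_eq[OF P(1,2) B(2) B1(1), symmetric])
    finally show "ereal (- ln A) \<le> log_energy \<mu>" using L0 by (simp add: enn2ereal_ennreal L_def)
  qed
  then show ?thesis using A_pos by simp
qed

text \<open>Condition \<kappa> on a compact piece \<open>C\<close> of its support near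
  \<open>x\<close>. As the kernel is nonnegative, the potentials of the conditioned measure are at
  most those of \<kappa> divided by the mass of \<open>C\<close>, so its energy is finite.\<close>

lemma capacity_pos_near_supp:
  assumes x: "x \<in> supp" and S: "supp \<subseteq> S" and h: "h > 0"
  shows "log_capacity (S \<inter> {x - h<..<x + h}) > 0"
proof -
  \<comment> \<open>Half the radius makes \<open>C\<close> compact inside the open interval, while
    \<open>x\<close> still has an open neighbourhood whose support points lie in
    \<open>C\<close>.\<close>
  define C where "C = supp \<inter> {x - h/2..x + h/2}"
  have C: "compact C" "C \<subseteq> S \<inter> {x - h<..<x + h}" using S h by (auto simp: C_def intro!: compact_Int compact_supp)
  have Cs [measurable]: "C \<in> sets \<kappa>" using C(1) by (simp add: sets_\<kappa> borel_closed compact_imp_closed)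
  have borel: "C \<in> sets borel" "- supp \<in> sets borel"
    using Cs borel_comp[OF borel_closed[OF closed_topological_support]] by (simp_all add: sets_\<kappa>)
  have "0 < emeasure \<kappa> {x - h/2<..<x + h/2}"
    by (rule topological_support_open[OF x]) (use h in auto)
  also have "\<dots> \<le> emeasure \<kappa> (C \<union> - supp)"
    by (rule emeasure_mono) (use borel in \<open>auto simp: sets_\<kappa>\<close>, auto simp: C_def)
  also have "\<dots> \<le> emeasure \<kappa> C + emeasure \<kappa> (- supp)"
    by (rule emeasure_subadditive) (use borel in \<open>auto simp: sets_\<kappa>\<close>)
  finally have pos: "0 < emeasure \<kappa> C" using emeasure_compl_topological_support[OF sets_\<kappa>] by simp
  obtain c where c: "emeasure \<kappa> C = ennreal c" "c > 0"
    using pos kap.emeasure_finite[of C] by (cases "emeasure \<kappa> C") auto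
  define \<mu> where "\<mu> = uniform_measure \<kappa> C"
  have P: "prob_space \<mu>" unfolding \<mu>_def using pos by (intro prob_space_uniform_measure) auto
  have Sm: "sets \<mu> = sets borel" by (simp add: \<mu>_def sets_\<kappa>)
  have "emeasure \<mu> (- C) = 0"
    unfolding \<mu>_def using Cs by (subst emeasure_uniform_measure) (auto simp: sets_\<kappa>)
  then have \<mu>: "\<mu> \<in> compact_prob_on (S \<inter> {x - h<..<x + h})"
    unfolding compact_prob_on_def using P Sm C by auto
  define B where "B = specR + 1"
  have B: "B \<ge> specR + 1" "B \<ge> 1" using specR_pos by (auto simp: B_def)
  have Cb: "\<bar>y\<bar> \<le> specR" if "y \<in> C" for y using subsetD[OF supp_subset, of y] that by (auto simp: C_def)
  have AEC: "AE y in \<mu>. y \<in> C"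
    unfolding \<mu>_def using pos by (intro AE_uniform_measureI) auto
  interpret m: prob_space \<mu> by (rule P)
  let ?L = "ln (2 * B) - ln A"
  have "energy (pot_kernel (2 * B)) \<mu> \<mu> \<le> (\<integral>\<^sup>+x. ennreal (?L / c) \<partial>\<mu>)"
  proof (rule nn_integral_mono_AE)
    show "AE x in \<mu>. (\<integral>\<^sup>+y. pot_kernel (2 * B) x y \<partial>\<mu>) \<le> ennreal (?L / c)"
      using AEC
    proof eventually_elim
      case (elim x)
      have "(\<integral>\<^sup>+y. pot_kernel (2 * B) x y \<partial>\<mu>) = (\<integral>\<^sup>+y. pot_kernel (2 * B) x y * indicator C y \<partial>\<kappa>) / emeasure \<kappa> C"
        unfolding \<mu>_def by (rule nn_integral_uniform_measure) auto
      also have "\<dots> \<le> (\<integral>\<^sup>+y. pot_kernel (2 * B) x y \<partial>\<kappa>) / emeasure \<kappa> C"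
        by (intro divide_right_mono_ennreal nn_integral_mono) (auto split: split_indicator)
      also have "\<dots> \<le> ennreal ?L / emeasure \<kappa> C"
        by (intro divide_right_mono_ennreal potential_le) (use Cb[OF elim] B in auto)
      also have "\<dots> = ennreal (?L / c)" using c const_nonneg[OF B(1)] by (simp add: divide_ennreal)
      finally show ?case .
    qed
  qed
  also have "\<dots> = ennreal (?L / c)" using m.emeasure_space_1 by simp
  finally have fin: "energy (pot_kernel (2 * B)) \<mu> \<mu> \<le> ennreal (?L / c)" .
  have "log_energy \<mu> = enn2ereal (energy (pot_kernel (2 * B)) \<mu> \<mu>) - ereal (ln (2 * B))"
    by (rule log_energy_eq[OF P Sm _ B(2)]) (use AEC in eventually_elim, use Cb B in fastforce)
  also have "\<dots> \<le> enn2ereal (ennreal (?L / c)) - ereal (ln (2 * B))"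
    using fin by (intro ereal_minus_mono) (auto simp: less_eq_ennreal.rep_eq)
  also have "\<dots> = ereal (?L / c - ln (2 * B))" using const_nonneg[OF B(1)] c by (simp add: enn2ereal_ennreal)
  finally have "ennreal (exp (- (?L / c - ln (2 * B)))) \<le> log_capacity (S \<inter> {x - h<..<x + h})"
    by (rule log_capacity_ge[OF \<mu>])
  then show ?thesis by (rule less_le_trans[rotated]) simp
qed

lemma zeros_in_gap:
  assumes gap: "emeasure \<kappa> {l<..<u} = 0" and t: "l < t1" "t1 < t2" "t2 < t3" "t3 < u"
    and z: "gamma_bdry w t1 = 0" "gamma_bdry w t2 = 0" "gamma_bdry w t3 = 0"
  shows False
proof -
  have "{l<..<u} \<in> null_sets \<kappa>" using gap by (auto simp: sets_\<kappa>)
  then have AEg: "AE s in \<kappa>. s \<notin> {l<..<u}" by (rule AE_not_in)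
  \<comment> \<open>This is \<open>t3 - t1\<close> times the height of
    \<open>ln \<bar>t2 - s\<bar>\<close> above the chord between \<open>t1\<close> and
    \<open>t3\<close>. It is positive for each \<open>s\<close> outside the gap, yet at three zeros
    its integral vanishes.\<close>
  define g where "g s = (t3 - t1) * ln \<bar>t2 - s\<bar> - ((t3 - t2) * ln \<bar>t1 - s\<bar> + (t2 - t1) * ln \<bar>t3 - s\<bar>)" for s
  have gpos: "AE s in \<kappa>. g s > 0"
    using AEg
  proof eventually_elim
    case (elim s)
    then consider "s \<le> l" | "s \<ge> u" by fastforce
    then show ?case
    proof cases
      case 1
      then show ?thesis using ln_strict_concave[of "t1 - s" "t2 - s" "t3 - s"] t by (simp add: g_def)
    next
      case 2
      then show ?thesis using ln_strict_concave[of "s - t3" "s - t2" "s - t1"] t by (simp add: g_def algebra_simps)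
    qed
  qed
  have gi: "integrable \<kappa> g" unfolding g_def using integrable_ln by auto
  have "(\<integral>s. g s \<partial>\<kappa>) = (t3 - t1) * potential t2 - ((t3 - t2) * potential t1 + (t2 - t1) * potential t3)"
    unfolding g_def using integrable_ln by simp
  also have "\<dots> = 0" using z unfolding gamma_zero_iff by (simp add: algebra_simps)
  finally have "(\<integral>s. g s \<partial>\<kappa>) = 0" .
  moreover have "AE s in \<kappa>. 0 \<le> g s" using gpos by eventually_elim simp
  ultimately have "AE s in \<kappa>. g s = 0"
    using integral_nonneg_eq_0_iff_AE[OF gi] by blast
  then have "AE s in \<kappa>. False" using gpos by eventually_elim simp
  then show False by simp
qed

lemma ess_closure_zero_subset: "ess_closure {t. gamma_bdry w t = 0} \<subseteq> supp"
proof
  fix x assume x: "x \<in> ess_closure {t. gamma_bdry w t = 0}"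
  show "x \<in> supp"
  proof (rule ccontr)
    assume "x \<notin> supp"
    then obtain h where h: "h > 0" "emeasure \<kappa> {x - h<..<x + h} = 0" using not_in_topological_support[OF _ sets_\<kappa>] by blast
    define F where "F = {t. gamma_bdry w t = 0} \<inter> {x - h<..<x + h}"
    have "finite F"
    proof (rule ccontr)
      assume "infinite F"
      then obtain T where T: "T \<subseteq> F" "finite T" "card T = 3" using infinite_arbitrarily_large by blast
      obtain t1 t2 t3 where "t1 \<in> T" "t2 \<in> T" "t3 \<in> T" "t1 < t2" "t2 < t3"
      proof -
        define l where "l = sorted_list_of_set T"
        have l: "sorted_wrt (<) l" "length l = 3" "set l = T"
          using T by (auto simp: l_def)
        have "l ! 0 < l ! 1" "l ! 1 < l ! 2" using sorted_wrt_nth_less[OF l(1)] l(2) by auto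
        moreover have "l ! 0 \<in> T" "l ! 1 \<in> T" "l ! 2 \<in> T" using l(2,3) by auto
        ultimately show thesis using that by blast
      qed
      then have "t1 \<in> F" "t2 \<in> F" "t3 \<in> F" using T(1) by auto
      then show False
        using zeros_in_gap[OF h(2), of t1 t2 t3] \<open>t1 < t2\<close> \<open>t2 < t3\<close> by (simp add: F_def)
    qed
    then have "emeasure lborel F = 0" by (rule emeasure_lborel_countable[OF countable_finite])
    then show False using x h(1) unfolding ess_closure_def F_def by auto
  qed
qed

end

section \<open>Eigenvalues in gaps of the spectrum\<close>

lemma ell2_norm_nonneg: "u \<in> ell2 \<Longrightarrow> 0 \<le> ell2_norm u"
  unfolding ell2_norm_def ell2_def by (auto intro!: suminf_nonneg)

lemma ell2_finite_support:
  assumes "\<And>k. k \<notin> {1..n} \<Longrightarrow> u k = 0"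
  shows "u \<in> ell2" "(ell2_norm u)\<^sup>2 = (\<Sum>k=1..n. (cmod (u k))\<^sup>2)"
proof -
  have s: "(\<lambda>k. (cmod (u k))\<^sup>2) sums (\<Sum>k=1..n. (cmod (u k))\<^sup>2)"
    by (rule sums_finite) (use assms in auto)
  show "u \<in> ell2" unfolding ell2_def using s assms[of 0] by (auto simp: sums_iff)
  have "(\<Sum>k. (cmod (u k))\<^sup>2) = (\<Sum>k=1..n. (cmod (u k))\<^sup>2)" using s by (simp add: sums_iff)
  then show "(ell2_norm u)\<^sup>2 = (\<Sum>k=1..n. (cmod (u k))\<^sup>2)"
    unfolding ell2_norm_def by (simp add: sum_nonneg)
qed

context jacobi_coeffs begin

lemma fr_consecutive_nonzero:
  assumes "s \<in> eigs n" shows "fr n s \<noteq> 0"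
proof
  assume z: "fr n s = 0"
  have n: "n \<ge> 1" using assms by (cases n) (auto simp: eigs_def)
  have "(\<Sum>k=1..n. (fm k (of_real s))\<^sup>2) = 0"
    using christoffel_darboux_diag[of n "of_real s"] assms z by (simp add: eigs_def fm_of_real)
  then have "(of_real (\<Sum>k=1..n. (fr k s)\<^sup>2) :: complex) = 0" by (simp add: fm_of_real)
  then have z: "(\<Sum>k=1..n. (fr k s)\<^sup>2) = 0" by (metis of_real_eq_0_iff)
  have "1 \<le> (\<Sum>k=1..n. (fr k s)\<^sup>2)"
    using n member_le_sum[of 1 "{1..n}" "\<lambda>k. (fr k s)\<^sup>2"] by simp
  with z show False by simp
qed

lemma eigenvectors_orthogonal:
  assumes "s1 \<in> eigs n" "s2 \<in> eigs n" "s1 \<noteq> s2"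
  shows "(\<Sum>k=1..n. fr k s1 * fr k s2) = 0"
proof -
  have "of_real (s1 - s2) * (of_real (\<Sum>k=1..n. fr k s1 * fr k s2) :: complex) = 0"
    using wronskian_sum[OF fm_eq fm_eq, of n "of_real s1" "of_real s2"] assms(1,2)
    by (simp add: fm_of_real eigs_def)
  then have "(s1 - s2) * (\<Sum>k=1..n. fr k s1 * fr k s2) = 0"
    unfolding of_real_mult[symmetric] of_real_eq_0_iff .
  then show ?thesis using assms(3) by simp
qed

text \<open>Two eigenvectors of a truncation combine to a vector vanishing at the last site, on which the
  truncation agrees with the full operator.\<close>

lemma eigs_gap:
  assumes C: "\<And>u. u \<in> ell2 \<Longrightarrow> ell2_norm u \<le> C * ell2_norm (shifted (jacobi_op a b) (of_real t) u)"
    and h: "C > 0" "C * h < 1" "h > 0"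
    and s: "s1 \<in> eigs n" "s2 \<in> eigs n" "\<bar>s1 - t\<bar> \<le> h" "\<bar>s2 - t\<bar> \<le> h"
  shows "s1 = s2"
proof (rule ccontr)
  assume ne: "s1 \<noteq> s2"
  have n: "n \<ge> 1" using s(1) by (cases n) (auto simp: eigs_def)
  \<comment> \<open>Two eigenvectors scaled by the last entry of the other one, so that they agree
    at site \<open>n\<close> and \<open>u\<close> vanishes there.\<close>
  define \<alpha> \<beta> where "\<alpha> k = fr k s1 * fr n s2" and "\<beta> k = fr k s2 * fr n s1" for k
  define u v where "u k = (if k \<in> {1..n} then of_real (\<alpha> k - \<beta> k) else 0 :: complex)"
    and "v k = (if k \<in> {1..n} then of_real ((s1 - t) * \<alpha> k - (s2 - t) * \<beta> k) else 0 :: complex)" for k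
  \<comment> \<open>The formula persists at 0 and at \<open>Suc n\<close>, where the polynomials
    vanish at both eigenvalues; thus the recurrence applies at every site from 1 to
    \<open>n\<close>.\<close>
  have u_alt: "u k = of_real (\<alpha> k - \<beta> k)" if "k \<le> Suc n" for k
  proof -
    have "k = 0 \<or> k \<in> {1..n} \<or> k = Suc n" using that by auto
    then show ?thesis using s(1,2) by (auto simp: u_def \<alpha>_def \<beta>_def eigs_def)
  qed
  have un: "u n = 0" using u_alt[of n] by (simp add: \<alpha>_def \<beta>_def)
  have u0: "u k = 0" "v k = 0" if "k \<notin> {1..n}" for k using that by (auto simp: u_def v_def)
  have shift: "shifted (jacobi_op a b) (of_real t) u = v"
  proof
    fix k
    have "k = 0 \<or> k = Suc n \<or> k > Suc n \<or> k \<in> {1..n}" by auto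
    then consider "k = 0" | "k = Suc n" | "k > Suc n" | "k \<in> {1..n}" by blast
    then show "shifted (jacobi_op a b) (of_real t) u k = v k"
    proof cases
      case 4
      then obtain m where m: "k = Suc m" "m < n" by (cases k) auto
      have e1: "a (Suc m) * fr (Suc (Suc m)) s1 + a m * fr m s1 + b (Suc m) * fr (Suc m) s1 = s1 * fr (Suc m) s1"
        and e2: "a (Suc m) * fr (Suc (Suc m)) s2 + a m * fr m s2 + b (Suc m) * fr (Suc m) s2 = s2 * fr (Suc m) s2"
        by (rule fr_rec)+
      have "shifted (jacobi_op a b) (of_real t) u k = of_real (a (Suc m)) * u (Suc (Suc m)) + of_real (a m) * u m
          + of_real (b (Suc m)) * u (Suc m) - of_real t * u (Suc m)"
        using m u0(1)[of 0] by (simp add: shifted_def jacobi_op_def)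
      also have "\<dots> = of_real (a (Suc m) * (\<alpha> (Suc (Suc m)) - \<beta> (Suc (Suc m))) + a m * (\<alpha> m - \<beta> m)
          + b (Suc m) * (\<alpha> (Suc m) - \<beta> (Suc m)) - t * (\<alpha> (Suc m) - \<beta> (Suc m)))"
        using m u_alt[of "Suc (Suc m)"] u_alt[of "Suc m"] u_alt[of m] by simp
      also have "a (Suc m) * (\<alpha> (Suc (Suc m)) - \<beta> (Suc (Suc m))) + a m * (\<alpha> m - \<beta> m)
          + b (Suc m) * (\<alpha> (Suc m) - \<beta> (Suc m)) - t * (\<alpha> (Suc m) - \<beta> (Suc m))
          = (a (Suc m) * fr (Suc (Suc m)) s1 + a m * fr m s1 + b (Suc m) * fr (Suc m) s1) * fr n s2
          - (a (Suc m) * fr (Suc (Suc m)) s2 + a m * fr m s2 + b (Suc m) * fr (Suc m) s2) * fr n s1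
          - t * (\<alpha> (Suc m) - \<beta> (Suc m))"
        by (simp add: \<alpha>_def \<beta>_def algebra_simps)
      also have "\<dots> = (s1 - t) * \<alpha> (Suc m) - (s2 - t) * \<beta> (Suc m)"
        unfolding e1 e2 by (simp add: \<alpha>_def \<beta>_def algebra_simps)
      finally show ?thesis using m by (simp add: v_def)
    next
      case 3
      have "u k = 0" "u (k - 1) = 0" "u (k + 1) = 0" "v k = 0" by (rule u0; use 3 in auto)+
      then show ?thesis by (simp add: shifted_def jacobi_op_def)
    qed (use un u0 n in \<open>auto simp: shifted_def jacobi_op_def\<close>)
  qed
  have orth: "(\<Sum>k=1..n. \<alpha> k * \<beta> k) = 0"
  proof -
    have "(\<Sum>k=1..n. \<alpha> k * \<beta> k) = (\<Sum>k=1..n. fr k s1 * fr k s2) * (fr n s2 * fr n s1)"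
      unfolding \<alpha>_def \<beta>_def sum_distrib_right by (intro sum.cong) (auto simp: algebra_simps)
    then show ?thesis using eigenvectors_orthogonal[OF s(1,2) ne] by simp
  qed
  have pyth: "(\<Sum>k=1..n. (c * \<alpha> k - d * \<beta> k)\<^sup>2) = c\<^sup>2 * (\<Sum>k=1..n. (\<alpha> k)\<^sup>2) + d\<^sup>2 * (\<Sum>k=1..n. (\<beta> k)\<^sup>2)" for c d
  proof -
    have "(\<Sum>k=1..n. (c * \<alpha> k - d * \<beta> k)\<^sup>2) = (\<Sum>k=1..n. c\<^sup>2 * (\<alpha> k)\<^sup>2 + d\<^sup>2 * (\<beta> k)\<^sup>2 - 2 * c * d * (\<alpha> k * \<beta> k))"
      by (intro sum.cong) (auto simp: power2_eq_square algebra_simps)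
    also have "\<dots> = c\<^sup>2 * (\<Sum>k=1..n. (\<alpha> k)\<^sup>2) + d\<^sup>2 * (\<Sum>k=1..n. (\<beta> k)\<^sup>2) - 2 * c * d * (\<Sum>k=1..n. \<alpha> k * \<beta> k)"
      by (simp add: sum.distrib sum_subtractf sum_distrib_left)
    finally show ?thesis unfolding orth by simp
  qed
  have U: "u \<in> ell2" "(ell2_norm u)\<^sup>2 = (\<Sum>k=1..n. (cmod (u k))\<^sup>2)"
    and V: "v \<in> ell2" "(ell2_norm v)\<^sup>2 = (\<Sum>k=1..n. (cmod (v k))\<^sup>2)"
    by (rule ell2_finite_support; use u0 in blast)+
  have nu: "(ell2_norm u)\<^sup>2 = (\<Sum>k=1..n. (\<alpha> k)\<^sup>2) + (\<Sum>k=1..n. (\<beta> k)\<^sup>2)"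
  proof -
    have "(\<Sum>k=1..n. (cmod (u k))\<^sup>2) = (\<Sum>k=1..n. (1 * \<alpha> k - 1 * \<beta> k)\<^sup>2)"
      by (intro sum.cong) (auto simp: u_def simp flip: of_real_diff)
    then show ?thesis unfolding U(2) pyth by simp
  qed
  have nv: "(ell2_norm v)\<^sup>2 = (s1 - t)\<^sup>2 * (\<Sum>k=1..n. (\<alpha> k)\<^sup>2) + (s2 - t)\<^sup>2 * (\<Sum>k=1..n. (\<beta> k)\<^sup>2)"
  proof -
    have "(\<Sum>k=1..n. (cmod (v k))\<^sup>2) = (\<Sum>k=1..n. ((s1 - t) * \<alpha> k - (s2 - t) * \<beta> k)\<^sup>2)"
      by (intro sum.cong) (auto simp: v_def simp flip: of_real_diff of_real_mult)
    then show ?thesis unfolding V(2) pyth by simp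
  qed
  note sq = power_mono[OF s(3) abs_ge_zero, of 2, unfolded power2_abs]
    power_mono[OF s(4) abs_ge_zero, of 2, unfolded power2_abs]
  have nonneg: "0 \<le> (\<Sum>k=1..n. (\<alpha> k)\<^sup>2)" "0 \<le> (\<Sum>k=1..n. (\<beta> k)\<^sup>2)"
    by (rule sum_nonneg, rule zero_le_power2)+
  \<comment> \<open>By orthogonality the shifted operator multiplies the two components by
    \<open>s1 - t\<close> and \<open>s2 - t\<close>, so it shrinks \<open>u\<close> at least by the
    factor \<open>h\<close>. The assumed lower bound and \<open>C * h < 1\<close> then leave only
    \<open>u = 0\<close>.\<close>
  have "(ell2_norm v)\<^sup>2 \<le> h\<^sup>2 * (ell2_norm u)\<^sup>2"
    using add_mono[OF mult_right_mono[OF sq(1) nonneg(1)] mult_right_mono[OF sq(2) nonneg(2)]]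
    by (simp only: nu nv distrib_left)
  then have le: "(ell2_norm v)\<^sup>2 \<le> (h * ell2_norm u)\<^sup>2" unfolding power_mult_distrib .
  have nn: "ell2_norm u \<ge> 0" "ell2_norm v \<ge> 0" by (intro ell2_norm_nonneg U V)+
  have "ell2_norm v \<le> h * ell2_norm u"
    by (rule power2_le_imp_le[OF le]) (intro mult_nonneg_nonneg nn less_imp_le[OF h(3)])
  moreover have "ell2_norm u \<le> C * ell2_norm v" using C[OF U(1)] shift by simp
  ultimately have "ell2_norm u \<le> (C * h) * ell2_norm u"
    using mult_left_mono[of "ell2_norm v" "h * ell2_norm u" C] less_imp_le[OF h(1)] unfolding mult.assoc by linarith
  then have "(1 - C * h) * ell2_norm u \<le> 0" unfolding left_diff_distrib by simp
  moreover have "0 < 1 - C * h" using h(2) by simp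
  ultimately have "ell2_norm u \<le> 0" by (metis mult_pos_pos not_le)
  then have "ell2_norm u = 0" using nn(1) by linarith
  then have "(\<Sum>k=1..n. (\<alpha> k)\<^sup>2) + (\<Sum>k=1..n. (\<beta> k)\<^sup>2) = 0" unfolding nu[symmetric] by simp
  \<comment> \<open>Since \<open>fr 1\<close> is constantly 1, \<open>\<alpha> 1 = fr n s2\<close>,
    which \<open>fr_consecutive_nonzero\<close> forbids to vanish.\<close>
  moreover have "(\<alpha> 1)\<^sup>2 \<le> (\<Sum>k=1..n. (\<alpha> k)\<^sup>2)"
    using n by (intro member_le_sum zero_le_power2) simp_all
  ultimately have "(\<alpha> 1)\<^sup>2 \<le> 0" using nonneg(2) by linarith
  then have "\<alpha> 1 = 0" by simp
  then show False using fr_consecutive_nonzero[OF s(2)] by (simp add: \<alpha>_def)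
qed

end

context jacobi_limit begin

text \<open>A tent function of height \<open>h\<close> around a point of the resolvent set meets at
  most one eigenvalue of each truncation, by \<open>eigs_gap\<close>. Its averages are at most
  \<open>h / N\<close>, so its integral against \<kappa> is 0.\<close>

lemma supp_subset_spectrum: "supp \<subseteq> real_spectrum (jacobi_op a b)"
proof
  fix t assume t: "t \<in> supp"
  show "t \<in> real_spectrum (jacobi_op a b)"
  proof (rule ccontr)
    assume "t \<notin> real_spectrum (jacobi_op a b)"
    then have "of_real t \<in> resolvent_set (jacobi_op a b)" unfolding real_spectrum_def by simp
    then have bij: "bij_betw (shifted (jacobi_op a b) (of_real t)) ell2 ell2"
      and "\<exists>C. \<forall>u\<in>ell2. ell2_norm u \<le> C * ell2_norm (shifted (jacobi_op a b) (of_real t) u)"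
      unfolding resolvent_set_def mem_Collect_eq by (rule conjunct1, rule conjunct2)
    then obtain C0 where "\<forall>u\<in>ell2. ell2_norm u \<le> C0 * ell2_norm (shifted (jacobi_op a b) (of_real t) u)"
      by (elim exE)
    then have C0: "ell2_norm u \<le> C0 * ell2_norm (shifted (jacobi_op a b) (of_real t) u)" if "u \<in> ell2" for u
      using that by (rule bspec)
    \<comment> \<open>The maximum with 1 makes the constant positive, so that
      \<open>h = 1 / (2 * C)\<close> satisfies \<open>C * h < 1\<close>.\<close>
    define C where "C = max C0 1"

    have C: "ell2_norm u \<le> C * ell2_norm (shifted (jacobi_op a b) (of_real t) u)" if "u \<in> ell2" for u
    proof -
      have "0 \<le> ell2_norm (shifted (jacobi_op a b) (of_real t) u)"
        by (rule ell2_norm_nonneg[OF bspec[OF bij_betwE[OF bij] that]])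
      then have "C0 * ell2_norm (shifted (jacobi_op a b) (of_real t) u) \<le> C * ell2_norm (shifted (jacobi_op a b) (of_real t) u)"
        by (intro mult_right_mono) (auto simp: C_def)
      with C0[OF that] show ?thesis by linarith
    qed
    define h where "h = 1 / (2 * C)"
    have h: "C > 0" "C * h < 1" "h > 0" by (auto simp: h_def C_def)
    define f where "f s = max 0 (h - \<bar>s - t\<bar>)" for s
    have cont: "continuous_on UNIV f" unfolding f_def by (intro continuous_intros)
    have f_le: "f s \<le> h" for s unfolding f_def using h(3) by simp
    have f_zero: "f s = 0" if "\<not> \<bar>s - t\<bar> \<le> h" for s unfolding f_def using that by simp
    have sum_le: "(\<Sum>s\<in>eigs n. f s) \<le> h" for n
    proof (cases "\<exists>s0\<in>eigs n. \<bar>s0 - t\<bar> \<le> h")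
      case True
      then obtain s0 where s0: "s0 \<in> eigs n" "\<bar>s0 - t\<bar> \<le> h" by blast
      have "f s = 0" if "s \<in> eigs n - {s0}" for s
      proof (rule f_zero)
        show "\<not> \<bar>s - t\<bar> \<le> h"
        proof
          assume "\<bar>s - t\<bar> \<le> h"
          then have "s = s0" using that s0 by (intro eigs_gap[OF C h]) auto
          then show False using that by blast
        qed
      qed
      then have "(\<Sum>s\<in>eigs n. f s) = (\<Sum>s\<in>{s0}. f s)"
        using s0(1) by (intro sum.mono_neutral_right) auto
      then show ?thesis using f_le[of s0] by simp
    next
      case False
      then have "(\<Sum>s\<in>eigs n. f s) = 0" by (intro sum.neutral ballI f_zero) blast
      then show ?thesis using h(3) by linarith
    qed
    have "(\<lambda>j. (\<Sum>s\<in>eigs (N j). f s) / real (N j)) \<longlonglongrightarrow> 0"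
    proof (rule Lim_null_comparison)
      show "\<forall>\<^sub>F j in sequentially. norm ((\<Sum>s\<in>eigs (N j). f s) / real (N j)) \<le> h * inverse (real (N j))"
      proof (intro always_eventually allI)
        fix j
        have "0 \<le> (\<Sum>s\<in>eigs (N j). f s)" by (intro sum_nonneg) (simp add: f_def)
        then have "norm ((\<Sum>s\<in>eigs (N j). f s) / real (N j)) = (\<Sum>s\<in>eigs (N j). f s) * inverse (real (N j))"
          by (simp add: divide_inverse)
        also have "\<dots> \<le> h * inverse (real (N j))" by (intro mult_right_mono sum_le) simp
        finally show "norm ((\<Sum>s\<in>eigs (N j). f s) / real (N j)) \<le> h * inverse (real (N j))" .
      qed
      show "(\<lambda>j. h * inverse (real (N j))) \<longlonglongrightarrow> 0"
        using tendsto_mult[OF tendsto_const[of h] inverse_N] by simp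
    qed
    from LIMSEQ_unique[OF kappa_limit_cont[OF cont] this] have z: "(\<integral>s. f s \<partial>\<kappa>) = 0" .
    have "AE s in \<kappa>. 0 \<le> f s" by (simp add: f_def)
    then have "AE s in \<kappa>. f s = 0"
      using integral_nonneg_eq_0_iff_AE[OF integrable_cont[OF cont]] z by blast
    then have "AE s in \<kappa>. s \<notin> {t - h<..<t + h}" by eventually_elim (auto simp: f_def max_def split: if_splits)
    moreover have "(AE s in \<kappa>. s \<notin> {t - h<..<t + h}) \<longleftrightarrow> emeasure \<kappa> {t - h<..<t + h} = 0"
      by (rule AE_iff_measurable) (auto simp: sets_\<kappa>)
    ultimately show False using topological_support_open[OF t, of "{t - h<..<t + h}"] h by simp
  qed
qed

end

section \<open>The sequence space\<close>

lemma ell2_summable: "u \<in> ell2 \<Longrightarrow> summable (\<lambda>n. (cmod (u n))\<^sup>2)"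
  by (simp add: ell2_def)

lemma ell2_lin:
  assumes "u \<in> ell2" "v \<in> ell2"
  shows "(\<lambda>n. c * u n + d * v n) \<in> ell2"
proof -
  have "summable (\<lambda>n. 2 * ((cmod c)\<^sup>2 * (cmod (u n))\<^sup>2) + 2 * ((cmod d)\<^sup>2 * (cmod (v n))\<^sup>2))"
    by (intro summable_add summable_mult ell2_summable assms)
  moreover have "norm ((cmod (c * u n + d * v n))\<^sup>2) \<le> 2 * ((cmod c)\<^sup>2 * (cmod (u n))\<^sup>2) + 2 * ((cmod d)\<^sup>2 * (cmod (v n))\<^sup>2)" for n
  proof -
    have "(cmod (c * u n + d * v n))\<^sup>2 \<le> (cmod (c * u n) + cmod (d * v n))\<^sup>2"
      by (intro power_mono norm_triangle_ineq) simp
    also have "\<dots> \<le> 2 * (cmod (c * u n))\<^sup>2 + 2 * (cmod (d * v n))\<^sup>2"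
      using sum_squares_bound[of "cmod (c * u n)" "cmod (d * v n)"] by (simp add: power2_sum)
    finally show ?thesis by (simp add: norm_mult power_mult_distrib)
  qed
  ultimately have "summable (\<lambda>n. (cmod (c * u n + d * v n))\<^sup>2)"
    by (rule summable_comparison_test'[where N = 0])
  then show ?thesis using assms by (simp add: ell2_def)
qed

lemma ell2_inner_summable:
  assumes "u \<in> ell2" "v \<in> ell2"
  shows "summable (\<lambda>n. norm (cnj (u n) * v n))"
proof -
  have "summable (\<lambda>n. (cmod (u n))\<^sup>2 + (cmod (v n))\<^sup>2)"
    by (intro summable_add ell2_summable assms)
  moreover have "norm (norm (cnj (u n) * v n)) \<le> (cmod (u n))\<^sup>2 + (cmod (v n))\<^sup>2" for n
  proof -
    have "cmod (u n) * cmod (v n) \<le> 2 * (cmod (u n) * cmod (v n))" by simp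
    also have "\<dots> \<le> (cmod (u n))\<^sup>2 + (cmod (v n))\<^sup>2"
      using sum_squares_bound[of "cmod (u n)" "cmod (v n)"] by (simp only: mult.assoc)
    finally show ?thesis by (simp add: norm_mult)
  qed
  ultimately show ?thesis by (rule summable_comparison_test'[where N = 0])
qed

lemma ell2_inner_lin:
  assumes "u \<in> ell2" "v \<in> ell2" "w \<in> ell2"
  shows "ell2_inner u (\<lambda>n. c * v n + d * w n) = c * ell2_inner u v + d * ell2_inner u w"
proof -
  have "(\<Sum>n. cnj (u n) * (c * v n + d * w n)) = (\<Sum>n. c * (cnj (u n) * v n) + d * (cnj (u n) * w n))"
    by (simp add: algebra_simps)
  also have "\<dots> = (\<Sum>n. c * (cnj (u n) * v n)) + (\<Sum>n. d * (cnj (u n) * w n))"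
    by (intro suminf_add[symmetric] summable_mult summable_norm_cancel[OF ell2_inner_summable] assms)
  also have "\<dots> = c * ell2_inner u v + d * ell2_inner u w"
    unfolding ell2_inner_def
    by (intro arg_cong2[of _ _ _ _ "(+)"] suminf_mult summable_norm_cancel[OF ell2_inner_summable] assms)
  finally show ?thesis unfolding ell2_inner_def .
qed

lemma ell2_inner_cnj:
  assumes "u \<in> ell2" "v \<in> ell2"
  shows "ell2_inner v u = cnj (ell2_inner u v)"
proof -
  have "(\<lambda>n. cnj (u n) * v n) sums ell2_inner u v"
    unfolding ell2_inner_def by (intro summable_sums summable_norm_cancel[OF ell2_inner_summable] assms)
  then have "(\<lambda>n. cnj (cnj (u n) * v n)) sums cnj (ell2_inner u v)" by (subst sums_cnj)
  then show ?thesis unfolding ell2_inner_def by (simp add: sums_iff mult.commute)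
qed

lemma ell2_norm_eq: "u \<in> ell2 \<Longrightarrow> (ell2_norm u)\<^sup>2 = (\<Sum>n. (cmod (u n))\<^sup>2)"
  unfolding ell2_norm_def using suminf_nonneg[OF ell2_summable] by simp

lemma ell2_inner_self:
  assumes "u \<in> ell2"
  shows "ell2_inner u u = of_real ((ell2_norm u)\<^sup>2)"
proof -
  have "(\<Sum>n. cnj (u n) * u n) = (\<Sum>n. of_real ((cmod (u n))\<^sup>2))"
    by (simp add: complex_norm_square mult.commute del: of_real_power)
  also have "\<dots> = of_real (\<Sum>n. (cmod (u n))\<^sup>2)"
    by (rule suminf_of_real[OF ell2_summable[OF assms], symmetric])
  finally show ?thesis unfolding ell2_inner_def ell2_norm_eq[OF assms] .
qed

lemma ell2_cauchy_schwarz: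
  assumes "u \<in> ell2" "v \<in> ell2"
  shows "cmod (ell2_inner u v) \<le> ell2_norm u * ell2_norm v"
proof -
  have L2: "L2_set (\<lambda>n. cmod (x n)) {..<m} \<le> ell2_norm x" if "x \<in> ell2" for x m
    unfolding L2_set_def ell2_norm_def
    by (intro real_sqrt_le_mono sum_le_suminf ell2_summable that) auto
  have "(\<Sum>n. norm (cnj (u n) * v n)) \<le> ell2_norm u * ell2_norm v"
  proof (rule suminf_le_const[OF ell2_inner_summable[OF assms]])
    fix m
    have "(\<Sum>n<m. norm (cnj (u n) * v n)) = (\<Sum>n<m. \<bar>cmod (u n)\<bar> * \<bar>cmod (v n)\<bar>)" by (simp add: norm_mult)
    also have "\<dots> \<le> L2_set (\<lambda>n. cmod (u n)) {..<m} * L2_set (\<lambda>n. cmod (v n)) {..<m}"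
      by (rule L2_set_mult_ineq)
    also have "\<dots> \<le> ell2_norm u * ell2_norm v"
      by (intro mult_mono L2 assms ell2_norm_nonneg) (auto simp: L2_set_nonneg)
    finally show "(\<Sum>n<m. norm (cnj (u n) * v n)) \<le> ell2_norm u * ell2_norm v" .
  qed
  then show ?thesis
    unfolding ell2_inner_def using summable_norm[OF ell2_inner_summable[OF assms]] by linarith
qed

lemma ell2_norm_zero:
  assumes "u \<in> ell2" "ell2_norm u = 0" shows "u n = 0"
proof -
  have "(cmod (u n))\<^sup>2 = (\<Sum>k\<in>{n}. (cmod (u k))\<^sup>2)" by simp
  also have "\<dots> \<le> (\<Sum>k. (cmod (u k))\<^sup>2)"
    by (rule sum_le_suminf[OF ell2_summable[OF assms(1)]]) auto
  also have "\<dots> = 0" using ell2_norm_eq[OF assms(1)] assms(2) by simp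
  finally show ?thesis by simp
qed

lemma delta_ell2: "n \<ge> 1 \<Longrightarrow> delta n \<in> ell2"
  by (rule ell2_finite_support(1)[of n]) (auto simp: delta_def)

lemma ell2_norm_delta:
  assumes "n \<ge> 1" shows "ell2_norm (delta n) = 1"
proof -
  have "of_real ((ell2_norm (delta n))\<^sup>2) = (of_real 1 :: complex)"
    using ell2_inner_self[OF delta_ell2[OF assms]] unfolding ell2_inner_delta by (simp add: delta_def)
  then have "(ell2_norm (delta n))\<^sup>2 = 1" unfolding of_real_eq_iff .
  then show ?thesis using ell2_norm_nonneg[OF delta_ell2[OF assms]] by (simp add: power2_eq_1_iff)
qed

lemma ell2_zero: "(\<lambda>n. 0) \<in> ell2" by (simp add: ell2_def)

lemma ell2_sum: "(\<And>i. i \<in> I \<Longrightarrow> v i \<in> ell2) \<Longrightarrow> (\<lambda>k. \<Sum>i\<in>I. v i k) \<in> ell2"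
proof (induction I rule: infinite_finite_induct)
  case (insert x F)
  then show ?case using ell2_lin[of "v x" "\<lambda>k. \<Sum>i\<in>F. v i k" 1 1] by simp
qed (auto simp: ell2_zero)

lemma ell2_inner_sum:
  assumes "u \<in> ell2" "\<And>i. i \<in> I \<Longrightarrow> v i \<in> ell2"
  shows "ell2_inner u (\<lambda>k. \<Sum>i\<in>I. v i k) = (\<Sum>i\<in>I. ell2_inner u (v i))"
  using assms(2)
proof (induction I rule: infinite_finite_induct)
  case (insert x F)
  then show ?case using ell2_inner_lin[OF assms(1), of "v x" "\<lambda>k. \<Sum>i\<in>F. v i k" 1 1]
    by (simp add: ell2_sum)
qed (auto simp: ell2_inner_def)

text \<open>The spectral resolution is known through quadratic forms. Real polarization recovers the
  real parts of mixed forms; a general \<open>F\<close> covers both the projections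
  \<open>E A\<close> and \<open>jacobi_op\<close>.\<close>

lemma ell2_form_polarization:
  assumes x: "x \<in> ell2" and y: "y \<in> ell2" and F: "\<And>u. u \<in> ell2 \<Longrightarrow> F u \<in> ell2"
    and lin: "\<And>c. F (\<lambda>n. 1 * x n + c * y n) = (\<lambda>n. 1 * F x n + c * F y n)"
  defines "s \<equiv> \<lambda>n. x n + y n" and "d \<equiv> \<lambda>n. x n - y n"
  shows "s \<in> ell2" "d \<in> ell2"
    "Re (ell2_inner s (F s)) - Re (ell2_inner d (F d)) = 2 * Re (ell2_inner x (F y)) + 2 * Re (ell2_inner y (F x))"
proof -
  have sd: "s = (\<lambda>n. 1 * x n + 1 * y n)" "d = (\<lambda>n. 1 * x n + (- 1) * y n)" by (auto simp: s_def d_def)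
  show "s \<in> ell2" "d \<in> ell2" unfolding sd by (rule ell2_lin[OF x y])+
  have gen: "ell2_inner (\<lambda>n. 1 * x n + c * y n) (F (\<lambda>n. 1 * x n + c * y n))
      = ell2_inner x (F x) + c * ell2_inner x (F y) + c * (ell2_inner y (F x) + c * ell2_inner y (F y))"
    if c: "cnj c = c" for c
  proof -
    note z = ell2_lin[OF x y, of 1 c]
    have R: "ell2_inner (\<lambda>n. 1 * x n + c * y n) v = ell2_inner x v + c * ell2_inner y v" if v: "v \<in> ell2" for v
      unfolding ell2_inner_cnj[OF v z] ell2_inner_lin[OF v x y]
      using ell2_inner_cnj[OF v x] ell2_inner_cnj[OF v y] c by simp
    show ?thesis
      unfolding R[OF F[OF z]] unfolding lin ell2_inner_lin[OF x F[OF x] F[OF y]] ell2_inner_lin[OF y F[OF x] F[OF y]]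
      by simp
  qed
  show "Re (ell2_inner s (F s)) - Re (ell2_inner d (F d)) = 2 * Re (ell2_inner x (F y)) + 2 * Re (ell2_inner y (F x))"
    unfolding sd using gen[of 1] gen[of "- 1"] by simp
qed

section \<open>Comparison of measures\<close>

text \<open>The signed identity \<open>dP - dQ = (p - q) d\<rho>\<close> with all negative terms
  moved across, so that the usual induction from sets to nonnegative functions never subtracts
  infinite values.\<close>

lemma nn_integral_measure_identity:
  fixes p q :: "real \<Rightarrow> ennreal"
  assumes S: "sets P = sets borel" "sets Q = sets borel" "sets \<rho> = sets borel"
    and pq: "p \<in> borel_measurable borel" "q \<in> borel_measurable borel"
    and id: "\<And>A. A \<in> sets borel \<Longrightarrow> emeasure P A + (\<integral>\<^sup>+t. q t * indicator A t \<partial>\<rho>) = emeasure Q A + (\<integral>\<^sup>+t. p t * indicator A t \<partial>\<rho>)"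
    and g: "g \<in> borel_measurable borel"
  shows "(\<integral>\<^sup>+t. g t \<partial>P) + (\<integral>\<^sup>+t. q t * g t \<partial>\<rho>) = (\<integral>\<^sup>+t. g t \<partial>Q) + (\<integral>\<^sup>+t. p t * g t \<partial>\<rho>)"
proof -
  note [measurable_cong] = S
  note [measurable] = pq
  show ?thesis using g
  proof (induction rule: borel_measurable_induct)
    case (cong f g)
    then show ?case by (simp add: nn_integral_cong[of _ f g] cong: nn_integral_cong)
  next
    case (set A)
    then show ?case using id[OF set] by (simp add: S)
  next
    case (mult u c)
    note [measurable] = mult(2)
    have "c * ((\<integral>\<^sup>+t. u t \<partial>P) + (\<integral>\<^sup>+t. q t * u t \<partial>\<rho>)) = c * ((\<integral>\<^sup>+t. u t \<partial>Q) + (\<integral>\<^sup>+t. p t * u t \<partial>\<rho>))"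
      using mult by simp
    then show ?case by (simp add: distrib_left mult.left_commute[of _ c] nn_integral_cmult)
  next
    case (add u v)
    note [measurable] = add(1,3)
    have "((\<integral>\<^sup>+t. u t \<partial>P) + (\<integral>\<^sup>+t. q t * u t \<partial>\<rho>)) + ((\<integral>\<^sup>+t. v t \<partial>P) + (\<integral>\<^sup>+t. q t * v t \<partial>\<rho>))
      = ((\<integral>\<^sup>+t. u t \<partial>Q) + (\<integral>\<^sup>+t. p t * u t \<partial>\<rho>)) + ((\<integral>\<^sup>+t. v t \<partial>Q) + (\<integral>\<^sup>+t. p t * v t \<partial>\<rho>))"
      using add by simp
    then show ?case by (simp add: distrib_left nn_integral_add ac_simps)
  next
    case (seq U)
    note [measurable] = seq(1)
    have i: "incseq (\<lambda>i t. q t * U i t)" "incseq (\<lambda>i t. p t * U i t)"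
      using seq(3) by (auto simp: incseq_def le_fun_def intro!: mult_left_mono)
    have m: "incseq (\<lambda>i. \<integral>\<^sup>+t. U i t \<partial>P)" "incseq (\<lambda>i. \<integral>\<^sup>+t. U i t \<partial>Q)"
      "incseq (\<lambda>i. \<integral>\<^sup>+t. q t * U i t \<partial>\<rho>)" "incseq (\<lambda>i. \<integral>\<^sup>+t. p t * U i t \<partial>\<rho>)"
      using seq(3) by (auto simp: incseq_def le_fun_def intro!: nn_integral_mono mult_left_mono)
    have "(SUP i. (\<integral>\<^sup>+t. U i t \<partial>P) + (\<integral>\<^sup>+t. q t * U i t \<partial>\<rho>)) = (SUP i. (\<integral>\<^sup>+t. U i t \<partial>Q) + (\<integral>\<^sup>+t. p t * U i t \<partial>\<rho>))"
      using seq by simp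
    then have "(SUP i. (\<integral>\<^sup>+t. U i t \<partial>P)) + (SUP i. (\<integral>\<^sup>+t. q t * U i t \<partial>\<rho>)) = (SUP i. (\<integral>\<^sup>+t. U i t \<partial>Q)) + (SUP i. (\<integral>\<^sup>+t. p t * U i t \<partial>\<rho>))"
      by (simp add: ennreal_SUP_add m)
    then show ?case
      using seq(3) i by (simp add: SUP_apply image_comp nn_integral_monotone_convergence_SUP[symmetric] SUP_mult_left_ennreal)
  qed
qed

text \<open>Integrability of \<open>f * g\<close> has to be derived. Applying the identity to
  \<open>g\<close> restricted to the set where \<open>f > 0\<close> removes the negative part of
  \<open>f\<close> and bounds the positive part of \<open>f * g\<close> by the integral of
  \<open>g\<close> against \<open>P\<close>; the unrestricted identity then bounds the negative
  part.\<close>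

lemma integral_measure_identity_nonneg:
  fixes f g :: "real \<Rightarrow> real"
  assumes fin: "finite_measure P" "finite_measure Q"
    and S: "sets P = sets borel" "sets Q = sets borel" "sets \<rho> = sets borel"
    and f: "integrable \<rho> f"
    and id: "\<And>A. A \<in> sets borel \<Longrightarrow> measure P A - measure Q A = (\<integral>t. f t * indicator A t \<partial>\<rho>)"
    and g: "integrable P g" "integrable Q g" "\<And>t. g t \<ge> 0"
  shows "integrable \<rho> (\<lambda>t. f t * g t) \<and> (\<integral>t. g t \<partial>P) - (\<integral>t. g t \<partial>Q) = (\<integral>t. f t * g t \<partial>\<rho>)"
proof -
  interpret P: finite_measure P by fact
  interpret Q: finite_measure Q by fact
  note [measurable_cong] = S
  have fm [measurable]: "f \<in> borel_measurable borel" using f borel_measurable_integrable measurable_cong_sets[OF S(3) refl] by blast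
  have gm [measurable]: "g \<in> borel_measurable borel" using g(1) borel_measurable_integrable measurable_cong_sets[OF S(1) refl] by blast
  define p q where "p = (\<lambda>t. ennreal (f t))" and "q = (\<lambda>t. ennreal (- f t))"
  have [measurable]: "p \<in> borel_measurable borel" "q \<in> borel_measurable borel" by (auto simp: p_def q_def)
  have ind: "ennreal (f t * indicator A t) = p t * indicator A t" "ennreal (- (f t * indicator A t)) = q t * indicator A t"
    for t and A :: "real set" by (auto simp: p_def q_def split: split_indicator)
  have idA: "emeasure P A + (\<integral>\<^sup>+t. q t * indicator A t \<partial>\<rho>) = emeasure Q A + (\<integral>\<^sup>+t. p t * indicator A t \<partial>\<rho>)"
    if A [measurable]: "A \<in> sets borel" for A
  proof -
    have fi: "integrable \<rho> (\<lambda>t. f t * indicator A t)"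
      using integrable_real_mult_indicator[OF _ f, of A] S A by simp
    obtain r s where rs: "(\<integral>\<^sup>+t. p t * indicator A t \<partial>\<rho>) = ennreal r" "r \<ge> 0" "(\<integral>\<^sup>+t. q t * indicator A t \<partial>\<rho>) = ennreal s" "s \<ge> 0"
      "(\<integral>t. f t * indicator A t \<partial>\<rho>) = r - s"
      by (rule integrableE[OF fi]) (unfold ind, blast)
    have "measure P A + s = measure Q A + r" using id[OF A] rs by simp
    then show ?thesis unfolding rs P.emeasure_eq_measure Q.emeasure_eq_measure
      using rs by (simp flip: ennreal_plus)
  qed
  note key = nn_integral_measure_identity[OF S _ _ idA, of "\<lambda>t. h t" for h]
  have le: "(\<integral>\<^sup>+t. p t * ennreal (g t) \<partial>\<rho>) \<le> (\<integral>\<^sup>+t. ennreal (g t) \<partial>P)"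
  proof -
    let ?h = "\<lambda>t. ennreal (g t) * indicator {t. f t > 0} t"
    have "(\<integral>\<^sup>+t. ?h t \<partial>P) + (\<integral>\<^sup>+t. q t * ?h t \<partial>\<rho>) = (\<integral>\<^sup>+t. ?h t \<partial>Q) + (\<integral>\<^sup>+t. p t * ?h t \<partial>\<rho>)"
      by (rule key) auto
    moreover have "(\<integral>\<^sup>+t. q t * ?h t \<partial>\<rho>) = 0"
      by (subst nn_integral_0_iff_AE) (auto simp: q_def ennreal_neg split: split_indicator)
    moreover have "(\<integral>\<^sup>+t. p t * ?h t \<partial>\<rho>) = (\<integral>\<^sup>+t. p t * ennreal (g t) \<partial>\<rho>)"
      by (intro nn_integral_cong) (auto simp: p_def ennreal_neg split: split_indicator)
    moreover have "(\<integral>\<^sup>+t. ?h t \<partial>P) \<le> (\<integral>\<^sup>+t. ennreal (g t) \<partial>P)"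
      by (intro nn_integral_mono) (auto split: split_indicator)
    ultimately have "(\<integral>\<^sup>+t. ennreal (g t) \<partial>P) \<ge> (\<integral>\<^sup>+t. ?h t \<partial>Q) + (\<integral>\<^sup>+t. p t * ennreal (g t) \<partial>\<rho>)" by simp
    then show ?thesis by (rule order_trans[rotated]) simp
  qed
  have Pf: "(\<integral>\<^sup>+t. ennreal (g t) \<partial>P) = ennreal (\<integral>t. g t \<partial>P)" "(\<integral>\<^sup>+t. ennreal (g t) \<partial>Q) = ennreal (\<integral>t. g t \<partial>Q)"
    by (auto intro!: nn_integral_eq_integral g)
  have main: "(\<integral>\<^sup>+t. ennreal (g t) \<partial>P) + (\<integral>\<^sup>+t. q t * ennreal (g t) \<partial>\<rho>) = (\<integral>\<^sup>+t. ennreal (g t) \<partial>Q) + (\<integral>\<^sup>+t. p t * ennreal (g t) \<partial>\<rho>)"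
    by (rule key) auto
  have pg: "p t * ennreal (g t) = ennreal (f t * g t)" "q t * ennreal (g t) = ennreal (- (f t * g t))" for t
    unfolding p_def q_def using g(3)[of t] by (simp_all add: ennreal_mult''[symmetric])
  obtain r where r: "(\<integral>\<^sup>+t. p t * ennreal (g t) \<partial>\<rho>) = ennreal r" "r \<ge> 0"
    using le unfolding Pf by (cases "\<integral>\<^sup>+t. p t * ennreal (g t) \<partial>\<rho>") (auto simp: top_unique)
  obtain s where s: "(\<integral>\<^sup>+t. q t * ennreal (g t) \<partial>\<rho>) = ennreal s" "s \<ge> 0"
  proof (cases "\<integral>\<^sup>+t. q t * ennreal (g t) \<partial>\<rho>")
    case top
    then have "\<top> = ennreal (\<integral>t. g t \<partial>Q) + ennreal r" using main unfolding Pf r by simp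
    then have "ennreal (\<integral>t. g t \<partial>Q) + ennreal r = \<top>" by simp
    then show ?thesis by simp
  qed auto
  have int: "integrable \<rho> (\<lambda>t. f t * g t)"
  proof (subst real_integrable_def, intro conjI)
    show "(\<lambda>t. f t * g t) \<in> borel_measurable \<rho>" by measurable
    show "(\<integral>\<^sup>+t. ennreal (f t * g t) \<partial>\<rho>) \<noteq> \<infinity>" using r unfolding pg by simp
    show "(\<integral>\<^sup>+t. ennreal (- (f t * g t)) \<partial>\<rho>) \<noteq> \<infinity>" using s unfolding pg by simp
  qed
  have eq: "(\<integral>t. f t * g t \<partial>\<rho>) = r - s"
    using real_lebesgue_integral_def[OF int] r s unfolding pg by simp
  have G: "0 \<le> (\<integral>t. g t \<partial>P)" "0 \<le> (\<integral>t. g t \<partial>Q)" using g(3) by simp_all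
  have "ennreal ((\<integral>t. g t \<partial>P) + s) = ennreal ((\<integral>t. g t \<partial>Q) + r)"
    using main unfolding Pf r(1) s(1) using G r(2) s(2) by (simp add: ennreal_plus)
  then have "(\<integral>t. g t \<partial>P) + s = (\<integral>t. g t \<partial>Q) + r"
    using G r(2) s(2) by (subst (asm) ennreal_inj) auto
  then show ?thesis using int eq by simp
qed

lemma integral_measure_identity:
  fixes f :: "real \<Rightarrow> real"
  assumes fin: "finite_measure P" "finite_measure Q"
    and S: "sets P = sets borel" "sets Q = sets borel" "sets \<rho> = sets borel"
    and f: "integrable \<rho> f"
    and id: "\<And>A. A \<in> sets borel \<Longrightarrow> measure P A - measure Q A = (\<integral>t. f t * indicator A t \<partial>\<rho>)"
    and g: "integrable P g" "integrable Q g"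
  shows "integrable \<rho> (\<lambda>t. f t * g t)" "(\<integral>t. g t \<partial>P) - (\<integral>t. g t \<partial>Q) = (\<integral>t. f t * g t \<partial>\<rho>)"
proof -
  have sp: "g t = max (g t) 0 - max (- g t) 0" for t :: real by simp
  have int: "integrable P (\<lambda>t. max (g t) 0)" "integrable Q (\<lambda>t. max (g t) 0)"
    "integrable P (\<lambda>t. max (- g t) 0)" "integrable Q (\<lambda>t. max (- g t) 0)"
    using g by auto
  note A = integral_measure_identity_nonneg[OF fin S f id int(1,2)] and B = integral_measure_identity_nonneg[OF fin S f id int(3,4)]
  have A': "integrable \<rho> (\<lambda>t. f t * max (g t) 0)" "(\<integral>t. max (g t) 0 \<partial>P) - (\<integral>t. max (g t) 0 \<partial>Q) = (\<integral>t. f t * max (g t) 0 \<partial>\<rho>)"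
    and B': "integrable \<rho> (\<lambda>t. f t * max (- g t) 0)" "(\<integral>t. max (- g t) 0 \<partial>P) - (\<integral>t. max (- g t) 0 \<partial>Q) = (\<integral>t. f t * max (- g t) 0 \<partial>\<rho>)"
    using A B by auto
  have fg: "f t * g t = f t * max (g t) 0 - f t * max (- g t) 0" for t
    by (subst sp[of t]) (simp only: right_diff_distrib)
  show "integrable \<rho> (\<lambda>t. f t * g t)"
    unfolding fg by (intro Bochner_Integration.integrable_diff A' B')
  have "(\<integral>t. g t \<partial>P) = (\<integral>t. max (g t) 0 \<partial>P) - (\<integral>t. max (- g t) 0 \<partial>P)"
    by (subst Bochner_Integration.integral_diff[symmetric, OF int(1,3)]) (simp flip: sp)
  moreover have "(\<integral>t. g t \<partial>Q) = (\<integral>t. max (g t) 0 \<partial>Q) - (\<integral>t. max (- g t) 0 \<partial>Q)"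
    by (subst Bochner_Integration.integral_diff[symmetric, OF int(2,4)]) (simp flip: sp)
  moreover have "(\<integral>t. f t * g t \<partial>\<rho>) = (\<integral>t. f t * max (g t) 0 \<partial>\<rho>) - (\<integral>t. f t * max (- g t) 0 \<partial>\<rho>)"
    unfolding fg by (rule Bochner_Integration.integral_diff[OF A'(1) B'(1)])
  ultimately show "(\<integral>t. g t \<partial>P) - (\<integral>t. g t \<partial>Q) = (\<integral>t. f t * g t \<partial>\<rho>)"
    using A'(2) B'(2) by linarith
qed

section \<open>The spectral measure\<close>

locale resolution =
  fixes T :: "cseq \<Rightarrow> cseq" and E :: "real set \<Rightarrow> cseq \<Rightarrow> cseq"
  assumes res: "spectral_resolution T E"
begin

lemma proj: "A \<in> sets borel \<Longrightarrow> orthogonal_projection (E A)"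
  using res by (simp add: spectral_resolution_def)

lemma E_ell2: "A \<in> sets borel \<Longrightarrow> u \<in> ell2 \<Longrightarrow> E A u \<in> ell2"
  and E_idem: "A \<in> sets borel \<Longrightarrow> u \<in> ell2 \<Longrightarrow> E A (E A u) = E A u"
  and E_lin: "A \<in> sets borel \<Longrightarrow> u \<in> ell2 \<Longrightarrow> v \<in> ell2 \<Longrightarrow> E A (\<lambda>n. c * u n + d * v n) = (\<lambda>n. c * E A u n + d * E A v n)"
  and E_sym: "A \<in> sets borel \<Longrightarrow> u \<in> ell2 \<Longrightarrow> v \<in> ell2 \<Longrightarrow> ell2_inner u (E A v) = ell2_inner (E A u) v"
  using proj[of A] unfolding orthogonal_projection_def by blast+

lemma E_UNIV: "u \<in> ell2 \<Longrightarrow> E UNIV u = u"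
  using res by (simp add: spectral_resolution_def)

lemma E_norm: "A \<in> sets borel \<Longrightarrow> u \<in> ell2 \<Longrightarrow> (ell2_norm (E A u))\<^sup>2 = Re (ell2_inner u (E A u))"
proof -
  assume A: "A \<in> sets borel" "u \<in> ell2"
  have "ell2_inner u (E A u) = ell2_inner u (E A (E A u))" using E_idem[OF A] by simp
  also have "\<dots> = ell2_inner (E A u) (E A u)" by (rule E_sym[OF A(1) A(2) E_ell2[OF A]])
  also have "\<dots> = of_real ((ell2_norm (E A u))\<^sup>2)" by (rule ell2_inner_self[OF E_ell2[OF A]])
  finally show "(ell2_norm (E A u))\<^sup>2 = Re (ell2_inner u (E A u))" by simp
qed

lemma E_countable:
  assumes "range A \<subseteq> sets borel" "disjoint_family A" "u \<in> ell2"
  shows "(\<lambda>m. ell2_norm (\<lambda>k. (\<Sum>i<m. E (A i) u k) - E (\<Union>i. A i) u k)) \<longlonglongrightarrow> 0"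
  using res assms unfolding spectral_resolution_def by blast

text \<open>The squared norm of a projected vector is the quadratic form of the projection, so
  Cauchy-Schwarz turns strong convergence into convergence of squared norms.\<close>

lemma E_sums:
  assumes A: "range A \<subseteq> sets borel" "disjoint_family A" and u: "u \<in> ell2"
  shows "(\<lambda>i. (ell2_norm (E (A i) u))\<^sup>2) sums (ell2_norm (E (\<Union>i. A i) u))\<^sup>2"
  unfolding sums_def
proof (rule Lim_transform[OF tendsto_const])
  have Ai: "A i \<in> sets borel" for i using A(1) by blast
  have AU: "(\<Union>i. A i) \<in> sets borel" using Ai by blast
  define s where "s m k = (\<Sum>i<m. E (A i) u k) - E (\<Union>i. A i) u k" for m k
  have sl: "(\<lambda>k. \<Sum>i<m. E (A i) u k) \<in> ell2" for m by (intro ell2_sum E_ell2 Ai u)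
  have s_eq: "s m = (\<lambda>k. 1 * (\<Sum>i<m. E (A i) u k) + (- 1) * E (\<Union>i. A i) u k)" for m by (simp add: s_def fun_eq_iff)
  have s: "s m \<in> ell2" for m unfolding s_eq by (intro ell2_lin sl E_ell2 AU u)
  have eq: "(\<Sum>i<m. (ell2_norm (E (A i) u))\<^sup>2) - (ell2_norm (E (\<Union>i. A i) u))\<^sup>2 = Re (ell2_inner u (s m))" for m
  proof -
    have "ell2_inner u (s m) = (\<Sum>i<m. ell2_inner u (E (A i) u)) - ell2_inner u (E (\<Union>i. A i) u)"
      unfolding s_eq ell2_inner_lin[OF u sl E_ell2[OF AU u]]
      by (simp add: ell2_inner_sum[OF u E_ell2[OF Ai u]])
    then show ?thesis by (simp add: E_norm Ai AU u)
  qed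
  show "(\<lambda>m. (\<Sum>i<m. (ell2_norm (E (A i) u))\<^sup>2) - (ell2_norm (E (\<Union>i. A i) u))\<^sup>2) \<longlonglongrightarrow> 0"
  proof (rule Lim_null_comparison)
    show "\<forall>\<^sub>F m in sequentially. norm ((\<Sum>i<m. (ell2_norm (E (A i) u))\<^sup>2) - (ell2_norm (E (\<Union>i. A i) u))\<^sup>2) \<le> ell2_norm u * ell2_norm (s m)"
      unfolding eq real_norm_def
      by (intro always_eventually allI order_trans[OF abs_Re_le_cmod ell2_cauchy_schwarz] u s)
    have "(\<lambda>m. ell2_norm (s m)) \<longlonglongrightarrow> 0" using E_countable[OF A u] unfolding s_def .
    from tendsto_mult[OF tendsto_const[of "ell2_norm u"] this]
    show "(\<lambda>m. ell2_norm u * ell2_norm (s m)) \<longlonglongrightarrow> 0" by simp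
  qed
qed

text \<open>Countable additivity on a family of empty sets makes a constant series converge, which
  forces its terms to be 0.\<close>

lemma E_empty_norm: "u \<in> ell2 \<Longrightarrow> ell2_norm (E {} u) = 0"
proof -
  assume u: "u \<in> ell2"
  have "(\<lambda>i::nat. (ell2_norm (E {} u))\<^sup>2) sums (ell2_norm (E (\<Union>i::nat. {}) u))\<^sup>2"
    by (rule E_sums[OF _ _ u]) (auto simp: disjoint_family_on_def)
  then have "summable (\<lambda>i::nat. (ell2_norm (E {} u))\<^sup>2)" by (rule sums_summable)
  then show ?thesis by (simp add: summable_const_iff)
qed

definition mu :: "cseq \<Rightarrow> real measure" where "mu u = spectral_measure E u"

lemma sets_mu [simp]: "sets (mu u) = sets borel"
  unfolding mu_def spectral_measure_def by (subst sets_measure_of) (auto simp: sets.sigma_sets_eq[of borel, simplified])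

lemma space_mu [simp]: "space (mu u) = UNIV"
  using sets_eq_imp_space_eq[OF sets_mu] by simp

lemma meas_mu [measurable_cong]: "sets (mu u) = sets borel" by (rule sets_mu)

lemma emeasure_mu:
  assumes u: "u \<in> ell2" and A: "A \<in> sets borel"
  shows "emeasure (mu u) A = ennreal ((ell2_norm (E A u))\<^sup>2)"
proof -
  have "emeasure (spectral_measure E u) A = ennreal ((ell2_norm (E A u))\<^sup>2)"
    unfolding spectral_measure_def
  proof (rule emeasure_measure_of_sigma)
    show "sigma_algebra UNIV (sets (borel :: real measure))" using sets.sigma_algebra_axioms[of borel] by simp
    show "positive (sets borel) (\<lambda>A. ennreal ((ell2_norm (E A u))\<^sup>2))"
      by (simp add: positive_def E_empty_norm u)
    show "countably_additive (sets borel) (\<lambda>A. ennreal ((ell2_norm (E A u))\<^sup>2))"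
    proof (rule countably_additiveI)
      fix B :: "nat \<Rightarrow> real set"
      assume B: "range B \<subseteq> sets borel" "disjoint_family B"
      have "(\<lambda>i. ennreal ((ell2_norm (E (B i) u))\<^sup>2)) sums ennreal ((ell2_norm (E (\<Union>i. B i) u))\<^sup>2)"
        using E_sums[OF B u] by (subst sums_ennreal) auto
      then show "(\<Sum>i. ennreal ((ell2_norm (E (B i) u))\<^sup>2)) = ennreal ((ell2_norm (E (\<Union>i. B i) u))\<^sup>2)"
        by (simp add: sums_iff)
    qed
  qed (rule A)
  then show ?thesis unfolding mu_def .
qed

lemma finite_mu: "u \<in> ell2 \<Longrightarrow> finite_measure (mu u)"
  by (rule finite_measureI) (simp add: emeasure_mu)

lemma measure_mu: "u \<in> ell2 \<Longrightarrow> A \<in> sets borel \<Longrightarrow> measure (mu u) A = (ell2_norm (E A u))\<^sup>2"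
  by (simp add: measure_def emeasure_mu)

text \<open>For \<open>v = E B u\<close> the measure \<open>mu v\<close> gives \<open>B\<close> its
  total mass, so nothing remains for \<open>A\<close>. This is the step from additivity to
  multiplicativity (\<open>E_Int\<close>), which the definition of a resolution does not
  postulate.\<close>

lemma E_disjoint:
  assumes AB: "A \<in> sets borel" "B \<in> sets borel" "A \<inter> B = {}" and u: "u \<in> ell2"
  shows "E A (E B u) n = 0"
proof -
  define v where "v = E B u"
  have v: "v \<in> ell2" "E B v = v" unfolding v_def using E_ell2 E_idem AB u by auto
  interpret finite_measure "mu v" by (rule finite_mu[OF v(1)])
  have "measure (mu v) (A \<union> B) = measure (mu v) A + measure (mu v) B"
    using AB by (intro finite_measure_Union) auto
  moreover have "measure (mu v) (A \<union> B) \<le> measure (mu v) UNIV"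
    using AB by (intro finite_measure_mono) auto
  ultimately have "(ell2_norm (E A v))\<^sup>2 \<le> 0" using AB v by (simp add: measure_mu E_UNIV)
  then have "ell2_norm (E A v) = 0" by simp
  from ell2_norm_zero[OF E_ell2[OF AB(1) v(1)] this] show ?thesis unfolding v_def .
qed

lemma E_Un_disjoint:
  assumes AB: "A \<in> sets borel" "B \<in> sets borel" "A \<inter> B = {}" and u: "u \<in> ell2"
  shows "E (A \<union> B) u n = E A u n + E B u n"
proof -
  define S where "S i = (if i = 0 then A else if i = Suc 0 then B else {})" for i :: nat
  have S: "range S \<subseteq> sets borel" "disjoint_family S" using AB by (auto simp: S_def disjoint_family_on_def)
  have SU: "(\<Union>i. S i) = A \<union> B" by (auto simp: S_def split: if_splits)
  define v where "v = (\<lambda>k. 1 * (1 * E A u k + 1 * E B u k) + (- 1) * E (A \<union> B) u k)"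
  have v: "v \<in> ell2" unfolding v_def by (intro ell2_lin E_ell2 AB u sets.Un)
  have E0: "E {} u k = 0" for k by (rule ell2_norm_zero[OF E_ell2 E_empty_norm]) (auto simp: u)
  \<comment> \<open>After two terms the partial sums no longer change, so the norms in question form
    a constant sequence tending to 0.\<close>
  have "(\<Sum>i<m + 2. E (S i) u k) = E A u k + E B u k" for m k
  proof -
    have "(\<Sum>i<m + 2. E (S i) u k) = (\<Sum>i\<in>{0, Suc 0}. E (S i) u k)"
      by (rule sum.mono_neutral_right) (auto simp: S_def E0)
    then show ?thesis by (simp add: S_def)
  qed
  then have "(\<lambda>m. ell2_norm (\<lambda>k. (\<Sum>i<m + 2. E (S i) u k) - E (\<Union>i. S i) u k)) = (\<lambda>m. ell2_norm v)"
    unfolding SU v_def by (simp add: fun_eq_iff)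
  moreover have "(\<lambda>m. ell2_norm (\<lambda>k. (\<Sum>i<m + 2. E (S i) u k) - E (\<Union>i. S i) u k)) \<longlonglongrightarrow> 0"
    by (rule LIMSEQ_ignore_initial_segment[OF E_countable[OF S u]])
  ultimately have "ell2_norm v = 0" by (simp add: LIMSEQ_const_iff)
  from ell2_norm_zero[OF v this, of n] show ?thesis by (simp add: v_def)
qed

lemma E_Int:
  assumes AB: "A \<in> sets borel" "B \<in> sets borel" and u: "u \<in> ell2"
  shows "E A (E B u) n = E (A \<inter> B) u n"
proof -
  have s: "A \<inter> B \<in> sets borel" "B - A \<in> sets borel" "A - B \<in> sets borel" using AB by auto
  have "B = (A \<inter> B) \<union> (B - A)" by auto
  then have "E B u k = 1 * E (A \<inter> B) u k + 1 * E (B - A) u k" for k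
    using E_Un_disjoint[OF s(1,2) _ u, of k] by fastforce
  then have "E B u = (\<lambda>k. 1 * E (A \<inter> B) u k + 1 * E (B - A) u k)" by (rule ext)
  then have "E A (E B u) = (\<lambda>k. 1 * E A (E (A \<inter> B) u) k + 1 * E A (E (B - A) u) k)"
    using E_lin[OF AB(1) E_ell2[OF s(1) u] E_ell2[OF s(2) u], of 1 1] by simp
  then have 1: "E A (E B u) n = E A (E (A \<inter> B) u) n"
    using E_disjoint[OF AB(1) s(2) _ u, of n] by auto
  define v where "v = E (A \<inter> B) u"
  have v: "v \<in> ell2" unfolding v_def by (rule E_ell2[OF s(1) u])
  have "A = (A \<inter> B) \<union> (A - B)" by auto
  then have "E A v n = E (A \<inter> B) v n + E (A - B) v n"
    using E_Un_disjoint[OF s(1,3) _ v, of n] by fastforce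
  also have "E (A \<inter> B) v = v" unfolding v_def by (rule E_idem[OF s(1) u])
  also have "E (A - B) v n = 0" unfolding v_def by (rule E_disjoint[OF s(3,1) _ u]) auto
  finally show ?thesis using 1 unfolding v_def by simp
qed

lemma mu_polarization:
  assumes x: "x \<in> ell2" and y: "y \<in> ell2" and A: "A \<in> sets borel"
  shows "measure (mu (\<lambda>k. x k + y k)) A - measure (mu (\<lambda>k. x k - y k)) A = 4 * Re (ell2_inner x (E A y))"
proof -
  note p = ell2_form_polarization[OF x y E_ell2[OF A] E_lin[OF A x y]]
  have "measure (mu u) A = Re (ell2_inner u (E A u))" if "u \<in> ell2" for u
    using E_norm[OF A that] by (simp add: measure_mu that A)
  moreover have "ell2_inner y (E A x) = cnj (ell2_inner x (E A y))"
    unfolding E_sym[OF A y x] by (rule ell2_inner_cnj[OF x E_ell2[OF A y]])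
  ultimately show ?thesis using p by simp
qed

end

section \<open>Orthogonal polynomials as spectral densities\<close>

locale jacobi_resolution = jacobi_coeffs + resolution "jacobi_op a b" E for E
begin

lemma jacobi_op_ell2:
  assumes u: "u \<in> ell2" shows "jacobi_op a b u \<in> ell2"
proof -
  have u0: "u 0 = 0" using u by (simp add: ell2_def)
  have dom: "v \<in> ell2"
    if "v 0 = 0" "\<And>k. cmod (v k) \<le> (M + 1) * cmod (u (r k))" "summable (\<lambda>k. (cmod (u (r k)))\<^sup>2)" for v r
  proof -
    have "norm ((cmod (v k))\<^sup>2) \<le> (M + 1)\<^sup>2 * (cmod (u (r k)))\<^sup>2" for k
      using power_mono[OF that(2), of k 2] by (simp add: power_mult_distrib)
    from summable_comparison_test'[OF summable_mult[OF that(3)], of 0, OF this]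
    show ?thesis using that(1) by (simp add: ell2_def)
  qed
  note us = ell2_summable[OF u]
  have "summable (\<lambda>k. (cmod (u (Suc k)))\<^sup>2)"
    by (rule iffD2[OF summable_Suc_iff[of "\<lambda>k. (cmod (u k))\<^sup>2"] us])
  then have s1: "(\<lambda>k. if k = 0 then 0 else of_real (a k) * u (Suc k)) \<in> ell2"
    using M_pos by (intro dom[where r = Suc]) (auto simp: norm_mult intro!: mult_right_mono a_le)
  have "summable (\<lambda>k. (cmod (u (k - 1)))\<^sup>2)"
    using us by (subst summable_Suc_iff[symmetric]) simp
  then have s2: "(\<lambda>k. if k = 0 then 0 else of_real (a (k - 1)) * u (k - 1)) \<in> ell2"
    using M_pos by (intro dom[where r = "\<lambda>k. k - 1"]) (auto simp: norm_mult intro!: mult_right_mono a_le)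
  have "\<bar>b k\<bar> * cmod (u k) \<le> (M + 1) * cmod (u k)" for k
    using b_le[of k] u0 by (cases "k = 0") (auto intro!: mult_right_mono)
  then have s3: "(\<lambda>k. of_real (b k) * u k) \<in> ell2"
    by (intro dom[where r = "\<lambda>k. k"] us) (auto simp: norm_mult u0)
  have "jacobi_op a b u = (\<lambda>k. 1 * (1 * (if k = 0 then 0 else of_real (a k) * u (Suc k)) + 1 * (if k = 0 then 0 else of_real (a (k - 1)) * u (k - 1))) + 1 * (of_real (b k) * u k))"
    by (rule ext) (auto simp: jacobi_op_def u0)
  then show ?thesis using ell2_lin[OF ell2_lin[OF s1 s2] s3, of 1 1 1 1] by simp
qed

lemma jacobi_op_ell2_inner_delta:
  assumes y: "y \<in> ell2" and n: "n \<ge> 1"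
  shows "Re (ell2_inner y (jacobi_op a b (delta n))) = Re (jacobi_op a b y n)"
proof -
  obtain m where m: "n = Suc m" using n by (cases n) auto
  have y0: "y 0 = 0" using y by (simp add: ell2_def)
  have "ell2_inner y (jacobi_op a b (delta n)) = (\<Sum>k\<in>{m, Suc m, Suc (Suc m)}. cnj (y k) * jacobi_op a b (delta n) k)"
    unfolding ell2_inner_def
    by (rule suminf_finite) (auto simp: jacobi_op_def delta_def m)
  also have "\<dots> = cnj (y m) * of_real (a m) + cnj (y (Suc m)) * of_real (b (Suc m)) + cnj (y (Suc (Suc m))) * of_real (a (Suc m))"
    using y0 by (cases m) (auto simp: jacobi_op_def delta_def m)
  finally show ?thesis using y0 by (cases m) (auto simp: jacobi_op_def m algebra_simps)
qed

text \<open>The first moments of \<open>mu\<close> are the diagonal forms of the operator;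
  polarizing with \<open>delta n\<close> extracts the entry of \<open>jacobi_op a b y\<close> at
  site \<open>n\<close>.\<close>

lemma form_polarization:
  assumes y: "y \<in> ell2" and n: "n \<ge> 1"
  shows "(\<integral>t. t \<partial>mu (\<lambda>k. delta n k + y k)) - (\<integral>t. t \<partial>mu (\<lambda>k. delta n k - y k)) = 4 * Re (jacobi_op a b y n)"
proof -
  have lin: "jacobi_op a b (\<lambda>k. 1 * delta n k + c * y k) = (\<lambda>k. 1 * jacobi_op a b (delta n) k + c * jacobi_op a b y k)" for c
    by (rule ext) (auto simp: jacobi_op_def algebra_simps)
  note p = ell2_form_polarization[OF delta_ell2[OF n] y jacobi_op_ell2 lin]
  have "Re (ell2_inner u (jacobi_op a b u)) = (\<integral>t. t \<partial>mu u)" if "u \<in> ell2" for u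
    using res that unfolding spectral_resolution_def mu_def by simp
  then show ?thesis
    using p jacobi_op_ell2_inner_delta[OF y n] by (simp add: ell2_inner_delta)
qed

abbreviation "\<rho> \<equiv> mu (delta 1)"

lemma integrable_id: "u \<in> ell2 \<Longrightarrow> integrable (mu u) (\<lambda>t. t)"
proof -
  assume u: "u \<in> ell2"
  interpret finite_measure "mu u" by (rule finite_mu[OF u])
  have "integrable (mu u) (\<lambda>t. 1 + t\<^sup>2)"
    using res u unfolding spectral_resolution_def mu_def[symmetric] by auto
  then show ?thesis
  proof (rule Bochner_Integration.integrable_bound)
    show "AE t in mu u. norm t \<le> norm (1 + t\<^sup>2)"
    proof (rule AE_I2)
      fix t :: real
      have "2 * \<bar>t\<bar> \<le> 1 + t\<^sup>2" using sum_squares_bound[of 1 "\<bar>t\<bar>"] by simp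
      then show "norm t \<le> norm (1 + t\<^sup>2)" by simp
    qed
  qed simp
qed

lemma d1: "delta 1 \<in> ell2" by (rule delta_ell2) simp

text \<open>Both sides obey the three-term recurrence, since \<open>J\<close> acts as multiplication by \<open>t\<close>.\<close>

lemma spectral_density:
  "integrable \<rho> (\<lambda>t. fr n t) \<and> (\<forall>B\<in>sets borel. Re (E B (delta 1) n) = (\<integral>t. fr n t * indicator B t \<partial>\<rho>))"
proof (induction n rule: induct_nat_012)
  case 0
  then show ?case using E_ell2[OF _ d1] by (auto simp: ell2_def)
next
  case 1
  interpret finite_measure \<rho> by (rule finite_mu[OF d1])
  have "Re (E B (delta 1) 1) = (\<integral>t. indicator B t \<partial>\<rho>)" if B: "B \<in> sets borel" for B
    using E_norm[OF B d1] measure_mu[OF d1 B] B by (simp add: ell2_inner_delta)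
  moreover have "integrable \<rho> (\<lambda>t. 1 :: real)" by (rule integrable_const)
  ultimately show ?case by simp
next
  case (ge2 n)
  let ?m = "Suc n"
  have m: "?m \<ge> 1" by simp
  have fi: "integrable \<rho> (fr n)" "integrable \<rho> (fr ?m)" using ge2 by auto
  have T: "integrable \<rho> (\<lambda>t. fr ?m t * indicator B t * t) \<and>
     Re (jacobi_op a b (E B (delta 1)) ?m) = (\<integral>t. fr ?m t * indicator B t * t \<partial>\<rho>)" if B: "B \<in> sets borel" for B
  proof -
    define y where "y = E B (delta 1)"
    have y: "y \<in> ell2" unfolding y_def by (rule E_ell2[OF B d1])
    have xy: "(\<lambda>k. delta ?m k + y k) \<in> ell2" "(\<lambda>k. delta ?m k - y k) \<in> ell2"
      using ell2_lin[OF delta_ell2[OF m] y, of 1 1] ell2_lin[OF delta_ell2[OF m] y, of 1 "- 1"] by simp_all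
    have fB: "integrable \<rho> (\<lambda>t. fr ?m t * indicator B t)"
      using integrable_real_mult_indicator[OF _ fi(2), of B] B by simp
    \<comment> \<open>By multiplicativity of \<open>E\<close> and the induction hypothesis, the
      difference of the two measures has density \<open>4 * fr ?m\<close> on \<open>B\<close> with
      respect to \<rho>, the factor 4 coming from polarization. Integrating the function
      \<open>t\<close> against both sides then yields the operator applied to
      \<open>y\<close>.\<close>
    have id: "measure (mu (\<lambda>k. delta ?m k + y k)) A - measure (mu (\<lambda>k. delta ?m k - y k)) A
       = (\<integral>t. (4 * (fr ?m t * indicator B t)) * indicator A t \<partial>\<rho>)" if A: "A \<in> sets borel" for A
    proof -
      have "Re (ell2_inner (delta ?m) (E A y)) = Re (E (A \<inter> B) (delta 1) ?m)"
        unfolding ell2_inner_delta y_def E_Int[OF A B d1] ..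
      also have "\<dots> = (\<integral>t. fr ?m t * indicator (A \<inter> B) t \<partial>\<rho>)" using ge2 A B by auto
      also have "\<dots> = (\<integral>t. fr ?m t * indicator B t * indicator A t \<partial>\<rho>)"
        by (intro Bochner_Integration.integral_cong) (auto split: split_indicator)
      finally have "4 * Re (ell2_inner (delta ?m) (E A y)) = (\<integral>t. 4 * (fr ?m t * indicator B t * indicator A t) \<partial>\<rho>)"
        by simp
      then show ?thesis unfolding mu_polarization[OF delta_ell2[OF m] y A] by (simp only: mult.assoc)
    qed
    have f4: "integrable \<rho> (\<lambda>t. 4 * (fr ?m t * indicator B t))" using fB by simp
    note I = integral_measure_identity[OF finite_mu[OF xy(1)] finite_mu[OF xy(2)] sets_mu sets_mu sets_mu f4 id
        integrable_id[OF xy(1)] integrable_id[OF xy(2)]]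
    have "integrable \<rho> (\<lambda>t. 4 * (fr ?m t * indicator B t * t))" using I(1) by (simp only: mult.assoc)
    then have i: "integrable \<rho> (\<lambda>t. fr ?m t * indicator B t * t)" by simp
    have "4 * Re (jacobi_op a b y ?m) = (\<integral>t. 4 * (fr ?m t * indicator B t * t) \<partial>\<rho>)"
      using I(2) unfolding form_polarization[OF y m] by (simp only: mult.assoc)
    then show ?thesis using i unfolding y_def by simp
  qed
  have frs: "fr (Suc ?m) t = (t * fr ?m t - b ?m * fr ?m t - a n * fr n t) / a ?m" for t
    using fr_rec[of n t] by (simp add: field_simps)
  have tf: "integrable \<rho> (\<lambda>t. t * fr ?m t)" using T[of UNIV] by (simp add: mult.commute)
  have int: "integrable \<rho> (\<lambda>t. fr (Suc ?m) t)" unfolding frs using tf fi by auto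
  have "Re (E B (delta 1) (Suc ?m)) = (\<integral>t. fr (Suc ?m) t * indicator B t \<partial>\<rho>)" if B: "B \<in> sets borel" for B
  proof -
    have z0: "E B (delta 1) 0 = 0" using E_ell2[OF B d1] by (simp add: ell2_def)
    have i: "integrable \<rho> (\<lambda>t. fr n t * indicator B t)" "integrable \<rho> (\<lambda>t. fr ?m t * indicator B t)"
      using integrable_real_mult_indicator[OF _ fi(1), of B] integrable_real_mult_indicator[OF _ fi(2), of B] B by auto
    have "Re (jacobi_op a b (E B (delta 1)) ?m) = a ?m * Re (E B (delta 1) (Suc ?m)) + a n * Re (E B (delta 1) n) + b ?m * Re (E B (delta 1) ?m)"
      using z0 by (simp add: jacobi_op_def)
    then have "a ?m * Re (E B (delta 1) (Suc ?m)) = (\<integral>t. fr ?m t * indicator B t * t \<partial>\<rho>) - a n * (\<integral>t. fr n t * indicator B t \<partial>\<rho>) - b ?m * (\<integral>t. fr ?m t * indicator B t \<partial>\<rho>)"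
      using T[OF B] ge2 B by simp
    also have "\<dots> = (\<integral>t. fr ?m t * indicator B t * t - a n * (fr n t * indicator B t) - b ?m * (fr ?m t * indicator B t) \<partial>\<rho>)"
      using T[OF B] i by simp
    also have "\<dots> = (\<integral>t. a ?m * (fr (Suc ?m) t * indicator B t) \<partial>\<rho>)"
      by (intro Bochner_Integration.integral_cong) (auto simp: frs field_simps)
    finally show ?thesis by simp
  qed
  then show ?case using int by blast
qed

text \<open>Split the line by the sign of \<open>fr n\<close>. On each part the integral is the real
  part of an entry of a projection of \<open>delta 1\<close>, at most 1 in modulus by
  Cauchy-Schwarz.\<close>

lemma integral_abs_fr: "(\<integral>\<^sup>+t. ennreal \<bar>fr n t\<bar> \<partial>\<rho>) \<le> 2"
proof (cases "n \<ge> 1")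
  case True
  have i: "integrable \<rho> (fr n)" using spectral_density[of n] by blast
  have m: "fr n \<in> borel_measurable borel"
    using borel_measurable_integrable[OF i] measurable_cong_sets[OF sets_mu refl] by blast
  have bd: "\<bar>Re (E B (delta 1) n)\<bar> \<le> 1" if B: "B \<in> sets borel" for B
  proof -
    have e: "E B (delta 1) \<in> ell2" by (rule E_ell2[OF B d1])
    interpret finite_measure \<rho> by (rule finite_mu[OF d1])
    have U: "UNIV \<in> sets (borel :: real measure)" by simp
    have "measure \<rho> B \<le> measure \<rho> UNIV" using B by (intro finite_measure_mono) auto
    then have "(ell2_norm (E B (delta 1)))\<^sup>2 \<le> (ell2_norm (E UNIV (delta 1)))\<^sup>2"
      by (simp only: measure_mu[OF d1 B] measure_mu[OF d1 U])
    then have "(ell2_norm (E B (delta 1)))\<^sup>2 \<le> 1\<^sup>2"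
      by (simp only: E_UNIV[OF d1] ell2_norm_delta[OF order_refl])
    then have n1: "ell2_norm (E B (delta 1)) \<le> 1" by (rule power2_le_imp_le) simp
    have "\<bar>Re (E B (delta 1) n)\<bar> \<le> cmod (ell2_inner (delta n) (E B (delta 1)))"
      unfolding ell2_inner_delta by (rule abs_Re_le_cmod)
    also have "\<dots> \<le> ell2_norm (delta n) * ell2_norm (E B (delta 1))"
      by (rule ell2_cauchy_schwarz[OF delta_ell2[OF True] e])
    finally show ?thesis using n1 ell2_norm_delta[OF True] by simp
  qed
  define B where "B = {t. fr n t \<ge> 0}"
  have B: "B \<in> sets borel" "- B \<in> sets borel" unfolding B_def using m by auto
  have iB: "integrable \<rho> (\<lambda>t. fr n t * indicator B t)" "integrable \<rho> (\<lambda>t. fr n t * indicator (- B) t)"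
    using integrable_real_mult_indicator[OF _ i, of B] integrable_real_mult_indicator[OF _ i, of "- B"] B by auto
  have "(\<integral>t. \<bar>fr n t\<bar> \<partial>\<rho>) = (\<integral>t. fr n t * indicator B t - fr n t * indicator (- B) t \<partial>\<rho>)"
    by (intro Bochner_Integration.integral_cong) (auto simp: B_def split: split_indicator)
  also have "\<dots> = Re (E B (delta 1) n) - Re (E (- B) (delta 1) n)"
    using iB B spectral_density[of n] by simp
  also have "\<dots> \<le> 2" using bd[OF B(1)] bd[OF B(2)] by linarith
  finally have "(\<integral>t. \<bar>fr n t\<bar> \<partial>\<rho>) \<le> 2" .
  moreover have "(\<integral>\<^sup>+t. ennreal \<bar>fr n t\<bar> \<partial>\<rho>) = ennreal (\<integral>t. \<bar>fr n t\<bar> \<partial>\<rho>)"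
    by (rule nn_integral_eq_integral) (use i in auto)
  ultimately show ?thesis using ennreal_leI[of _ 2] by simp
next
  case False
  then have "n = 0" by simp
  then show ?thesis by simp
qed

lemma fr_measurable [measurable]: "fr n \<in> borel_measurable borel"
  using borel_measurable_integrable[OF spectral_density[THEN conjunct1]] measurable_cong_sets[OF sets_mu refl] by blast

text \<open>The weights are summable, so the uniform \<open>L^1\<close> bound makes this series
  finite \<rho>-almost everywhere; where it is finite, \<open>fr n t\<close> is bounded by a
  multiple of \<open>(n + 1)^2\<close>.\<close>

definition regular_points :: "real set" where
  "regular_points = {t. (\<Sum>n. ennreal (inverse ((real (Suc n))\<^sup>2)) * ennreal \<bar>fr n t\<bar>) \<noteq> \<infinity>}"

lemma regular_points_borel: "regular_points \<in> sets borel"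
  unfolding regular_points_def by measurable

lemma regular_points_null: "emeasure \<rho> (- regular_points) = 0"
proof -
  let ?c = "\<lambda>n. inverse ((real (Suc n))\<^sup>2)"
  have "summable (\<lambda>n. inverse ((real n)\<^sup>2))" by (rule inverse_power_summable) simp
  from summable_ignore_initial_segment[OF this, of 1] have sm: "summable ?c"
    unfolding Suc_eq_plus1 .
  have "(\<integral>\<^sup>+t. (\<Sum>n. ennreal (?c n) * ennreal \<bar>fr n t\<bar>) \<partial>\<rho>) = (\<Sum>n. \<integral>\<^sup>+t. ennreal (?c n) * ennreal \<bar>fr n t\<bar> \<partial>\<rho>)"
    by (rule nn_integral_suminf) measurable
  also have "\<dots> = (\<Sum>n. ennreal (?c n) * (\<integral>\<^sup>+t. ennreal \<bar>fr n t\<bar> \<partial>\<rho>))"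
    by (intro suminf_cong nn_integral_cmult) measurable
  also have "\<dots> \<le> (\<Sum>n. ennreal (?c n) * 2)"
    by (intro suminf_le mult_left_mono integral_abs_fr) auto
  also have "\<dots> = (\<Sum>n. ennreal (?c n * 2))" by (simp add: ennreal_mult'')
  also have "\<dots> = ennreal (\<Sum>n. ?c n * 2)"
    by (rule suminf_ennreal2[OF _ summable_mult2[OF sm]]) simp
  finally have "(\<integral>\<^sup>+t. (\<Sum>n. ennreal (?c n) * ennreal \<bar>fr n t\<bar>) \<partial>\<rho>) \<noteq> \<infinity>" by (auto simp: top_unique)
  then have "AE t in \<rho>. (\<Sum>n. ennreal (?c n) * ennreal \<bar>fr n t\<bar>) \<noteq> \<infinity>"
    by (intro nn_integral_noteq_infinite) measurable
  moreover have "(AE t in \<rho>. (\<Sum>n. ennreal (?c n) * ennreal \<bar>fr n t\<bar>) \<noteq> \<infinity>) \<longleftrightarrow> emeasure \<rho> (- regular_points) = 0"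
    by (rule AE_iff_measurable) (use regular_points_borel in \<open>auto simp: regular_points_def\<close>)
  ultimately show ?thesis by blast
qed

lemma regular_points_bound:
  assumes "t \<in> regular_points"
  shows "\<exists>C>0. \<forall>n. \<bar>fr n t\<bar> \<le> C * (real (Suc n))\<^sup>2"
proof -
  let ?c = "\<lambda>n. inverse ((real (Suc n))\<^sup>2)"
  obtain S where S: "(\<Sum>n. ennreal (?c n) * ennreal \<bar>fr n t\<bar>) = ennreal S" "S \<ge> 0"
    using assms unfolding regular_points_def
    by (cases "\<Sum>n. ennreal (?c n) * ennreal \<bar>fr n t\<bar>") auto
  have "\<bar>fr n t\<bar> \<le> (S + 1) * (real (Suc n))\<^sup>2" for n
  proof -
    have "(\<Sum>k\<in>{n}. ennreal (?c k) * ennreal \<bar>fr k t\<bar>) \<le> (\<Sum>k. ennreal (?c k) * ennreal \<bar>fr k t\<bar>)"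
      by (rule sum_le_suminf) auto
    then have "ennreal (?c n * \<bar>fr n t\<bar>) \<le> ennreal S" unfolding S(1) by (simp add: ennreal_mult)
    then have "?c n * \<bar>fr n t\<bar> \<le> S + 1" using S(2) by (subst (asm) ennreal_le_iff) auto
    then show ?thesis by (simp add: field_simps del: of_nat_Suc)
  qed
  then show ?thesis using S(2) by (intro exI[of _ "S + 1"]) auto
qed

end

section \<open>The absolutely continuous spectrum\<close>

text \<open>Layer-cake formula \<open>ln (\<epsilon> / d) = \<integral>\<^bsub>d\<^esub>\<^bsup>\<epsilon>\<^esup> dh / h\<close> and Tonelli avoid an improper integral.\<close>

lemma pot_kernel_local_integral:
  assumes e: "\<epsilon> > 0"
  shows "(\<integral>\<^sup>+t. pot_kernel \<epsilon> t s * indicator {s - \<epsilon>..s + \<epsilon>} t \<partial>lborel) \<le> ennreal (2 * \<epsilon>)"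
proof -
  have ind: "indicator {\<bar>t - s\<bar>..\<epsilon>} h = (if \<bar>t - s\<bar> \<le> h \<and> h \<le> \<epsilon> then 1 else 0 :: ennreal)" for t h
    by (auto split: split_indicator)
  have m: "(\<lambda>(t, h). ennreal (1 / h) * indicator {\<bar>t - s\<bar>..\<epsilon>} h) \<in> borel_measurable (lborel \<Otimes>\<^sub>M lborel)"
    unfolding ind by measurable
  have "(\<integral>\<^sup>+t. pot_kernel \<epsilon> t s * indicator {s - \<epsilon>..s + \<epsilon>} t \<partial>lborel) = (\<integral>\<^sup>+t. (\<integral>\<^sup>+h. ennreal (1 / h) * indicator {\<bar>t - s\<bar>..\<epsilon>} h \<partial>lborel) \<partial>lborel)"
  proof (rule nn_integral_cong_AE)
    have "AE t in lborel. t \<noteq> s" by (rule AE_lborel_singleton)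
    then show "AE t in lborel. pot_kernel \<epsilon> t s * indicator {s - \<epsilon>..s + \<epsilon>} t = (\<integral>\<^sup>+h. ennreal (1 / h) * indicator {\<bar>t - s\<bar>..\<epsilon>} h \<partial>lborel)"
    proof eventually_elim
      case (elim t)
      define d where "d = \<bar>t - s\<bar>"
      have d: "d > 0" using elim by (simp add: d_def)
      show ?case
      proof (cases "d \<le> \<epsilon>")
        case True
        have "(\<integral>\<^sup>+h. ennreal (1 / h) * indicator {d..\<epsilon>} h \<partial>lborel) = ennreal (ln \<epsilon> - ln d)"
        proof (rule nn_integral_FTC_Icc)
          fix h assume h: "h \<in> {d..\<epsilon>}"
          show "(ln has_real_derivative 1 / h) (at h)" using h d by (auto intro!: derivative_eq_intros)
          show "0 \<le> 1 / h" using h d by simp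
        qed (use True in auto)
        moreover have "t \<in> {s - \<epsilon>..s + \<epsilon>}" using True by (auto simp: d_def)
        ultimately show ?thesis using elim d e by (simp add: pot_kernel_def ln_div flip: d_def)
      next
        case False
        then have "t \<notin> {s - \<epsilon>..s + \<epsilon>}" by (auto simp: d_def abs_if split: if_splits)
        then show ?thesis using False by (simp flip: d_def)
      qed
    qed
  qed
  also have "\<dots> = (\<integral>\<^sup>+h. (\<integral>\<^sup>+t. ennreal (1 / h) * indicator {\<bar>t - s\<bar>..\<epsilon>} h \<partial>lborel) \<partial>lborel)"
    by (rule lborel_pair.Fubini'[symmetric]) (use m in simp)
  also have "\<dots> \<le> (\<integral>\<^sup>+h. 2 * indicator {0..\<epsilon>} h \<partial>lborel)"
  proof (rule nn_integral_mono)
    fix h :: real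
    have "(\<integral>\<^sup>+t. ennreal (1 / h) * indicator {\<bar>t - s\<bar>..\<epsilon>} h \<partial>lborel) \<le> (\<integral>\<^sup>+t. (ennreal (1 / h) * indicator {0..\<epsilon>} h) * indicator {s - h..s + h} t \<partial>lborel)"
      by (rule nn_integral_mono) (auto split: split_indicator)
    also have "\<dots> = (ennreal (1 / h) * indicator {0..\<epsilon>} h) * emeasure lborel {s - h..s + h}"
      by (simp add: nn_integral_cmult_indicator)
    also have "\<dots> \<le> 2 * indicator {0..\<epsilon>} h"
    proof (cases "h > 0")
      case True
      then show ?thesis by (auto split: split_indicator simp: emeasure_lborel_Icc_eq ennreal_mult[symmetric])
    next
      case False
      then show ?thesis by (auto split: split_indicator simp: emeasure_lborel_Icc_eq)
    qed
    finally show "(\<integral>\<^sup>+t. ennreal (1 / h) * indicator {\<bar>t - s\<bar>..\<epsilon>} h \<partial>lborel) \<le> 2 * indicator {0..\<epsilon>} h" .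
  qed
  also have "\<dots> = ennreal (2 * \<epsilon>)"
    using e by (simp add: nn_integral_cmult_indicator emeasure_lborel_Icc_eq ennreal_mult)
  finally show ?thesis .
qed

text \<open>Truncating the distance at \<epsilon> separates a bounded kernel, continuous in
  \<open>s\<close> and accessible to weak convergence, from a singular part living on
  \<open>\<bar>t - s\<bar> \<le> \<epsilon>\<close>, whose Lebesgue integral
  \<open>pot_kernel_local_integral\<close> makes small.\<close>

lemma pot_kernel_split:
  assumes "\<bar>t - s\<bar> \<le> D" "0 < \<epsilon>" "\<epsilon> \<le> D"
  shows "pot_kernel D t s \<le> ennreal (ln (D / max \<bar>t - s\<bar> \<epsilon>)) + pot_kernel \<epsilon> t s * indicator {s - \<epsilon>..s + \<epsilon>} t"
    "ennreal (ln (D / max \<bar>t - s\<bar> \<epsilon>)) \<le> pot_kernel D t s"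
    "0 \<le> ln (D / max \<bar>t - s\<bar> \<epsilon>)" "ln (D / max \<bar>t - s\<bar> \<epsilon>) \<le> ln (D / \<epsilon>)"
proof -
  have mx: "max \<bar>t - s\<bar> \<epsilon> > 0" "max \<bar>t - s\<bar> \<epsilon> \<le> D" using assms by auto
  show nn: "0 \<le> ln (D / max \<bar>t - s\<bar> \<epsilon>)" using mx by simp
  show "ln (D / max \<bar>t - s\<bar> \<epsilon>) \<le> ln (D / \<epsilon>)"
    using assms mx by (intro ln_mono divide_left_mono mult_pos_pos divide_pos_pos) auto
  show "ennreal (ln (D / max \<bar>t - s\<bar> \<epsilon>)) \<le> pot_kernel D t s"
  proof (cases "t = s")
    case False
    have "ln (D / max \<bar>t - s\<bar> \<epsilon>) \<le> ln (D / \<bar>t - s\<bar>)"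
      using False assms mx by (intro ln_mono divide_left_mono mult_pos_pos divide_pos_pos) auto
    then show ?thesis using False by (simp add: pot_kernel_def ennreal_leI)
  qed (simp add: pot_kernel_def)
  show "pot_kernel D t s \<le> ennreal (ln (D / max \<bar>t - s\<bar> \<epsilon>)) + pot_kernel \<epsilon> t s * indicator {s - \<epsilon>..s + \<epsilon>} t"
  proof (cases "\<bar>t - s\<bar> < \<epsilon>")
    case True
    then have ind: "indicator {s - \<epsilon>..s + \<epsilon>} t = (1::ennreal)" by (auto simp: abs_if split: split_indicator if_splits)
    show ?thesis
    proof (cases "t = s")
      case False
      have "ln (D / \<bar>t - s\<bar>) = ln (D / max \<bar>t - s\<bar> \<epsilon>) + ln (\<epsilon> / \<bar>t - s\<bar>)"
        using True False assms by (simp add: ln_div max_def)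
      moreover have "0 \<le> ln (\<epsilon> / \<bar>t - s\<bar>)" using True False by simp
      ultimately show ?thesis using False nn unfolding ind by (simp add: pot_kernel_def)
    next
      case True
      then show ?thesis unfolding ind pot_kernel_def by simp
    qed
  next
    case False
    then have "t \<noteq> s" "max \<bar>t - s\<bar> \<epsilon> = \<bar>t - s\<bar>" using assms by (auto intro!: max_absorb1)
    then show ?thesis by (simp add: pot_kernel_def)
  qed
qed

section \<open>Vanishing of gamma at almost every regular point\<close>

locale jacobi_full = jacobi_limit + jacobi_resolution
begin

definition eig_potential :: "real \<Rightarrow> nat \<Rightarrow> real \<Rightarrow> ennreal" where
  "eig_potential D n t = (\<Sum>s\<in>eigs n. pot_kernel D t s) / of_nat n"

text \<open>The product of the distances from \<open>t\<close> to the eigenvalues is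
  \<open>\<bar>fr (Suc n) t\<bar>\<close> times \<open>a 1 ... a n\<close>. Polynomial growth of the
  first factor is lost after taking logarithms and dividing by \<open>n\<close>, and the second
  contributes \<open>ln A\<close>. If \<open>t\<close> is itself an eigenvalue, the potential is
  infinite.\<close>

lemma eig_potential_liminf_ge:
  assumes t: "t \<in> regular_points" and D: "D > 0"
  shows "ennreal (ln D - ln A) \<le> liminf (\<lambda>j. eig_potential D (N j) t)"
proof -
  obtain C where C: "C > 0" "\<And>n. \<bar>fr n t\<bar> \<le> C * (real (Suc n))\<^sup>2"
    using regular_points_bound[OF t] by blast
  \<comment> \<open>The term \<open>n + 2\<close> appears because the growth bound
    \<open>C * (real (Suc k))^2\<close> is used at \<open>k = Suc n\<close>.\<close>
  define y where "y n = ln D - (ln C + 2 * ln (real n + 2)) / n - (\<Sum>k=1..n. ln (a k)) / n" for n :: nat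
  have lower: "ennreal (y n) \<le> eig_potential D n t" if n: "n \<ge> 1" for n
  proof (cases "t \<in> eigs n")
    case True
    then have "(\<Sum>s\<in>eigs n. pot_kernel D t s) = \<top>"
      by (simp add: pot_kernel_def sum.remove[OF finite_eigs True])
    then have "eig_potential D n t = \<top> / of_nat n" unfolding eig_potential_def by (simp only:)
    then show ?thesis by (simp add: ennreal_top_divide)
  next
    case False
    have ne: "t - s \<noteq> 0" if "s \<in> eigs n" for s using that False by auto
    have fnz: "fr (Suc n) t \<noteq> 0" using False by (simp add: eigs_def)
    have "(\<Sum>s\<in>eigs n. ln \<bar>t - s\<bar>) = ln (\<Prod>s\<in>eigs n. \<bar>t - s\<bar>)"
      using ne by (intro ln_prod[symmetric]) auto
    also have "(\<Prod>s\<in>eigs n. \<bar>t - s\<bar>) = \<bar>fr (Suc n) t\<bar> * (\<Prod>k=1..n. a k)"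
      unfolding fr_prod abs_divide abs_of_pos[OF prod_a_pos] abs_prod using prod_a_pos[of n] by simp
    also have "ln \<dots> = ln \<bar>fr (Suc n) t\<bar> + (\<Sum>k=1..n. ln (a k))"
      using fnz prod_a_pos[of n] by (simp add: ln_mult ln_prod)
    finally have sl: "(\<Sum>s\<in>eigs n. ln \<bar>t - s\<bar>) = ln \<bar>fr (Suc n) t\<bar> + (\<Sum>k=1..n. ln (a k))" .
    have "ln \<bar>fr (Suc n) t\<bar> \<le> ln (C * (real n + 2)\<^sup>2)"
      using C(2)[of "Suc n"] fnz by (intro ln_mono) (auto simp: algebra_simps)
    also have "\<dots> = ln C + 2 * ln (real n + 2)" using C(1) by (simp add: ln_mult ln_realpow)
    finally have "y n \<le> (\<Sum>s\<in>eigs n. ln (D / \<bar>t - s\<bar>)) / n"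
    proof -
      assume l: "ln \<bar>fr (Suc n) t\<bar> \<le> ln C + 2 * ln (real n + 2)"
      have "(\<Sum>s\<in>eigs n. ln (D / \<bar>t - s\<bar>)) = (\<Sum>s\<in>eigs n. ln D - ln \<bar>t - s\<bar>)"
        using ne D by (intro sum.cong) (auto simp: ln_div)
      also have "\<dots> = n * ln D - (ln \<bar>fr (Suc n) t\<bar> + (\<Sum>k=1..n. ln (a k)))"
        by (simp add: sum_subtractf sl)
      finally have eq: "(\<Sum>s\<in>eigs n. ln (D / \<bar>t - s\<bar>)) / n = ln D - ln \<bar>fr (Suc n) t\<bar> / n - (\<Sum>k=1..n. ln (a k)) / n"
        using n by (simp add: diff_divide_distrib add_divide_distrib)
      show ?thesis unfolding eq y_def using divide_right_mono[OF l, of "real n"] by simp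
    qed
    then have "ennreal (y n) \<le> ennreal ((\<Sum>s\<in>eigs n. ln (D / \<bar>t - s\<bar>)) / n)" by (rule ennreal_leI)
    also have "\<dots> = ennreal (\<Sum>s\<in>eigs n. ln (D / \<bar>t - s\<bar>)) / of_nat n"
      using n by (simp add: ennreal_of_nat_eq_real_of_nat divide_ennreal_def ennreal_mult' divide_inverse inverse_ennreal mult.commute)
    also have "\<dots> \<le> eig_potential D n t"
      unfolding eig_potential_def
    proof (rule divide_right_mono_ennreal)
      have "ennreal (\<Sum>s\<in>eigs n. ln (D / \<bar>t - s\<bar>)) \<le> ennreal (\<Sum>s\<in>eigs n. max 0 (ln (D / \<bar>t - s\<bar>)))"
        by (intro ennreal_leI sum_mono) simp
      also have "\<dots> = (\<Sum>s\<in>eigs n. ennreal (max 0 (ln (D / \<bar>t - s\<bar>))))" by (rule sum_ennreal[symmetric]) simp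
      also have "\<dots> = (\<Sum>s\<in>eigs n. pot_kernel D t s)"
        using ne by (intro sum.cong) (auto simp: pot_kernel_def max_def ennreal_neg)
      finally show "ennreal (\<Sum>s\<in>eigs n. ln (D / \<bar>t - s\<bar>)) \<le> (\<Sum>s\<in>eigs n. pot_kernel D t s)" .
    qed
    finally show ?thesis .
  qed
  have lnN: "(\<lambda>n::nat. (ln C + 2 * ln (real n + 2)) / n) \<longlonglongrightarrow> 0" by real_asymp
  have "(\<lambda>j. y (N j)) \<longlonglongrightarrow> ln D - 0 - ln A"
    unfolding y_def by (intro tendsto_diff tendsto_const filterlim_compose[OF lnN N_top] ln_a_limit)
  then have "(\<lambda>j. ennreal (y (N j))) \<longlonglongrightarrow> ennreal (ln D - ln A)" by (intro tendsto_ennrealI) simp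
  then have "ennreal (ln D - ln A) = liminf (\<lambda>j. ennreal (y (N j)))" by (simp add: lim_imp_Liminf)
  also have "\<dots> \<le> liminf (\<lambda>j. eig_potential D (N j) t)"
    by (rule Liminf_mono) (use ev_N in eventually_elim, rule lower)
  finally show ?thesis .
qed

lemma eig_potential_measurable [measurable]: "eig_potential D n \<in> borel_measurable borel"
  unfolding eig_potential_def by measurable

text \<open>Boundedness of \<open>S\<close> gives finite Lebesgue measure and a single
  \<open>D\<close> valid for all its points; \<open>gamma_zero_AE\<close> then exhausts the line by
  bounded intervals.\<close>

lemma gamma_zero_on_regular:
  assumes S: "S \<in> sets borel" "S \<subseteq> regular_points" "S \<subseteq> {-r..r}"
  shows "AE t in lborel. t \<in> S \<longrightarrow> gamma_bdry w t = 0"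
proof -
  define D where "D = \<bar>r\<bar> + specR + 1"
  have D: "D \<ge> 1" using specR_pos by (simp add: D_def)
  have tD: "\<bar>t\<bar> + specR + 1 \<le> D" if "t \<in> S" for t
  proof -
    have "t \<in> {-r..r}" using that S(3) by blast
    then show ?thesis by (auto simp: D_def)
  qed
  have dist: "\<bar>t - s\<bar> \<le> D" if "t \<in> S" "\<bar>s\<bar> \<le> specR" for s t using tD[OF that(1)] that(2) by linarith
  define L where "L = ln D - ln A"
  have L: "0 \<le> L" using potential_eq[of 0 D] A_le_potential[of 0] D specR_pos by (simp add: L_def D_def)
  have Sfin: "emeasure lborel S < \<infinity>"
  proof -
    have "emeasure lborel S \<le> emeasure lborel {-r..r}" by (intro emeasure_mono S) simp
    also have "\<dots> < \<infinity>" by (simp add: emeasure_lborel_Icc_eq)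
    finally show ?thesis .
  qed
  note [measurable] = S(1)
  let ?P = "\<lambda>t. \<integral>\<^sup>+s. pot_kernel D t s \<partial>\<kappa>"
  have Pm [measurable]: "?P \<in> borel_measurable borel" by measurable
  have step: "ennreal L * emeasure lborel S \<le> (\<integral>\<^sup>+t. ?P t * indicator S t \<partial>lborel) + ennreal (2 * \<epsilon>)"
    if e: "0 < \<epsilon>" "\<epsilon> \<le> D" for \<epsilon>
  proof -
    \<comment> \<open>The truncated kernel is continuous in \<open>s\<close>, so its eigenvalue
      averages \<open>x n t\<close> converge at every \<open>t\<close>; it is bounded by
      \<open>ln (D / \<epsilon>)\<close>, which supplies the majorant on \<open>S\<close>.\<close>
    define l where "l t s = ln (D / max \<bar>t - s\<bar> \<epsilon>)" for t s
    have mx: "max \<bar>t - s\<bar> \<epsilon> > 0" for t s using e by simp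
    have lcont: "continuous_on UNIV (\<lambda>s. l t s)" for t
      unfolding l_def using mx D by (intro continuous_intros) (auto simp: less_imp_neq[OF mx, symmetric] intro!: divide_pos_pos)
    have lm [measurable]: "(\<lambda>(t, s). l t s) \<in> borel_measurable (borel \<Otimes>\<^sub>M borel)" unfolding l_def by measurable
    define x where "x n t = (\<Sum>s\<in>eigs n. l t s) / real n" for n t
    have xm [measurable]: "x n \<in> borel_measurable borel" for n unfolding x_def by measurable
    have xlim: "(\<lambda>j. x (N j) t) \<longlonglongrightarrow> (\<integral>s. l t s \<partial>\<kappa>)" for t
      unfolding x_def by (rule kappa_limit_cont[OF lcont])
    have up: "(\<integral>\<^sup>+t. eig_potential D n t * indicator S t \<partial>lborel) \<le> (\<integral>\<^sup>+t. ennreal (x n t) * indicator S t \<partial>lborel) + ennreal (2 * \<epsilon>)"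
      if n: "n \<ge> 1" for n
    proof -
      let ?c = "inverse (of_nat n) :: ennreal"
      let ?k = "\<lambda>t s. pot_kernel \<epsilon> t s * indicator {s - \<epsilon>..s + \<epsilon>} t"
      have ptw: "eig_potential D n t * indicator S t \<le> ennreal (x n t) * indicator S t + ?c * (\<Sum>s\<in>eigs n. ?k t s)" for t
      proof (cases "t \<in> S")
        case True
        have "eig_potential D n t \<le> (\<Sum>s\<in>eigs n. ennreal (l t s) + ?k t s) / of_nat n"
          unfolding eig_potential_def l_def
          by (intro divide_right_mono_ennreal sum_mono pot_kernel_split dist[OF True] e) (use eigs_bound in \<open>auto simp: less_imp_le\<close>)
        also have "\<dots> = ?c * (\<Sum>s\<in>eigs n. ennreal (l t s)) + ?c * (\<Sum>s\<in>eigs n. ?k t s)"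
          by (simp add: sum.distrib divide_ennreal_def distrib_left mult.commute)
        also have "(\<Sum>s\<in>eigs n. ennreal (l t s)) = ennreal (\<Sum>s\<in>eigs n. l t s)"
          unfolding l_def by (intro sum_ennreal pot_kernel_split(3) dist[OF True] e) (use eigs_bound in \<open>auto simp: less_imp_le\<close>)
        also have "?c * ennreal (\<Sum>s\<in>eigs n. l t s) = ennreal (x n t)"
          unfolding x_def using n
          by (simp add: ennreal_of_nat_eq_real_of_nat inverse_ennreal divide_inverse ennreal_mult' mult.commute)
        finally show ?thesis using True by simp
      qed simp
      have "(\<integral>\<^sup>+t. eig_potential D n t * indicator S t \<partial>lborel) \<le> (\<integral>\<^sup>+t. ennreal (x n t) * indicator S t + ?c * (\<Sum>s\<in>eigs n. ?k t s) \<partial>lborel)"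
        by (intro nn_integral_mono ptw)
      also have "\<dots> = (\<integral>\<^sup>+t. ennreal (x n t) * indicator S t \<partial>lborel) + ?c * (\<Sum>s\<in>eigs n. \<integral>\<^sup>+t. ?k t s \<partial>lborel)"
      proof -
        have km: "(\<lambda>t. ?k t s) \<in> borel_measurable lborel" for s by measurable
        have "(\<integral>\<^sup>+t. ennreal (x n t) * indicator S t + ?c * (\<Sum>s\<in>eigs n. ?k t s) \<partial>lborel)
            = (\<integral>\<^sup>+t. ennreal (x n t) * indicator S t \<partial>lborel) + (\<integral>\<^sup>+t. ?c * (\<Sum>s\<in>eigs n. ?k t s) \<partial>lborel)"
        proof (rule nn_integral_add)
          show "(\<lambda>t. ennreal (x n t) * indicator S t) \<in> borel_measurable lborel" by measurable
          show "(\<lambda>t. ?c * (\<Sum>s\<in>eigs n. ?k t s)) \<in> borel_measurable lborel"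
            by (intro borel_measurable_times_ennreal borel_measurable_const borel_measurable_sum km)
        qed
        also have "(\<integral>\<^sup>+t. ?c * (\<Sum>s\<in>eigs n. ?k t s) \<partial>lborel) = ?c * (\<integral>\<^sup>+t. (\<Sum>s\<in>eigs n. ?k t s) \<partial>lborel)"
          by (rule nn_integral_cmult) (intro borel_measurable_sum km)
        also have "(\<integral>\<^sup>+t. (\<Sum>s\<in>eigs n. ?k t s) \<partial>lborel) = (\<Sum>s\<in>eigs n. \<integral>\<^sup>+t. ?k t s \<partial>lborel)"
          by (rule nn_integral_sum[OF km])
        finally show ?thesis .
      qed
      \<comment> \<open>An average of \<open>n\<close> terms, each at most
        \<open>2 * \<epsilon>\<close>, so the error does not depend on \<open>n\<close>.\<close>
      also have "?c * (\<Sum>s\<in>eigs n. \<integral>\<^sup>+t. ?k t s \<partial>lborel) \<le> ?c * (\<Sum>s\<in>eigs n. ennreal (2 * \<epsilon>))"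
        by (intro mult_left_mono sum_mono pot_kernel_local_integral e) simp
      also have "\<dots> = ennreal (2 * \<epsilon>)"
        using n by (simp add: ennreal_of_nat_eq_real_of_nat inverse_ennreal ennreal_mult[symmetric] e less_imp_le)
      finally show ?thesis by (simp add: add_left_mono)
    qed
    have conv: "(\<lambda>j. \<integral>\<^sup>+t. ennreal (x (N j) t) * indicator S t \<partial>lborel) \<longlonglongrightarrow> (\<integral>\<^sup>+t. ennreal (\<integral>s. l t s \<partial>\<kappa>) * indicator S t \<partial>lborel)"
    proof (rule nn_integral_dominated_convergence[where w="\<lambda>t. ennreal (ln (D / \<epsilon>)) * indicator S t"])
      show "AE t in lborel. ennreal (x (N j) t) * indicator S t \<le> ennreal (ln (D / \<epsilon>)) * indicator S t" for j
      proof (rule AE_I2)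
        fix t
        have "x (N j) t \<le> ln (D / \<epsilon>)" if t: "t \<in> S"
        proof -
          have "(\<Sum>s\<in>eigs (N j). l t s) \<le> (\<Sum>s\<in>eigs (N j). ln (D / \<epsilon>))"
            unfolding l_def by (intro sum_mono pot_kernel_split(4) dist[OF t] e) (use eigs_bound in \<open>auto simp: less_imp_le\<close>)
          also have "\<dots> = real (N j) * ln (D / \<epsilon>)" by simp
          finally show ?thesis
            unfolding x_def using e D by (cases "N j = 0") (auto simp: divide_le_eq mult.commute)
        qed
        then show "ennreal (x (N j) t) * indicator S t \<le> ennreal (ln (D / \<epsilon>)) * indicator S t"
          by (auto split: split_indicator intro!: ennreal_leI)
      qed
      show "(\<integral>\<^sup>+t. ennreal (ln (D / \<epsilon>)) * indicator S t \<partial>lborel) < \<infinity>"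
        using Sfin by (simp add: nn_integral_cmult_indicator ennreal_mult_less_top)
      show "AE t in lborel. (\<lambda>j. ennreal (x (N j) t) * indicator S t) \<longlonglongrightarrow> ennreal (\<integral>s. l t s \<partial>\<kappa>) * indicator S t"
        using tendsto_ennrealI[OF xlim] by (intro AE_I2) (auto split: split_indicator)
    qed measurable
    have xP: "ennreal (\<integral>s. l t s \<partial>\<kappa>) \<le> ?P t" if t: "t \<in> S" for t
    proof -
      have "ennreal (\<integral>s. l t s \<partial>\<kappa>) = (\<integral>\<^sup>+s. ennreal (l t s) \<partial>\<kappa>)"
        by (rule nn_integral_eq_integral[symmetric, OF integrable_cont[OF lcont]])
           (use AE_bounded in eventually_elim, unfold l_def, rule pot_kernel_split(3)[OF dist[OF t] e])
      also have "\<dots> \<le> ?P t"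
        by (rule nn_integral_mono_AE)
           (use AE_bounded in eventually_elim, unfold l_def, rule pot_kernel_split(2)[OF dist[OF t] e])
      finally show ?thesis .
    qed
    \<comment> \<open>Fatou's lemma bounds the left side by integrals of eigenvalue potentials; the
      truncated kernel passes to the limit there, and the singular part costs
      \<open>2 * \<epsilon>\<close>.\<close>
    have "ennreal L * emeasure lborel S = (\<integral>\<^sup>+t. ennreal L * indicator S t \<partial>lborel)"
      by (simp add: nn_integral_cmult_indicator)
    also have "\<dots> \<le> (\<integral>\<^sup>+t. liminf (\<lambda>j. eig_potential D (N j) t * indicator S t) \<partial>lborel)"
    proof (rule nn_integral_mono)
      fix t
      show "ennreal L * indicator S t \<le> liminf (\<lambda>j. eig_potential D (N j) t * indicator S t)"
        using eig_potential_liminf_ge[of t D] S(2) D by (auto split: split_indicator simp: L_def)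
    qed
    also have "\<dots> \<le> liminf (\<lambda>j. \<integral>\<^sup>+t. eig_potential D (N j) t * indicator S t \<partial>lborel)"
      by (rule nn_integral_liminf) measurable
    also have "\<dots> \<le> liminf (\<lambda>j. (\<integral>\<^sup>+t. ennreal (x (N j) t) * indicator S t \<partial>lborel) + ennreal (2 * \<epsilon>))"
      by (rule Liminf_mono) (use ev_N in eventually_elim, rule up)
    also have "\<dots> = (\<integral>\<^sup>+t. ennreal (\<integral>s. l t s \<partial>\<kappa>) * indicator S t \<partial>lborel) + ennreal (2 * \<epsilon>)"
      by (intro lim_imp_Liminf tendsto_add conv tendsto_const) simp
    also have "\<dots> \<le> (\<integral>\<^sup>+t. ?P t * indicator S t \<partial>lborel) + ennreal (2 * \<epsilon>)"
      by (intro add_right_mono nn_integral_mono) (auto split: split_indicator simp: xP)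
    finally show ?thesis .
  qed
  have ineq: "ennreal L * emeasure lborel S \<le> (\<integral>\<^sup>+t. ?P t * indicator S t \<partial>lborel)"
  proof (rule ennreal_le_epsilon)
    fix e :: real assume e: "e > 0"
    define \<epsilon> where "\<epsilon> = min D (e / 2)"
    have "0 < \<epsilon>" "\<epsilon> \<le> D" "2 * \<epsilon> \<le> e" using e D by (auto simp: \<epsilon>_def)
    from step[OF this(1,2)] ennreal_leI[OF this(3)] show "ennreal L * emeasure lborel S \<le> (\<integral>\<^sup>+t. ?P t * indicator S t \<partial>lborel) + ennreal e"
      by (meson add_left_mono order_trans)
  qed
  \<comment> \<open>On \<open>S\<close> the potential and gamma are nonnegative with constant sum
    \<open>L\<close>. Since the potential alone already integrates to at least \<open>L\<close>
    times the measure of \<open>S\<close>, nothing is left for gamma.\<close>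
  have Pg: "?P t + ennreal (gamma_bdry w t) = ennreal L" if "t \<in> S" for t
  proof -
    have p: "?P t = ennreal (ln D - potential t)" "0 \<le> ln D - potential t"
      using potential_eq[OF tD[OF that]] by auto
    have "?P t + ennreal (gamma_bdry w t) = ennreal ((ln D - potential t) + gamma_bdry w t)"
      unfolding p(1) using p(2) gamma_nonneg[of t] by (rule ennreal_plus[symmetric])
    then show ?thesis unfolding gamma_eq L_def by simp
  qed
  have "(\<integral>\<^sup>+t. ?P t * indicator S t \<partial>lborel) + (\<integral>\<^sup>+t. ennreal (gamma_bdry w t) * indicator S t \<partial>lborel) = (\<integral>\<^sup>+t. ennreal L * indicator S t \<partial>lborel)"
    by (subst nn_integral_add[symmetric]) (auto intro!: nn_integral_cong simp: Pg split: split_indicator)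
  also have "\<dots> = ennreal L * emeasure lborel S" by (simp add: nn_integral_cmult_indicator)
  finally have sum: "(\<integral>\<^sup>+t. ?P t * indicator S t \<partial>lborel) + (\<integral>\<^sup>+t. ennreal (gamma_bdry w t) * indicator S t \<partial>lborel) = ennreal L * emeasure lborel S" .
  have fin: "ennreal L * emeasure lborel S \<noteq> \<infinity>" using Sfin by (simp add: ennreal_mult_eq_top_iff)
  have Pfin: "(\<integral>\<^sup>+t. ?P t * indicator S t \<partial>lborel) \<noteq> \<infinity>" using sum fin by auto
  have "(\<integral>\<^sup>+t. ?P t * indicator S t \<partial>lborel) + (\<integral>\<^sup>+t. ennreal (gamma_bdry w t) * indicator S t \<partial>lborel) \<le> (\<integral>\<^sup>+t. ?P t * indicator S t \<partial>lborel) + 0"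
    unfolding sum using ineq by simp
  then have "(\<integral>\<^sup>+t. ennreal (gamma_bdry w t) * indicator S t \<partial>lborel) = 0"
    unfolding ennreal_add_left_cancel_le using Pfin by simp
  then have "AE t in lborel. ennreal (gamma_bdry w t) * indicator S t = 0"
    by (subst (asm) nn_integral_0_iff_AE) auto
  then show ?thesis
  proof eventually_elim
    case (elim t)
    show ?case
    proof
      assume "t \<in> S"
      then have "gamma_bdry w t \<le> 0" using elim by (simp add: ennreal_eq_0_iff)
      then show "gamma_bdry w t = 0" using gamma_nonneg[of t] by linarith
    qed
  qed
qed

lemma gamma_zero_AE: "AE t in lborel. t \<in> regular_points \<longrightarrow> gamma_bdry w t = 0"
proof -
  have "AE t in lborel. \<forall>n::nat. t \<in> regular_points \<inter> {- real n..real n} \<longrightarrow> gamma_bdry w t = 0"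
    unfolding AE_all_countable
    by (intro allI gamma_zero_on_regular) (auto simp: regular_points_borel)
  then show ?thesis
  proof eventually_elim
    case (elim t)
    obtain n where "\<bar>t\<bar> \<le> real n" using real_arch_simple by blast
    then have "t \<in> {- real n..real n}" by (auto simp: abs_le_iff)
    then show ?case using elim by blast
  qed
qed

text \<open>The regular points carry all of the spectral measure, hence also its absolutely
  continuous part. Minimality of \<Sigma> puts it inside them up to a Lebesgue null set, and gamma
  vanishes at almost all of them.\<close>

lemma ac_support_subset:
  assumes ac: "ess_support_ac (spectral_measure E (delta 1)) \<Sigma>"
  shows "\<Sigma> - {t. gamma_bdry w t = 0} \<in> null_sets lborel"
proof -
  obtain \<mu>ac \<mu>s where S: "\<Sigma> \<in> sets borel" and dec: "lebesgue_decomposition (spectral_measure E (delta 1)) \<mu>ac \<mu>s"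
    and min: "\<And>T. T \<in> sets borel \<Longrightarrow> emeasure \<mu>ac (- T) = 0 \<Longrightarrow> emeasure lborel (\<Sigma> - T) = 0"
    using ac unfolding ess_support_ac_def by blast
  have "- regular_points \<in> sets borel" using regular_points_borel by auto
  then have "emeasure (spectral_measure E (delta 1)) (- regular_points) = emeasure \<mu>ac (- regular_points) + emeasure \<mu>s (- regular_points)"
    using dec unfolding lebesgue_decomposition_def by blast
  then have "emeasure \<mu>ac (- regular_points) = 0"
    using regular_points_null unfolding mu_def by simp
  from min[OF regular_points_borel this] have n1: "\<Sigma> - regular_points \<in> null_sets lborel"
    using S regular_points_borel by (auto simp: null_sets_def)
  have m: "{t. gamma_bdry w t = 0} \<in> sets borel" using gamma_measurable by measurable
  have "AE t in lborel. t \<notin> regular_points - {t. gamma_bdry w t = 0}"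
    using gamma_zero_AE by eventually_elim auto
  then have n2: "regular_points - {t. gamma_bdry w t = 0} \<in> null_sets lborel"
    using regular_points_borel m by (subst AE_iff_null_sets) auto
  have "(\<Sigma> - regular_points) \<union> (regular_points - {t. gamma_bdry w t = 0}) \<in> null_sets lborel"
    using n1 n2 by (rule null_sets.Un)
  then show ?thesis
    by (rule null_sets_subset) (use S m in auto)
qed

end

theorem theorem5p4:
  fixes a b :: "nat \<Rightarrow> real"
    and E :: "real set \<Rightarrow> cseq \<Rightarrow> cseq"
    and N :: "nat \<Rightarrow> nat"
    and w_plus w_minus g :: "complex \<Rightarrow> complex"
    and \<nu> \<kappa> :: "real measure"
    and A :: real
    and \<Sigma>ac K Z :: "real set"
  assumes "bounded_jacobi a b"
    and "spectral_resolution (jacobi_op a b) E"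
    and "ess_support_ac (spectral_measure E (delta 1)) \<Sigma>ac"
    and "filterlim N at_top sequentially"
    and "herglotz w_plus" and "locally_uniform_limit (\<lambda>j. w_plus_avg a b (N j)) w_plus"
    and "herglotz w_minus" and "locally_uniform_limit (\<lambda>j. w_minus_avg a b (N j)) w_minus"
    and "herglotz g" and "locally_uniform_limit (\<lambda>j. g_avg a b (N j)) g"
    and "prob_space \<nu>" and "sets \<nu> = sets borel"
    and "weak_star_tendsto (\<lambda>j. nu_avg E (N j)) \<nu>"
    and "prob_space \<kappa>" and "sets \<kappa> = sets borel"
    and "weak_star_tendsto (\<lambda>j. eigenvalue_dist a b (N j)) \<kappa>"
    and "(\<lambda>j. root (N j) (\<Prod>n=1..N j. a n)) \<longlonglongrightarrow> A" and "A > 0"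
    and "K = topological_support (dk_measure w_plus)"
    and "Z = {t. gamma_bdry w_plus t = 0}"
  shows "\<Sigma>ac - Z \<in> null_sets lborel
    \<and> ess_closure \<Sigma>ac \<subseteq> ess_closure Z
    \<and> ess_closure Z \<subseteq> K
    \<and> K \<subseteq> cap_closure (real_spectrum (jacobi_op a b))
    \<and> log_capacity Z \<le> ennreal A
    \<and> ennreal A \<le> log_capacity K"
proof -
  obtain M where M: "M > 0" "\<And>n. n \<ge> 1 \<Longrightarrow> inverse (M + 1) \<le> a n \<and> a n \<le> M + 1 \<and> \<bar>b n\<bar> \<le> M" and a0: "a 0 = 1"
    using assms(1) unfolding bounded_jacobi_def by blast
  have coeffs: "jacobi_coeffs a b M"
  proof
    show "a 0 = 1" "M > 0" by (fact a0 M(1))+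
    show "inverse (M + 1) \<le> a n" "a n \<le> M + 1" "\<bar>b n\<bar> \<le> M" if "n \<ge> 1" for n
      using M(2)[OF that] by blast+
  qed
  interpret jacobi_full a b M N w_plus \<kappa> A E
    by (intro jacobi_full.intro jacobi_limit.intro jacobi_limit_axioms.intro
        jacobi_resolution.intro resolution.intro coeffs assms)
  have Z: "Z = {t. gamma_bdry w_plus t = 0}" by (fact assms(20))
  have K: "K = supp" unfolding assms(19) dk_eq ..
  have null: "\<Sigma>ac - Z \<in> null_sets lborel"
    unfolding Z by (rule ac_support_subset[OF assms(3)])
  have Zs [measurable]: "Z \<in> sets borel" unfolding Z by measurable
  have S [measurable]: "\<Sigma>ac \<in> sets borel" using assms(3) by (simp add: ess_support_ac_def)
  have "ess_closure \<Sigma>ac \<subseteq> ess_closure Z"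
    unfolding ess_closure_def
  proof (intro subsetI CollectI allI impI)
    fix x h :: real
    assume x: "x \<in> {x. \<forall>h>0. 0 < emeasure lborel (\<Sigma>ac \<inter> {x - h<..<x + h})}" and h: "h > 0"
    let ?I = "{x - h<..<x + h}"
    \<comment> \<open>Essential closures ignore null sets, so inclusion up to a null set is
      enough.\<close>
    have "emeasure lborel (\<Sigma>ac \<inter> ?I) \<le> emeasure lborel (Z \<inter> ?I \<union> (\<Sigma>ac - Z))"
      by (rule emeasure_mono) auto
    also have "\<dots> = emeasure lborel (Z \<inter> ?I)"
      by (rule emeasure_Un_null_set[OF _ null]) auto
    finally show "0 < emeasure lborel (Z \<inter> ?I)" using x h by (auto intro: less_le_trans)
  qed
  moreover have "ess_closure Z \<subseteq> K" unfolding Z K by (rule ess_closure_zero_subset)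
  moreover have "K \<subseteq> cap_closure (real_spectrum (jacobi_op a b))"
    unfolding K cap_closure_def
    by (intro subsetI CollectI allI impI capacity_pos_near_supp[OF _ supp_subset_spectrum])
  moreover have "log_capacity Z \<le> ennreal A" unfolding Z by (rule capacity_zero_set_le)
  moreover have "ennreal A \<le> log_capacity K" unfolding K by (rule capacity_supp_ge)
  ultimately show ?thesis using null by blast
qed

end
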